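(* Let $\Bbbk$ be a nonzero commutative ring, let $\chi\colon E\to H$ be a crossed module, and let $A=\{A_x\}_{x\in H}$ be a Hopf $\chi$-coalgebra over $\Bbbk$. Let $\mathrm{Mod}_\Bbbk$ be the category of $\Bbbk$-modules and let ${}_A^A\mathcal H$ be the category of Hopf $\chi$-modules over $A$. Then the functors $$A\otimes ?\colon \mathrm{Mod}_\Bbbk\to {}_A^A\mathcal H\quad\text{and}\quad ?^{\mathrm{co}A}\colon {}_A^A\mathcal H\to\mathrm{Mod}_\Bbbk$$ are equivalences and are quasi-inverse of each other. In particular, any Hopf $\chi$-module $M$ over $A$ is isomorphic to the trivial Hopf $\chi$-module $A\otimes M^{\mathrm{co}A}$.
   Context: All tensor products are over $\Bbbk$; $\sigma$ denotes the flip. **Crossed module.** A group homomorphism $\chi\colon E\to H$ with a left action $(x,e)\mapsto {}^{x}e$ of $H$ on $E$ by group automorphisms such that $\chi({}^{x}e)=x\chi(e)x^{-1}$ and ${}^{\chi(e)}f=efe^{-1}$ for all $x\in H$, $e,f\in E$. **Hopf $\chi$-coalgebra.** A family $A=\{A_x\}_{x\in H}$ of $\Bbbk$-algebras (products $\mu_x$, unit maps $\eta_x$, unit elements $1_x$) with algebra homomorphisms $\Delta_{x,y}\colon A_{xy}\to A_x\otimes A_y$ and $\varepsilon\colon A_1\to\Bbbk$ such that $(\Delta_{x,y}\otimes\mathrm{id})\Delta_{xy,z}=(\mathrm{id}\otimes\Delta_{y,z})\Delta_{x,yz}$ and $(\mathrm{id}\otimes\varepsilon)\Delta_{x,1}=\mathrm{id}_{A_x}=(\varepsilon\otimes\mathrm{id})\Delta_{1,x}$;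 with $\Bbbk$-linear isomorphisms $S_x\colon A_{x^{-1}}\to A_x$ with $\mu_x(S_x\otimes\mathrm{id})\Delta_{x^{-1},x}=\eta_x\varepsilon=\mu_x(\mathrm{id}\otimes S_x)\Delta_{x,x^{-1}}$; and with algebra homomorphisms $\phi_{x,e}\colon A_x\to A_{\chi(e)x}$ ($x\in H,e\in E$) such that $\phi_{x,1}=\mathrm{id}_{A_x}$, $\phi_{\chi(e)x,f}\,\phi_{x,e}=\phi_{x,fe}$, and $(\phi_{x,e}\otimes\phi_{y,f})\Delta_{x,y}=\Delta_{\chi(e)x,\chi(f)y}\,\phi_{xy,\,e\,{}^{x}f}$. **Hopf $\chi$-module over $A$.** A family $M=\{M_x\}_{x\in H}$ of $\Bbbk$-modules with families of $\Bbbk$-linear maps $r_x\colon A_x\otimes M_x\to M_x$, $\rho_{x,y}\colon M_{xy}\to A_x\otimes M_y$, $\psi_{x,e}\colon M_x\to M_{\chi(e)x}$ such that for all $x,y,z\in H$, $e,f\in E$: (a) $(M_x,r_x)$ is a left $A_x$-module; (b) $(\Delta_{x,y}\otimes\mathrm{id}_{M_z})\rho_{xy,z}=(\mathrm{id}_{A_x}\otimes\rho_{y,z})\rho_{x,yz}$ and $(\varepsilon\otimes\mathrm{id}_{M_x})\rho_{1,x}=\mathrm{id}_{M_x}$; (c) $\rho_{x,y}r_{xy}=(\mu_x\otimes r_y)(\mathrm{id}_{A_x}\otimes\sigma_{A_y,A_x}\otimes\mathrm{id}_{M_y})(\Delta_{x,y}\otimes\rho_{x,y})$; (d) $\psi_{x,1}=\mathrm{id}_{M_x}$,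 $\psi_{x,fe}=\psi_{\chi(e)x,f}\psi_{x,e}$, $\psi_{x,e}r_x=r_{\chi(e)x}(\phi_{x,e}\otimes\psi_{x,e})$, and $(\phi_{x,e}\otimes\psi_{y,f})\rho_{x,y}=\rho_{\chi(e)x,\chi(f)y}\,\psi_{xy,\,e\,{}^{x}f}$. A morphism $M\to M'$ of Hopf $\chi$-modules is a family of $\Bbbk$-linear maps $\theta_x\colon M_x\to M'_x$ with $r'_x(\mathrm{id}\otimes\theta_x)=\theta_xr_x$, $(\mathrm{id}\otimes\theta_y)\rho_{x,y}=\rho'_{x,y}\theta_{xy}$, $\theta_{\chi(e)x}\psi_{x,e}=\psi'_{x,e}\theta_x$; composition is componentwise. **Coinvariants.** $M^{\mathrm{co}A}$ is the submodule of $\prod_{x\in H}M_x$ of the elements $(m_x)_{x\in H}$ with $\rho_{x,y}(m_{xy})=1_x\otimes m_y$ and $\psi_{x,e}(m_x)=m_{\chi(e)x}$ for all $x,y\in H$, $e\in E$; on morphisms, $\theta^{\mathrm{co}A}((m_x)_x)=(\theta_x(m_x))_x$. **Trivial Hopf $\chi$-modules.** For a $\Bbbk$-module $V$, $A\otimes V$ is the Hopf $\chi$-module $\{A_x\otimes V\}_{x\in H}$ with $r_x=\mu_x\otimes\mathrm{id}_V$, $\rho_{x,y}=\Delta_{x,y}\otimes\mathrm{id}_V$, $\psi_{x,e}=\phi_{x,e}\otimes\mathrm{id}_V$; a linear map $\alpha\colon V\to W$ is sent to $\{\mathrm{id}_{A_x}\otimes\alpha\}_{x\in H}$. *)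

theory Defs
  imports "HOL-Algebra.AbelCoset" "HOL-Algebra.Module" "HOL-Library.Nat_Bijection"
begin

section \<open>Linear maps and algebras\<close>

definition linear_map ::
  "'k ring \<Rightarrow> ('k, 'a) module \<Rightarrow> ('k, 'b) module \<Rightarrow> ('a \<Rightarrow> 'b) \<Rightarrow> bool" where
  "linear_map K M N f \<longleftrightarrow>
     f \<in> carrier M \<rightarrow> carrier N \<and>
     (\<forall>x\<in>carrier M. \<forall>y\<in>carrier M. f (x \<oplus>\<^bsub>M\<^esub> y) = f x \<oplus>\<^bsub>N\<^esub> f y) \<and>
     (\<forall>c\<in>carrier K. \<forall>x\<in>carrier M. f (c \<odot>\<^bsub>M\<^esub> x) = c \<odot>\<^bsub>N\<^esub> f x)"

text \<open>Morphisms of a category have to be equal as soon as they agree on the carrier, hence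
  the hom-sets consist of extensional functions.\<close>

definition lin_hom ::
  "'k ring \<Rightarrow> ('k, 'a) module \<Rightarrow> ('k, 'b) module \<Rightarrow> ('a \<Rightarrow> 'b) set" where
  "lin_hom K M N = {f \<in> extensional (carrier M). linear_map K M N f}"

text \<open>The locale \<^locale>\<open>algebra\<close> of the library only covers commutative algebras; here
  algebras are associative and unital.  The zero algebra is allowed.\<close>

definition k_algebra :: "'k ring \<Rightarrow> ('k, 'a) module \<Rightarrow> bool" where
  "k_algebra K A \<longleftrightarrow> module K A \<and> ring A \<and>
     (\<forall>c\<in>carrier K. \<forall>a\<in>carrier A. \<forall>b\<in>carrier A.
        (c \<odot>\<^bsub>A\<^esub> a) \<otimes>\<^bsub>A\<^esub> b = c \<odot>\<^bsub>A\<^esub> (a \<otimes>\<^bsub>A\<^esub> b) \<and>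
        a \<otimes>\<^bsub>A\<^esub> (c \<odot>\<^bsub>A\<^esub> b) = c \<odot>\<^bsub>A\<^esub> (a \<otimes>\<^bsub>A\<^esub> b))"

definition algebra_hom ::
  "'k ring \<Rightarrow> ('k, 'a) module \<Rightarrow> ('k, 'b) module \<Rightarrow> ('a \<Rightarrow> 'b) \<Rightarrow> bool" where
  "algebra_hom K A B f \<longleftrightarrow> f \<in> ring_hom A B \<and> linear_map K A B f"

definition self_module :: "'k ring \<Rightarrow> ('k, 'k) module" where
  "self_module K = \<lparr>carrier = carrier K, mult = mult K, one = \<one>\<^bsub>K\<^esub>,
     zero = \<zero>\<^bsub>K\<^esub>, add = add K, smult = mult K\<rparr>"


section \<open>Tensor products\<close>

text \<open>The record type \<^type>\<open>module_ext\<close> of the library also has multiplicative fields.  They are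
  irrelevant for modules and left undefined in the constructions below, unless the module
  carries an algebra structure.\<close>

definition free_module :: "'k ring \<Rightarrow> 'x set \<Rightarrow> ('k, 'x \<Rightarrow> 'k) module" where
  "free_module K X =
     \<lparr>carrier = {f. (\<forall>x\<in>X. f x \<in> carrier K) \<and> (\<forall>x. x \<notin> X \<longrightarrow> f x = \<zero>\<^bsub>K\<^esub>)
                  \<and> finite {x. f x \<noteq> \<zero>\<^bsub>K\<^esub>}},
      mult = undefined, one = undefined,
      zero = (\<lambda>x. \<zero>\<^bsub>K\<^esub>),
      add = (\<lambda>f g x. f x \<oplus>\<^bsub>K\<^esub> g x),
      smult = (\<lambda>c f x. c \<otimes>\<^bsub>K\<^esub> f x)\<rparr>"

definition free_gen :: "'k ring \<Rightarrow> 'x \<Rightarrow> ('x \<Rightarrow> 'k)" where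
  "free_gen K x = (\<lambda>y. if y = x then \<one>\<^bsub>K\<^esub> else \<zero>\<^bsub>K\<^esub>)"

definition submodule_span :: "'k ring \<Rightarrow> ('k, 'a) module \<Rightarrow> 'a set \<Rightarrow> 'a set" where
  "submodule_span K M R = \<Inter>{U. submodule U K M \<and> R \<subseteq> U}"

text \<open>The tensor product is the free module on pairs modulo the submodule generated by the
  bilinearity relations; its elements are cosets.\<close>

type_synonym ('k, 'a, 'b) tens = "('a \<times> 'b \<Rightarrow> 'k) set"

abbreviation pair_module ::
  "'k ring \<Rightarrow> ('k, 'a) module \<Rightarrow> ('k, 'b) module \<Rightarrow> ('k, 'a \<times> 'b \<Rightarrow> 'k) module" where
  "pair_module K M N \<equiv> free_module K (carrier M \<times> carrier N)"

definition tensor_rel ::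
  "'k ring \<Rightarrow> ('k, 'a) module \<Rightarrow> ('k, 'b) module \<Rightarrow> ('a \<times> 'b \<Rightarrow> 'k) set" where
  "tensor_rel K M N = (let F = pair_module K M N; d = (\<lambda>m n. free_gen K (m, n)) in
     submodule_span K F
      ({d (m \<oplus>\<^bsub>M\<^esub> m') n \<ominus>\<^bsub>F\<^esub> (d m n \<oplus>\<^bsub>F\<^esub> d m' n) | m m' n.
          m \<in> carrier M \<and> m' \<in> carrier M \<and> n \<in> carrier N} \<union>
       {d m (n \<oplus>\<^bsub>N\<^esub> n') \<ominus>\<^bsub>F\<^esub> (d m n \<oplus>\<^bsub>F\<^esub> d m n') | m n n'.
          m \<in> carrier M \<and> n \<in> carrier N \<and> n' \<in> carrier N} \<union>
       {d (c \<odot>\<^bsub>M\<^esub> m) n \<ominus>\<^bsub>F\<^esub> (c \<odot>\<^bsub>F\<^esub> d m n) | c m n.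
          c \<in> carrier K \<and> m \<in> carrier M \<and> n \<in> carrier N} \<union>
       {d m (c \<odot>\<^bsub>N\<^esub> n) \<ominus>\<^bsub>F\<^esub> (c \<odot>\<^bsub>F\<^esub> d m n) | c m n.
          c \<in> carrier K \<and> m \<in> carrier M \<and> n \<in> carrier N}))"

definition tensor ::
  "'k ring \<Rightarrow> ('k, 'a) module \<Rightarrow> ('k, 'b) module \<Rightarrow> ('k, ('k, 'a, 'b) tens) module" where
  "tensor K M N = (let F = pair_module K M N; U = tensor_rel K M N in
     \<lparr>carrier = a_rcosets\<^bsub>F\<^esub> U,
      mult = undefined, one = undefined,
      zero = U,
      add = (\<lambda>C D. C <+>\<^bsub>F\<^esub> D),
      smult = (\<lambda>c C. \<Union>f\<in>C. U +>\<^bsub>F\<^esub> (c \<odot>\<^bsub>F\<^esub> f))\<rparr>)"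

definition pure ::
  "'k ring \<Rightarrow> ('k, 'a) module \<Rightarrow> ('k, 'b) module \<Rightarrow> 'a \<Rightarrow> 'b \<Rightarrow> ('k, 'a, 'b) tens" where
  "pure K M N m n = tensor_rel K M N +>\<^bsub>pair_module K M N\<^esub> free_gen K (m, n)"

text \<open>Defined through the universal property: for bilinear \<open>b\<close> there is exactly one such linear
  map on the tensor product; extensionality makes it unique as a function.\<close>

definition tensor_lift ::
  "'k ring \<Rightarrow> ('k, 'a) module \<Rightarrow> ('k, 'b) module \<Rightarrow> ('k, 'c) module \<Rightarrow>
     ('a \<Rightarrow> 'b \<Rightarrow> 'c) \<Rightarrow> ('k, 'a, 'b) tens \<Rightarrow> 'c" where
  "tensor_lift K M N P b = (THE h. h \<in> lin_hom K (tensor K M N) P \<and>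
     (\<forall>m\<in>carrier M. \<forall>n\<in>carrier N. h (pure K M N m n) = b m n))"

definition tensor_map ::
  "'k ring \<Rightarrow> ('k, 'a) module \<Rightarrow> ('k, 'b) module \<Rightarrow> ('k, 'c) module \<Rightarrow> ('k, 'd) module \<Rightarrow>
     ('a \<Rightarrow> 'c) \<Rightarrow> ('b \<Rightarrow> 'd) \<Rightarrow> ('k, 'a, 'b) tens \<Rightarrow> ('k, 'c, 'd) tens" where
  "tensor_map K M N M' N' f g =
     tensor_lift K M N (tensor K M' N') (\<lambda>m n. pure K M' N' (f m) (g n))"

text \<open>The canonical isomorphisms that are suppressed in informal notation:
  \<open>(M \<otimes> N) \<otimes> P \<cong> M \<otimes> (N \<otimes> P)\<close> and its inverse, \<open>K \<otimes> M \<cong> M\<close>, \<open>M \<otimes> K \<cong> M\<close>.\<close>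

definition tensor_assoc ::
  "'k ring \<Rightarrow> ('k, 'a) module \<Rightarrow> ('k, 'b) module \<Rightarrow> ('k, 'c) module \<Rightarrow>
     ('k, ('k, 'a, 'b) tens, 'c) tens \<Rightarrow> ('k, 'a, ('k, 'b, 'c) tens) tens" where
  "tensor_assoc K M N P = (let T = tensor K M (tensor K N P) in
     tensor_lift K (tensor K M N) P T
       (\<lambda>s p. tensor_lift K M N T (\<lambda>m n. pure K M (tensor K N P) m (pure K N P n p)) s))"

definition tensor_assoc_inv ::
  "'k ring \<Rightarrow> ('k, 'a) module \<Rightarrow> ('k, 'b) module \<Rightarrow> ('k, 'c) module \<Rightarrow>
     ('k, 'a, ('k, 'b, 'c) tens) tens \<Rightarrow> ('k, ('k, 'a, 'b) tens, 'c) tens" where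
  "tensor_assoc_inv K M N P = (let T = tensor K (tensor K M N) P in
     tensor_lift K M (tensor K N P) T
       (\<lambda>m s. tensor_lift K N P T (\<lambda>n p. pure K (tensor K M N) P (pure K M N m n) p) s))"

definition tensor_unit_left ::
  "'k ring \<Rightarrow> ('k, 'a) module \<Rightarrow> ('k, 'k, 'a) tens \<Rightarrow> 'a" where
  "tensor_unit_left K M = tensor_lift K (self_module K) M M (\<lambda>c m. c \<odot>\<^bsub>M\<^esub> m)"

definition tensor_unit_right ::
  "'k ring \<Rightarrow> ('k, 'a) module \<Rightarrow> ('k, 'a, 'k) tens \<Rightarrow> 'a" where
  "tensor_unit_right K M = tensor_lift K M (self_module K) M (\<lambda>m c. c \<odot>\<^bsub>M\<^esub> m)"

text \<open>\<open>id \<otimes> \<sigma> \<otimes> id\<close>, as the map \<open>(M \<otimes> N) \<otimes> (P \<otimes> Q) \<rightarrow> (M \<otimes> P) \<otimes> (N \<otimes> Q)\<close>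
  with \<open>(m \<otimes> n) \<otimes> (p \<otimes> q) \<mapsto> (m \<otimes> p) \<otimes> (n \<otimes> q)\<close>.\<close>

definition middle_flip ::
  "'k ring \<Rightarrow> ('k, 'a) module \<Rightarrow> ('k, 'b) module \<Rightarrow> ('k, 'c) module \<Rightarrow> ('k, 'd) module \<Rightarrow>
     ('k, ('k, 'a, 'b) tens, ('k, 'c, 'd) tens) tens \<Rightarrow>
     ('k, ('k, 'a, 'c) tens, ('k, 'b, 'd) tens) tens" where
  "middle_flip K M N P Q = (let T = tensor K (tensor K M P) (tensor K N Q) in
     tensor_lift K (tensor K M N) (tensor K P Q) T
       (\<lambda>s t. tensor_lift K M N T
         (\<lambda>m n. tensor_lift K P Q T
           (\<lambda>p q. pure K (tensor K M P) (tensor K N Q) (pure K M P m p) (pure K N Q n q)) t) s))"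

definition mult_map :: "'k ring \<Rightarrow> ('k, 'a) module \<Rightarrow> ('k, 'a, 'a) tens \<Rightarrow> 'a" where
  "mult_map K A = tensor_lift K A A A (\<lambda>a b. a \<otimes>\<^bsub>A\<^esub> b)"

definition tensor_algebra ::
  "'k ring \<Rightarrow> ('k, 'a) module \<Rightarrow> ('k, 'b) module \<Rightarrow> ('k, ('k, 'a, 'b) tens) module" where
  "tensor_algebra K A B = (tensor K A B)
     \<lparr>mult := (\<lambda>s t. tensor_map K (tensor K A A) (tensor K B B) A B (mult_map K A) (mult_map K B)
                (middle_flip K A B A B (pure K (tensor K A B) (tensor K A B) s t))),
      one := pure K A B \<one>\<^bsub>A\<^esub> \<one>\<^bsub>B\<^esub>\<rparr>"


section \<open>Crossed modules\<close>

record ('e, 'h) xmod =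
  XE :: "'e monoid"
  XH :: "'h monoid"
  bdry :: "'e \<Rightarrow> 'h"
  xact :: "'h \<Rightarrow> 'e \<Rightarrow> 'e"

locale crossed_module =
  fixes X :: "('e, 'h) xmod"
  assumes group_E: "group (XE X)"
    and group_H: "group (XH X)"
    and bdry_hom: "bdry X \<in> hom (XE X) (XH X)"
    and act_auto: "x \<in> carrier (XH X) \<Longrightarrow> xact X x \<in> iso (XE X) (XE X)"
    and act_one: "e \<in> carrier (XE X) \<Longrightarrow> xact X \<one>\<^bsub>XH X\<^esub> e = e"
    and act_mult: "\<lbrakk>x \<in> carrier (XH X); y \<in> carrier (XH X); e \<in> carrier (XE X)\<rbrakk> \<Longrightarrow>
          xact X (x \<otimes>\<^bsub>XH X\<^esub> y) e = xact X x (xact X y e)"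
    and equivariance: "\<lbrakk>x \<in> carrier (XH X); e \<in> carrier (XE X)\<rbrakk> \<Longrightarrow>
          bdry X (xact X x e) = x \<otimes>\<^bsub>XH X\<^esub> bdry X e \<otimes>\<^bsub>XH X\<^esub> inv\<^bsub>XH X\<^esub> x"
    and peiffer: "\<lbrakk>e \<in> carrier (XE X); f \<in> carrier (XE X)\<rbrakk> \<Longrightarrow>
          xact X (bdry X e) f = e \<otimes>\<^bsub>XE X\<^esub> f \<otimes>\<^bsub>XE X\<^esub> inv\<^bsub>XE X\<^esub> e"

text \<open>\<open>shift X e x\<close> is \<open>\<chi>(e)x\<close>, and \<open>twist X e x f\<close> is \<open>e \<cdot> \<^sup>xf\<close>.\<close>

definition shift :: "('e, 'h) xmod \<Rightarrow> 'e \<Rightarrow> 'h \<Rightarrow> 'h" where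
  "shift X e x = bdry X e \<otimes>\<^bsub>XH X\<^esub> x"

definition twist :: "('e, 'h) xmod \<Rightarrow> 'e \<Rightarrow> 'h \<Rightarrow> 'e \<Rightarrow> 'e" where
  "twist X e x f = e \<otimes>\<^bsub>XE X\<^esub> xact X x f"


section \<open>Hopf coalgebras over a crossed module\<close>

record ('k, 'h, 'e, 'a) hcoalg =
  alg :: "'h \<Rightarrow> ('k, 'a) module"
  comul :: "'h \<Rightarrow> 'h \<Rightarrow> 'a \<Rightarrow> ('k, 'a, 'a) tens"
  counit :: "'a \<Rightarrow> 'k"
  antipode :: "'h \<Rightarrow> 'a \<Rightarrow> 'a"
  phi :: "'h \<Rightarrow> 'e \<Rightarrow> 'a \<Rightarrow> 'a"

locale hopf_coalgebra = crossed_module X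
  for K :: "'k ring" and X :: "('e, 'h) xmod" and A :: "('k, 'h, 'e, 'a) hcoalg" +
  assumes algebras: "x \<in> carrier (XH X) \<Longrightarrow> k_algebra K (alg A x)"
    and comul_hom: "\<lbrakk>x \<in> carrier (XH X); y \<in> carrier (XH X)\<rbrakk> \<Longrightarrow>
      algebra_hom K (alg A (x \<otimes>\<^bsub>XH X\<^esub> y)) (tensor_algebra K (alg A x) (alg A y)) (comul A x y)"
    and counit_hom: "algebra_hom K (alg A \<one>\<^bsub>XH X\<^esub>) (self_module K) (counit A)"
    and coassoc:
      "\<lbrakk>x \<in> carrier (XH X); y \<in> carrier (XH X); z \<in> carrier (XH X);
        a \<in> carrier (alg A (x \<otimes>\<^bsub>XH X\<^esub> y \<otimes>\<^bsub>XH X\<^esub> z))\<rbrakk> \<Longrightarrow>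
       tensor_assoc K (alg A x) (alg A y) (alg A z)
         (tensor_map K (alg A (x \<otimes>\<^bsub>XH X\<^esub> y)) (alg A z) (tensor K (alg A x) (alg A y)) (alg A z)
           (comul A x y) id (comul A (x \<otimes>\<^bsub>XH X\<^esub> y) z a)) =
       tensor_map K (alg A x) (alg A (y \<otimes>\<^bsub>XH X\<^esub> z)) (alg A x) (tensor K (alg A y) (alg A z))
         id (comul A y z) (comul A x (y \<otimes>\<^bsub>XH X\<^esub> z) a)"
    and counit_right:
      "\<lbrakk>x \<in> carrier (XH X); a \<in> carrier (alg A x)\<rbrakk> \<Longrightarrow>
       tensor_unit_right K (alg A x)
         (tensor_map K (alg A x) (alg A \<one>\<^bsub>XH X\<^esub>) (alg A x) (self_module K)
           id (counit A) (comul A x \<one>\<^bsub>XH X\<^esub> a)) = a"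
    and counit_left:
      "\<lbrakk>x \<in> carrier (XH X); a \<in> carrier (alg A x)\<rbrakk> \<Longrightarrow>
       tensor_unit_left K (alg A x)
         (tensor_map K (alg A \<one>\<^bsub>XH X\<^esub>) (alg A x) (self_module K) (alg A x)
           (counit A) id (comul A \<one>\<^bsub>XH X\<^esub> x a)) = a"
    and antipode_linear: "x \<in> carrier (XH X) \<Longrightarrow>
       linear_map K (alg A (inv\<^bsub>XH X\<^esub> x)) (alg A x) (antipode A x)"
    and antipode_bij: "x \<in> carrier (XH X) \<Longrightarrow>
       bij_betw (antipode A x) (carrier (alg A (inv\<^bsub>XH X\<^esub> x))) (carrier (alg A x))"
    and antipode_left:
      "\<lbrakk>x \<in> carrier (XH X); a \<in> carrier (alg A \<one>\<^bsub>XH X\<^esub>)\<rbrakk> \<Longrightarrow>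
       mult_map K (alg A x)
         (tensor_map K (alg A (inv\<^bsub>XH X\<^esub> x)) (alg A x) (alg A x) (alg A x)
           (antipode A x) id (comul A (inv\<^bsub>XH X\<^esub> x) x a)) =
       counit A a \<odot>\<^bsub>alg A x\<^esub> \<one>\<^bsub>alg A x\<^esub>"
    and antipode_right:
      "\<lbrakk>x \<in> carrier (XH X); a \<in> carrier (alg A \<one>\<^bsub>XH X\<^esub>)\<rbrakk> \<Longrightarrow>
       mult_map K (alg A x)
         (tensor_map K (alg A x) (alg A (inv\<^bsub>XH X\<^esub> x)) (alg A x) (alg A x)
           id (antipode A x) (comul A x (inv\<^bsub>XH X\<^esub> x) a)) =
       counit A a \<odot>\<^bsub>alg A x\<^esub> \<one>\<^bsub>alg A x\<^esub>"
    and phi_hom: "\<lbrakk>x \<in> carrier (XH X); e \<in> carrier (XE X)\<rbrakk> \<Longrightarrow>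
       algebra_hom K (alg A x) (alg A (shift X e x)) (phi A x e)"
    and phi_one: "\<lbrakk>x \<in> carrier (XH X); a \<in> carrier (alg A x)\<rbrakk> \<Longrightarrow> phi A x \<one>\<^bsub>XE X\<^esub> a = a"
    and phi_mult:
      "\<lbrakk>x \<in> carrier (XH X); e \<in> carrier (XE X); f \<in> carrier (XE X); a \<in> carrier (alg A x)\<rbrakk> \<Longrightarrow>
       phi A (shift X e x) f (phi A x e a) = phi A x (f \<otimes>\<^bsub>XE X\<^esub> e) a"
    and phi_comul:
      "\<lbrakk>x \<in> carrier (XH X); y \<in> carrier (XH X); e \<in> carrier (XE X); f \<in> carrier (XE X);
        a \<in> carrier (alg A (x \<otimes>\<^bsub>XH X\<^esub> y))\<rbrakk> \<Longrightarrow>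
       tensor_map K (alg A x) (alg A y) (alg A (shift X e x)) (alg A (shift X f y))
         (phi A x e) (phi A y f) (comul A x y a) =
       comul A (shift X e x) (shift X f y) (phi A (x \<otimes>\<^bsub>XH X\<^esub> y) (twist X e x f) a)"


section \<open>Hopf modules\<close>

record ('k, 'h, 'e, 'a, 'm) hmod =
  modl :: "'h \<Rightarrow> ('k, 'm) module"
  hact :: "'h \<Rightarrow> ('k, 'a, 'm) tens \<Rightarrow> 'm"
  coact :: "'h \<Rightarrow> 'h \<Rightarrow> 'm \<Rightarrow> ('k, 'a, 'm) tens"
  psi :: "'h \<Rightarrow> 'e \<Rightarrow> 'm \<Rightarrow> 'm"

locale hopf_module =
  fixes K :: "'k ring" and X :: "('e, 'h) xmod" and A :: "('k, 'h, 'e, 'a) hcoalg"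
    and M :: "('k, 'h, 'e, 'a, 'm) hmod"
  assumes modules: "x \<in> carrier (XH X) \<Longrightarrow> module K (modl M x)"
    and hact_linear: "x \<in> carrier (XH X) \<Longrightarrow>
       linear_map K (tensor K (alg A x) (modl M x)) (modl M x) (hact M x)"
    and coact_linear: "\<lbrakk>x \<in> carrier (XH X); y \<in> carrier (XH X)\<rbrakk> \<Longrightarrow>
       linear_map K (modl M (x \<otimes>\<^bsub>XH X\<^esub> y)) (tensor K (alg A x) (modl M y)) (coact M x y)"
    and psi_linear: "\<lbrakk>x \<in> carrier (XH X); e \<in> carrier (XE X)\<rbrakk> \<Longrightarrow>
       linear_map K (modl M x) (modl M (shift X e x)) (psi M x e)"
    and hact_one: "\<lbrakk>x \<in> carrier (XH X); m \<in> carrier (modl M x)\<rbrakk> \<Longrightarrow>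
       hact M x (pure K (alg A x) (modl M x) \<one>\<^bsub>alg A x\<^esub> m) = m"
    and hact_mult:
      "\<lbrakk>x \<in> carrier (XH X); a \<in> carrier (alg A x); b \<in> carrier (alg A x);
        m \<in> carrier (modl M x)\<rbrakk> \<Longrightarrow>
       hact M x (pure K (alg A x) (modl M x) (a \<otimes>\<^bsub>alg A x\<^esub> b) m) =
       hact M x (pure K (alg A x) (modl M x) a (hact M x (pure K (alg A x) (modl M x) b m)))"
    and coact_coassoc:
      "\<lbrakk>x \<in> carrier (XH X); y \<in> carrier (XH X); z \<in> carrier (XH X);
        m \<in> carrier (modl M (x \<otimes>\<^bsub>XH X\<^esub> y \<otimes>\<^bsub>XH X\<^esub> z))\<rbrakk> \<Longrightarrow>
       tensor_assoc K (alg A x) (alg A y) (modl M z)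
         (tensor_map K (alg A (x \<otimes>\<^bsub>XH X\<^esub> y)) (modl M z) (tensor K (alg A x) (alg A y)) (modl M z)
           (comul A x y) id (coact M (x \<otimes>\<^bsub>XH X\<^esub> y) z m)) =
       tensor_map K (alg A x) (modl M (y \<otimes>\<^bsub>XH X\<^esub> z)) (alg A x) (tensor K (alg A y) (modl M z))
         id (coact M y z) (coact M x (y \<otimes>\<^bsub>XH X\<^esub> z) m)"
    and coact_counit:
      "\<lbrakk>x \<in> carrier (XH X); m \<in> carrier (modl M x)\<rbrakk> \<Longrightarrow>
       tensor_unit_left K (modl M x)
         (tensor_map K (alg A \<one>\<^bsub>XH X\<^esub>) (modl M x) (self_module K) (modl M x)
           (counit A) id (coact M \<one>\<^bsub>XH X\<^esub> x m)) = m"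
    and coact_hact:
      "\<lbrakk>x \<in> carrier (XH X); y \<in> carrier (XH X);
        t \<in> carrier (tensor K (alg A (x \<otimes>\<^bsub>XH X\<^esub> y)) (modl M (x \<otimes>\<^bsub>XH X\<^esub> y)))\<rbrakk> \<Longrightarrow>
       coact M x y (hact M (x \<otimes>\<^bsub>XH X\<^esub> y) t) =
       tensor_map K (tensor K (alg A x) (alg A x)) (tensor K (alg A y) (modl M y))
         (alg A x) (modl M y) (mult_map K (alg A x)) (hact M y)
         (middle_flip K (alg A x) (alg A y) (alg A x) (modl M y)
           (tensor_map K (alg A (x \<otimes>\<^bsub>XH X\<^esub> y)) (modl M (x \<otimes>\<^bsub>XH X\<^esub> y))
             (tensor K (alg A x) (alg A y)) (tensor K (alg A x) (modl M y))
             (comul A x y) (coact M x y) t))"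
    and psi_one: "\<lbrakk>x \<in> carrier (XH X); m \<in> carrier (modl M x)\<rbrakk> \<Longrightarrow> psi M x \<one>\<^bsub>XE X\<^esub> m = m"
    and psi_mult:
      "\<lbrakk>x \<in> carrier (XH X); e \<in> carrier (XE X); f \<in> carrier (XE X); m \<in> carrier (modl M x)\<rbrakk> \<Longrightarrow>
       psi M x (f \<otimes>\<^bsub>XE X\<^esub> e) m = psi M (shift X e x) f (psi M x e m)"
    and psi_hact:
      "\<lbrakk>x \<in> carrier (XH X); e \<in> carrier (XE X);
        t \<in> carrier (tensor K (alg A x) (modl M x))\<rbrakk> \<Longrightarrow>
       psi M x e (hact M x t) =
       hact M (shift X e x)
         (tensor_map K (alg A x) (modl M x) (alg A (shift X e x)) (modl M (shift X e x))
           (phi A x e) (psi M x e) t)"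
    and psi_coact:
      "\<lbrakk>x \<in> carrier (XH X); y \<in> carrier (XH X); e \<in> carrier (XE X); f \<in> carrier (XE X);
        m \<in> carrier (modl M (x \<otimes>\<^bsub>XH X\<^esub> y))\<rbrakk> \<Longrightarrow>
       tensor_map K (alg A x) (modl M y) (alg A (shift X e x)) (modl M (shift X f y))
         (phi A x e) (psi M y f) (coact M x y m) =
       coact M (shift X e x) (shift X f y) (psi M (x \<otimes>\<^bsub>XH X\<^esub> y) (twist X e x f) m)"

definition hmod_hom ::
  "'k ring \<Rightarrow> ('e, 'h) xmod \<Rightarrow> ('k, 'h, 'e, 'a) hcoalg \<Rightarrow>
     ('k, 'h, 'e, 'a, 'm) hmod \<Rightarrow> ('k, 'h, 'e, 'a, 'n) hmod \<Rightarrow> ('h \<Rightarrow> 'm \<Rightarrow> 'n) set" where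
  "hmod_hom K X A M M' = {\<theta> \<in> (\<Pi>\<^sub>E x\<in>carrier (XH X). lin_hom K (modl M x) (modl M' x)).
     (\<forall>x\<in>carrier (XH X). \<forall>t\<in>carrier (tensor K (alg A x) (modl M x)).
        hact M' x (tensor_map K (alg A x) (modl M x) (alg A x) (modl M' x) id (\<theta> x) t) =
        \<theta> x (hact M x t)) \<and>
     (\<forall>x\<in>carrier (XH X). \<forall>y\<in>carrier (XH X). \<forall>m\<in>carrier (modl M (x \<otimes>\<^bsub>XH X\<^esub> y)).
        tensor_map K (alg A x) (modl M y) (alg A x) (modl M' y) id (\<theta> y) (coact M x y m) =
        coact M' x y (\<theta> (x \<otimes>\<^bsub>XH X\<^esub> y) m)) \<and>
     (\<forall>x\<in>carrier (XH X). \<forall>e\<in>carrier (XE X). \<forall>m\<in>carrier (modl M x).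
        \<theta> (shift X e x) (psi M x e m) = psi M' x e (\<theta> x m))}"

text \<open>Isomorphy of Hopf modules whose elements may have different types.\<close>

definition hmod_isomorphic ::
  "'k ring \<Rightarrow> ('e, 'h) xmod \<Rightarrow> ('k, 'h, 'e, 'a) hcoalg \<Rightarrow>
     ('k, 'h, 'e, 'a, 'm) hmod \<Rightarrow> ('k, 'h, 'e, 'a, 'n) hmod \<Rightarrow> bool" where
  "hmod_isomorphic K X A M M' \<longleftrightarrow>
     (\<exists>\<theta>\<in>hmod_hom K X A M M'. \<exists>\<theta>'\<in>hmod_hom K X A M' M. \<forall>x\<in>carrier (XH X).
        (\<forall>m\<in>carrier (modl M x). \<theta>' x (\<theta> x m) = m) \<and>
        (\<forall>m\<in>carrier (modl M' x). \<theta> x (\<theta>' x m) = m))"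


section \<open>Coinvariants and trivial Hopf modules\<close>

definition coinv ::
  "'k ring \<Rightarrow> ('e, 'h) xmod \<Rightarrow> ('k, 'h, 'e, 'a) hcoalg \<Rightarrow>
     ('k, 'h, 'e, 'a, 'm) hmod \<Rightarrow> ('k, 'h \<Rightarrow> 'm) module" where
  "coinv K X A M =
     \<lparr>carrier = {m \<in> (\<Pi>\<^sub>E x\<in>carrier (XH X). carrier (modl M x)).
        (\<forall>x\<in>carrier (XH X). \<forall>y\<in>carrier (XH X).
           coact M x y (m (x \<otimes>\<^bsub>XH X\<^esub> y)) = pure K (alg A x) (modl M y) \<one>\<^bsub>alg A x\<^esub> (m y)) \<and>
        (\<forall>x\<in>carrier (XH X). \<forall>e\<in>carrier (XE X). psi M x e (m x) = m (shift X e x))},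
      mult = undefined, one = undefined,
      zero = (\<lambda>x\<in>carrier (XH X). \<zero>\<^bsub>modl M x\<^esub>),
      add = (\<lambda>m n. \<lambda>x\<in>carrier (XH X). m x \<oplus>\<^bsub>modl M x\<^esub> n x),
      smult = (\<lambda>c m. \<lambda>x\<in>carrier (XH X). c \<odot>\<^bsub>modl M x\<^esub> m x)\<rparr>"

definition coinv_map ::
  "'k ring \<Rightarrow> ('e, 'h) xmod \<Rightarrow> ('k, 'h, 'e, 'a) hcoalg \<Rightarrow> ('k, 'h, 'e, 'a, 'm) hmod \<Rightarrow>
     ('h \<Rightarrow> 'm \<Rightarrow> 'n) \<Rightarrow> ('h \<Rightarrow> 'm) \<Rightarrow> ('h \<Rightarrow> 'n)" where
  "coinv_map K X A M \<theta> = (\<lambda>m\<in>carrier (coinv K X A M). \<lambda>x\<in>carrier (XH X). \<theta> x (m x))"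

definition triv ::
  "'k ring \<Rightarrow> ('e, 'h) xmod \<Rightarrow> ('k, 'h, 'e, 'a) hcoalg \<Rightarrow> ('k, 'v) module \<Rightarrow>
     ('k, 'h, 'e, 'a, ('k, 'a, 'v) tens) hmod" where
  "triv K X A V =
     \<lparr>modl = (\<lambda>x. tensor K (alg A x) V),
      hact = (\<lambda>x t. tensor_map K (tensor K (alg A x) (alg A x)) V (alg A x) V
                (mult_map K (alg A x)) id (tensor_assoc_inv K (alg A x) (alg A x) V t)),
      coact = (\<lambda>x y t. tensor_assoc K (alg A x) (alg A y) V
                (tensor_map K (alg A (x \<otimes>\<^bsub>XH X\<^esub> y)) V (tensor K (alg A x) (alg A y)) V
                  (comul A x y) id t)),
      psi = (\<lambda>x e. tensor_map K (alg A x) V (alg A (shift X e x)) V (phi A x e) id)\<rparr>"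

definition triv_map ::
  "'k ring \<Rightarrow> ('e, 'h) xmod \<Rightarrow> ('k, 'h, 'e, 'a) hcoalg \<Rightarrow> ('k, 'v) module \<Rightarrow> ('k, 'w) module \<Rightarrow>
     ('v \<Rightarrow> 'w) \<Rightarrow> 'h \<Rightarrow> ('k, 'a, 'v) tens \<Rightarrow> ('k, 'a, 'w) tens" where
  "triv_map K X A V W \<alpha> =
     (\<lambda>x\<in>carrier (XH X). tensor_map K (alg A x) V (alg A x) W id \<alpha>)"


section \<open>Categories and equivalences\<close>

text \<open>\<open>Comp C a b c g f\<close> is the composite of \<open>f : a \<rightarrow> b\<close> and \<open>g : b \<rightarrow> c\<close>.\<close>

record ('o, 'm) cat =
  Ob :: "'o set"
  Hom :: "'o \<Rightarrow> 'o \<Rightarrow> 'm set"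
  Id :: "'o \<Rightarrow> 'm"
  Comp :: "'o \<Rightarrow> 'o \<Rightarrow> 'o \<Rightarrow> 'm \<Rightarrow> 'm \<Rightarrow> 'm"

locale is_category =
  fixes C :: "('o, 'm) cat"
  assumes id_in: "a \<in> Ob C \<Longrightarrow> Id C a \<in> Hom C a a"
    and comp_in: "\<lbrakk>a \<in> Ob C; b \<in> Ob C; c \<in> Ob C; f \<in> Hom C a b; g \<in> Hom C b c\<rbrakk> \<Longrightarrow>
          Comp C a b c g f \<in> Hom C a c"
    and comp_id_left: "\<lbrakk>a \<in> Ob C; b \<in> Ob C; f \<in> Hom C a b\<rbrakk> \<Longrightarrow> Comp C a b b (Id C b) f = f"
    and comp_id_right: "\<lbrakk>a \<in> Ob C; b \<in> Ob C; f \<in> Hom C a b\<rbrakk> \<Longrightarrow> Comp C a a b f (Id C a) = f"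
    and comp_assoc: "\<lbrakk>a \<in> Ob C; b \<in> Ob C; c \<in> Ob C; d \<in> Ob C;
          f \<in> Hom C a b; g \<in> Hom C b c; h \<in> Hom C c d\<rbrakk> \<Longrightarrow>
          Comp C a b d (Comp C b c d h g) f = Comp C a c d h (Comp C a b c g f)"

definition iso_arrow :: "('o, 'm) cat \<Rightarrow> 'o \<Rightarrow> 'o \<Rightarrow> 'm \<Rightarrow> bool" where
  "iso_arrow C a b f \<longleftrightarrow> f \<in> Hom C a b \<and>
     (\<exists>g\<in>Hom C b a. Comp C a b a g f = Id C a \<and> Comp C b a b f g = Id C b)"

text \<open>A functor acts on an arrow depending on its source and target.\<close>

record ('o, 'm, 'p, 'n) ftr =
  fobj :: "'o \<Rightarrow> 'p"
  farr :: "'o \<Rightarrow> 'o \<Rightarrow> 'm \<Rightarrow> 'n"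

locale is_functor = source: is_category C + target: is_category D
  for C :: "('o, 'm) cat" and D :: "('p, 'n) cat" and F :: "('o, 'm, 'p, 'n) ftr" +
  assumes fobj_in: "a \<in> Ob C \<Longrightarrow> fobj F a \<in> Ob D"
    and farr_in: "\<lbrakk>a \<in> Ob C; b \<in> Ob C; f \<in> Hom C a b\<rbrakk> \<Longrightarrow>
          farr F a b f \<in> Hom D (fobj F a) (fobj F b)"
    and farr_id: "a \<in> Ob C \<Longrightarrow> farr F a a (Id C a) = Id D (fobj F a)"
    and farr_comp: "\<lbrakk>a \<in> Ob C; b \<in> Ob C; c \<in> Ob C; f \<in> Hom C a b; g \<in> Hom C b c\<rbrakk> \<Longrightarrow>
          farr F a c (Comp C a b c g f) =
          Comp D (fobj F a) (fobj F b) (fobj F c) (farr F b c g) (farr F a b f)"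

definition id_ftr :: "('o, 'm, 'o, 'm) ftr" where
  "id_ftr = \<lparr>fobj = (\<lambda>a. a), farr = (\<lambda>a b f. f)\<rparr>"

definition comp_ftr ::
  "('p, 'n, 'q, 'l) ftr \<Rightarrow> ('o, 'm, 'p, 'n) ftr \<Rightarrow> ('o, 'm, 'q, 'l) ftr" where
  "comp_ftr G F = \<lparr>fobj = (\<lambda>a. fobj G (fobj F a)),
     farr = (\<lambda>a b f. farr G (fobj F a) (fobj F b) (farr F a b f))\<rparr>"

definition nat_isomorphic ::
  "('o, 'm) cat \<Rightarrow> ('p, 'n) cat \<Rightarrow> ('o, 'm, 'p, 'n) ftr \<Rightarrow> ('o, 'm, 'p, 'n) ftr \<Rightarrow> bool" where
  "nat_isomorphic C D F G \<longleftrightarrow> is_functor C D F \<and> is_functor C D G \<and>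
     (\<exists>\<tau>. (\<forall>a\<in>Ob C. iso_arrow D (fobj F a) (fobj G a) (\<tau> a)) \<and>
          (\<forall>a\<in>Ob C. \<forall>b\<in>Ob C. \<forall>f\<in>Hom C a b.
             Comp D (fobj F a) (fobj F b) (fobj G b) (\<tau> b) (farr F a b f) =
             Comp D (fobj F a) (fobj G a) (fobj G b) (farr G a b f) (\<tau> a)))"

definition quasi_inverse ::
  "('o, 'm) cat \<Rightarrow> ('p, 'n) cat \<Rightarrow> ('o, 'm, 'p, 'n) ftr \<Rightarrow> ('p, 'n, 'o, 'm) ftr \<Rightarrow> bool" where
  "quasi_inverse C D F G \<longleftrightarrow> is_functor C D F \<and> is_functor D C G \<and>
     nat_isomorphic C C id_ftr (comp_ftr G F) \<and> nat_isomorphic D D (comp_ftr F G) id_ftr"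

definition is_equivalence ::
  "('o, 'm) cat \<Rightarrow> ('p, 'n) cat \<Rightarrow> ('o, 'm, 'p, 'n) ftr \<Rightarrow> bool" where
  "is_equivalence C D F \<longleftrightarrow> (\<exists>G. quasi_inverse C D F G)"


section \<open>The two categories and the two functors\<close>

text \<open>A type \<open>'u\<close> plays the role of a universe: all modules in the categories have elements in
  \<open>'u\<close>.\<close>

definition Mod_cat :: "'k ring \<Rightarrow> (('k, 'u) module, 'u \<Rightarrow> 'u) cat" where
  "Mod_cat K =
     \<lparr>Ob = {V. module K V},
      Hom = lin_hom K,
      Id = (\<lambda>V. \<lambda>v\<in>carrier V. v),
      Comp = (\<lambda>U V W g f. compose (carrier U) g f)\<rparr>"

definition HMod_cat ::
  "'k ring \<Rightarrow> ('e, 'h) xmod \<Rightarrow> ('k, 'h, 'e, 'a) hcoalg \<Rightarrow>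
     (('k, 'h, 'e, 'a, 'u) hmod, 'h \<Rightarrow> 'u \<Rightarrow> 'u) cat" where
  "HMod_cat K X A =
     \<lparr>Ob = {M. hopf_module K X A M},
      Hom = hmod_hom K X A,
      Id = (\<lambda>M. \<lambda>x\<in>carrier (XH X). \<lambda>m\<in>carrier (modl M x). m),
      Comp = (\<lambda>L M N \<eta> \<theta>. \<lambda>x\<in>carrier (XH X). compose (carrier (modl L x)) (\<eta> x) (\<theta> x))\<rparr>"

text \<open>The elements of \<open>A\<^sub>x \<otimes> V\<close> are sets of functions and the coinvariants are families, so that
  \<^const>\<open>triv\<close> and \<^const>\<open>coinv\<close> leave the type \<open>'u\<close>.  To obtain functors between the categories
  above, their results are replaced by copies with elements in \<open>'u\<close>, along an arbitrarily chosen
  injection of the carrier into \<open>'u\<close> (which exists if \<open>'u\<close> is large enough).\<close>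

definition code :: "'x set \<Rightarrow> 'x \<Rightarrow> 'u" where
  "code S = (SOME j. inj_on j S)"

definition decode :: "'x set \<Rightarrow> 'u \<Rightarrow> 'x" where
  "decode S = inv_into S (code S)"

definition copy_module :: "('k, 'x) module \<Rightarrow> ('k, 'u) module" where
  "copy_module M = (let c = code (carrier M); d = decode (carrier M) in
     \<lparr>carrier = c ` carrier M,
      mult = undefined, one = undefined,
      zero = c \<zero>\<^bsub>M\<^esub>,
      add = (\<lambda>u v. c (d u \<oplus>\<^bsub>M\<^esub> d v)),
      smult = (\<lambda>k u. c (k \<odot>\<^bsub>M\<^esub> d u))\<rparr>)"

definition copy_map ::
  "('k, 'x) module \<Rightarrow> ('k, 'y) module \<Rightarrow> ('x \<Rightarrow> 'y) \<Rightarrow> 'u \<Rightarrow> 'u" where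
  "copy_map M N f = (\<lambda>u\<in>code (carrier M) ` carrier M.
     code (carrier N) (f (decode (carrier M) u)))"

definition copy_hmod ::
  "'k ring \<Rightarrow> ('e, 'h) xmod \<Rightarrow> ('k, 'h, 'e, 'a) hcoalg \<Rightarrow>
     ('k, 'h, 'e, 'a, 'x) hmod \<Rightarrow> ('k, 'h, 'e, 'a, 'u) hmod" where
  "copy_hmod K X A M =
     (let N = (\<lambda>x. copy_module (modl M x));
          c = (\<lambda>x. code (carrier (modl M x)));
          d = (\<lambda>x. decode (carrier (modl M x))) in
     \<lparr>modl = N,
      hact = (\<lambda>x t. c x (hact M x
                (tensor_map K (alg A x) (N x) (alg A x) (modl M x) id (d x) t))),
      coact = (\<lambda>x y u. tensor_map K (alg A x) (modl M y) (alg A x) (N y) id (c y)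
                (coact M x y (d (x \<otimes>\<^bsub>XH X\<^esub> y) u))),
      psi = (\<lambda>x e u. c (shift X e x) (psi M x e (d x u)))\<rparr>)"

definition triv_functor ::
  "'k ring \<Rightarrow> ('e, 'h) xmod \<Rightarrow> ('k, 'h, 'e, 'a) hcoalg \<Rightarrow>
     (('k, 'u) module, 'u \<Rightarrow> 'u, ('k, 'h, 'e, 'a, 'u) hmod, 'h \<Rightarrow> 'u \<Rightarrow> 'u) ftr" where
  "triv_functor K X A =
     \<lparr>fobj = (\<lambda>V. copy_hmod K X A (triv K X A V)),
      farr = (\<lambda>V W \<alpha>. \<lambda>x\<in>carrier (XH X).
        copy_map (tensor K (alg A x) V) (tensor K (alg A x) W) (triv_map K X A V W \<alpha> x))\<rparr>"

definition coinv_functor ::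
  "'k ring \<Rightarrow> ('e, 'h) xmod \<Rightarrow> ('k, 'h, 'e, 'a) hcoalg \<Rightarrow>
     (('k, 'h, 'e, 'a, 'u) hmod, 'h \<Rightarrow> 'u \<Rightarrow> 'u, ('k, 'u) module, 'u \<Rightarrow> 'u) ftr" where
  "coinv_functor K X A =
     \<lparr>fobj = (\<lambda>M. copy_module (coinv K X A M)),
      farr = (\<lambda>M M' \<theta>. copy_map (coinv K X A M) (coinv K X A M') (coinv_map K X A M \<theta>))\<rparr>"

text \<open>Large enough means: there are injections into \<open>'u\<close> of the families \<open>'h \<Rightarrow> 'u\<close> and of the
  formal linear combinations of pairs in \<open>'a \<times> 'u\<close> with coefficients in \<open>'k\<close>, by which all
  tensors are represented.  Such universes exist for all \<open>'k\<close>, \<open>'h\<close>, \<open>'a\<close>, and they can be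
  chosen to contain a copy of any given type \<open>'b\<close>.\<close>

type_synonym ('k, 'h, 'a, 'b) univ = "nat \<times> 'h list \<Rightarrow> 'b + 'a + 'k + nat"

lemma universe_exists:
  "\<exists>(cf :: ('h \<Rightarrow> ('k, 'h, 'a, 'b) univ) \<Rightarrow> ('k, 'h, 'a, 'b) univ)
    (cl :: (('a \<times> ('k, 'h, 'a, 'b) univ) \<times> 'k) list \<Rightarrow> ('k, 'h, 'a, 'b) univ)
    (cb :: 'b \<Rightarrow> ('k, 'h, 'a, 'b) univ). inj cf \<and> inj cl \<and> inj cb"
proof -
  let ?n = "\<lambda>i. Inr (Inr (Inr i)) :: 'b + 'a + 'k + nat"
  define cf where "cf = (\<lambda>(g :: 'h \<Rightarrow> ('k, 'h, 'a, 'b) univ) (p :: nat \<times> 'h list).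
    case snd p of [] \<Rightarrow> ?n 0 | h # t \<Rightarrow> g h (fst p, t))"
  define cl where "cl = (\<lambda>(l :: (('a \<times> ('k, 'h, 'a, 'b) univ) \<times> 'k) list) (p :: nat \<times> 'h list).
    case fst p of 0 \<Rightarrow> ?n (length l)
    | Suc q \<Rightarrow> (case prod_decode q of (i, r) \<Rightarrow>
        if i < length l then
          (case r of 0 \<Rightarrow> Inr (Inl (fst (fst (l ! i))))
           | Suc s \<Rightarrow> (case s of 0 \<Rightarrow> Inr (Inr (Inl (snd (l ! i))))
              | Suc j \<Rightarrow> snd (fst (l ! i)) (j, snd p)))
        else ?n 0))"
  have "inj cf"
  proof (rule injI, intro ext)
    fix g g' h and p :: "nat \<times> 'h list"
    assume "cf g = cf g'"
    then have "cf g (fst p, h # snd p) = cf g' (fst p, h # snd p)" by simp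
    then show "g h p = g' h p" by (simp add: cf_def)
  qed
  moreover have "inj cl"
  proof (rule injI)
    fix l l' assume eq: "cl l = cl l'"
    then have "cl l (0, []) = cl l' (0, [])" by simp
    then have len: "length l = length l'" by (simp add: cl_def)
    show "l = l'"
    proof (rule nth_equalityI[OF len])
      fix i assume i: "i < length l"
      have e: "cl l (Suc (prod_encode (i, r)), t) = cl l' (Suc (prod_encode (i, r)), t)" for r t
        using eq by simp
      have "fst (fst (l ! i)) = fst (fst (l' ! i))"
        using e[of 0 "[]"] i len by (simp add: cl_def)
      moreover have "snd (l ! i) = snd (l' ! i)"
        using e[of 1 "[]"] i len by (simp add: cl_def)
      moreover have "snd (fst (l ! i)) = snd (fst (l' ! i))"
      proof
        fix p show "snd (fst (l ! i)) p = snd (fst (l' ! i)) p"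
          using e[of "Suc (Suc (fst p))" "snd p"] i len by (simp add: cl_def)
      qed
      ultimately show "l ! i = l' ! i" by (simp add: prod_eq_iff)
    qed
  qed
  moreover have "inj (\<lambda>b (_ :: nat \<times> 'h list). Inl b :: 'b + 'a + 'k + nat)"
    by (rule injI) (metis sum.inject(1))
  ultimately show ?thesis by blast
qed

end

theory Submission
  imports Defs
begin

text \<open>For a Hopf module \<open>M\<close> and \<open>m \<in> M\<^sub>1\<close> write \<open>\<rho>(m) = \<Sum> m' \<otimes> m''\<close> at \<open>(x\<inverse>, x)\<close> and put
  \<open>P\<^sub>x(m) = \<Sum> S\<^sub>x(m') m''\<close>.  Coassociativity and the antipode axiom give \<open>m = \<Sum> m' P\<^sub>x(m'')\<close> for
  \<open>m \<in> M\<^sub>x\<close>, with \<open>\<rho>\<close> at \<open>(x, 1)\<close>.  A linear map \<open>F\<close> from \<open>M\<^sub>1\<close> to an \<open>A\<^sub>z\<close>-module is determined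
      by the
  map \<open>m \<mapsto> \<Sum> m' F(m'')\<close> on \<open>M\<^sub>z\<close>; comparing such maps shows that the family \<open>P(m) = (P\<^sub>x(m))\<^sub>x\<close> is
  coinvariant.  Hence \<open>m \<mapsto> \<Sum> m' \<otimes> P(m'')\<close> is inverse to the natural map \<open>a \<otimes> m \<mapsto> a m\<^sub>x\<close> from
  \<open>A \<otimes> M\<^sup>c\<^sup>o\<^sup>A\<close> to \<open>M\<close>.  In the other direction \<open>v \<mapsto> (1\<^sub>x \<otimes> v)\<^sub>x\<close> is an isomorphism from \<open>V\<close> to
  \<open>(A \<otimes> V)\<^sup>c\<^sup>o\<^sup>A\<close>, with inverse \<open>t \<mapsto> (\<epsilon> \<otimes> id)(t\<^sub>1)\<close>.\<close>

section \<open>Linear and bilinear maps\<close>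

text \<open>That P(m) is coinvariant amounts to two equations between linear maps out of M_1, and
  each is settled by an action chosen for it: the algebra at xy acts on A_x \<otimes> M_y through
  \<Delta>, and the algebra at x acts on M at \<chi>(e)x through \<phi>. With these actions both
  sides of an equation induce the same known map, \<rho> or \<psi>, and so agree. Sweedler sums are
  only a guide: a coproduct is a coset, not a list of pure tensors. A sum formula becomes an
  equation between linear maps on a tensor product and is checked on pure tensors; any coproduct
  that then appears is generalised to an arbitrary tensor \<open>s\<close> and treated in the same
  way. The other obstacle is typing. A \<otimes> V and the coinvariants have element types different
  from those of V and M. The algebra is therefore done for \<open>triv\<close> and
  \<open>coinv\<close> at arbitrary types, and the functors within the universe are obtained by
  conjugating with \<open>code\<close> and \<open>decode\<close>, which requires that the axioms of
  a Hopf module can be carried along bijections.\<close>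

lemma linear_mapI:
  assumes "\<And>x. x \<in> carrier M \<Longrightarrow> f x \<in> carrier N"
    and "\<And>x y. \<lbrakk>x \<in> carrier M; y \<in> carrier M\<rbrakk> \<Longrightarrow> f (x \<oplus>\<^bsub>M\<^esub> y) = f x \<oplus>\<^bsub>N\<^esub> f y"
    and "\<And>c x. \<lbrakk>c \<in> carrier K; x \<in> carrier M\<rbrakk> \<Longrightarrow> f (c \<odot>\<^bsub>M\<^esub> x) = c \<odot>\<^bsub>N\<^esub> f x"
  shows "linear_map K M N f"
  using assms by (auto simp: linear_map_def)

lemma linear_map_closed: "\<lbrakk>linear_map K M N f; x \<in> carrier M\<rbrakk> \<Longrightarrow> f x \<in> carrier N"
  by (auto simp: linear_map_def)

lemma linear_map_add:
  "\<lbrakk>linear_map K M N f; x \<in> carrier M; y \<in> carrier M\<rbrakk> \<Longrightarrow> f (x \<oplus>\<^bsub>M\<^esub> y) = f x \<oplus>\<^bsub>N\<^esub> f y"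
  by (auto simp: linear_map_def)

lemma linear_map_smult:
  "\<lbrakk>linear_map K M N f; c \<in> carrier K; x \<in> carrier M\<rbrakk> \<Longrightarrow> f (c \<odot>\<^bsub>M\<^esub> x) = c \<odot>\<^bsub>N\<^esub> f x"
  by (auto simp: linear_map_def)

lemma module_abelian_group: "module K M \<Longrightarrow> abelian_group M"
  by (simp add: module_def)

lemma linear_map_zero:
  assumes "linear_map K M N f" "module K M" "module K N"
  shows "f \<zero>\<^bsub>M\<^esub> = \<zero>\<^bsub>N\<^esub>"
proof -
  interpret M: module K M by fact
  interpret N: module K N by fact
  have "f (\<zero>\<^bsub>K\<^esub> \<odot>\<^bsub>M\<^esub> \<zero>\<^bsub>M\<^esub>) = \<zero>\<^bsub>K\<^esub> \<odot>\<^bsub>N\<^esub> f \<zero>\<^bsub>M\<^esub>"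
    using assms(1) by (rule linear_map_smult) auto
  then show ?thesis using linear_map_closed[OF assms(1), of "\<zero>\<^bsub>M\<^esub>"] by simp
qed

lemma linear_map_minus:
  assumes f: "linear_map K M N f" and M: "module K M" and N: "module K N"
    and x: "x \<in> carrier M"
  shows "f (\<ominus>\<^bsub>M\<^esub> x) = \<ominus>\<^bsub>N\<^esub> f x"
proof -
  interpret M: module K M by fact
  interpret N: module K N by fact
  have "f (\<ominus>\<^bsub>M\<^esub> x) \<oplus>\<^bsub>N\<^esub> f x = f (\<ominus>\<^bsub>M\<^esub> x \<oplus>\<^bsub>M\<^esub> x)"
    using x by (simp add: linear_map_add[OF f])
  also have "\<dots> = \<zero>\<^bsub>N\<^esub>" using x by (simp add: M.l_neg linear_map_zero[OF f M N])
  finally show ?thesis using x linear_map_closed[OF f]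
    by (metis M.a_inv_closed N.minus_equality)
qed

lemma linear_map_comp:
  assumes "linear_map K N P g" "linear_map K M N f"
  shows "linear_map K M P (\<lambda>x. g (f x))"
  using assms by (auto simp: linear_map_def Pi_iff)

lemma linear_map_ident [simp]: "linear_map K M M (\<lambda>x. x)"
  by (simp add: linear_map_def)

lemma linear_map_id [simp]: "linear_map K M M id"
  by (simp add: linear_map_def)

lemma linear_map_cong:
  assumes "linear_map K M N f" "module K M" "\<And>x. x \<in> carrier M \<Longrightarrow> f x = g x"
  shows "linear_map K M N g"
proof -
  interpret M: module K M by fact
  show ?thesis using assms(1,3) by (auto simp: linear_map_def Pi_iff)
qed

lemma linear_map_inv_into:
  assumes f: "linear_map K M N f" and bij: "bij_betw f (carrier M) (carrier N)"
    and M: "module K M"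
  shows "linear_map K N M (inv_into (carrier M) f)"
proof -
  interpret M: module K M by fact
  have inj: "inj_on f (carrier M)" and im: "f ` carrier M = carrier N"
    using bij by (auto simp: bij_betw_def)
  show ?thesis
    unfolding linear_map_def im[symmetric]
    by (auto simp: inj linear_map_add[OF f, symmetric] linear_map_smult[OF f, symmetric])
qed

definition bilinear_map ::
  "'k ring \<Rightarrow> ('k, 'a) module \<Rightarrow> ('k, 'b) module \<Rightarrow> ('k, 'c) module \<Rightarrow> ('a \<Rightarrow> 'b \<Rightarrow> 'c) \<Rightarrow> bool" where
  "bilinear_map K M N P b \<longleftrightarrow>
     (\<forall>m\<in>carrier M. linear_map K N P (b m)) \<and> (\<forall>n\<in>carrier N. linear_map K M P (\<lambda>m. b m n))"

lemma bilinear_mapI: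
  assumes "\<And>m. m \<in> carrier M \<Longrightarrow> linear_map K N P (b m)"
    and "\<And>n. n \<in> carrier N \<Longrightarrow> linear_map K M P (\<lambda>m. b m n)"
  shows "bilinear_map K M N P b"
  using assms by (simp add: bilinear_map_def)


section \<open>Free modules\<close>

lemma free_module_simps:
  "zero (free_module K X) = (\<lambda>x. \<zero>\<^bsub>K\<^esub>)"
  "add (free_module K X) = (\<lambda>f g x. f x \<oplus>\<^bsub>K\<^esub> g x)"
  "smult (free_module K X) = (\<lambda>c f x. c \<otimes>\<^bsub>K\<^esub> f x)"
  by (simp_all add: free_module_def)

lemma free_module_carrier:
  "f \<in> carrier (free_module K X) \<longleftrightarrow>
     (\<forall>x\<in>X. f x \<in> carrier K) \<and> (\<forall>x. x \<notin> X \<longrightarrow> f x = \<zero>\<^bsub>K\<^esub>) \<and> finite {x. f x \<noteq> \<zero>\<^bsub>K\<^esub>}"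
  by (simp add: free_module_def)

lemma free_module_value: "cring K \<Longrightarrow> f \<in> carrier (free_module K X) \<Longrightarrow> f x \<in> carrier K"
  by (metis free_module_carrier cring.cring_simprules(2))

lemma free_module_module:
  assumes "cring K" shows "module K (free_module K X)"
proof -
  interpret cring K by fact
  let ?F = "free_module K X"
  note val = free_module_value[OF assms]
  have fin: "finite {x. h x \<noteq> \<zero>\<^bsub>K\<^esub>}"
    if "f \<in> carrier ?F" "g \<in> carrier ?F" "\<And>x. f x = \<zero>\<^bsub>K\<^esub> \<Longrightarrow> g x = \<zero>\<^bsub>K\<^esub> \<Longrightarrow> h x = \<zero>\<^bsub>K\<^esub>" for f g h
  proof (rule finite_subset)
    show "{x. h x \<noteq> \<zero>\<^bsub>K\<^esub>} \<subseteq> {x. f x \<noteq> \<zero>\<^bsub>K\<^esub>} \<union> {x. g x \<noteq> \<zero>\<^bsub>K\<^esub>}"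
      using that(3) by blast
    show "finite ({x. f x \<noteq> \<zero>\<^bsub>K\<^esub>} \<union> {x. g x \<noteq> \<zero>\<^bsub>K\<^esub>})"
      using that(1,2) by (simp add: free_module_carrier)
  qed
  have add_cl: "(\<lambda>x. f x \<oplus>\<^bsub>K\<^esub> g x) \<in> carrier ?F" if "f \<in> carrier ?F" "g \<in> carrier ?F" for f g
    using that fin[OF that, of "\<lambda>x. f x \<oplus>\<^bsub>K\<^esub> g x"] by (auto simp: free_module_carrier)
  have neg_cl: "(\<lambda>x. \<ominus>\<^bsub>K\<^esub> f x) \<in> carrier ?F" if "f \<in> carrier ?F" for f
    using that fin[OF that that, of "\<lambda>x. \<ominus>\<^bsub>K\<^esub> f x"] by (auto simp: free_module_carrier)
  have smult_cl: "(\<lambda>x. c \<otimes>\<^bsub>K\<^esub> f x) \<in> carrier ?F" if "c \<in> carrier K" "f \<in> carrier ?F" for c f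
    using that fin[OF that(2,2), of "\<lambda>x. c \<otimes>\<^bsub>K\<^esub> f x"] by (auto simp: free_module_carrier)
  show ?thesis
  proof (rule moduleI[OF assms])
    show "abelian_group ?F"
    proof (rule abelian_groupI)
      fix f assume f: "f \<in> carrier ?F"
      show "\<exists>g\<in>carrier ?F. g \<oplus>\<^bsub>?F\<^esub> f = \<zero>\<^bsub>?F\<^esub>"
        using neg_cl[OF f] by (intro bexI[of _ "\<lambda>x. \<ominus>\<^bsub>K\<^esub> f x"])
          (auto simp: free_module_simps l_neg val[OF f])
    qed (auto simp: free_module_simps add_cl free_module_carrier[of "\<lambda>x. \<zero>\<^bsub>K\<^esub>"] val
        intro!: ext a_assoc a_comm)
  qed (auto simp: free_module_simps smult_cl val l_distr r_distr m_assoc)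
qed

lemma free_gen_in: "cring K \<Longrightarrow> x \<in> X \<Longrightarrow> free_gen K x \<in> carrier (free_module K X)"
proof -
  assume "cring K" "x \<in> X"
  interpret cring K by fact
  have "finite {y. free_gen K x y \<noteq> \<zero>\<^bsub>K\<^esub>}"
    by (rule finite_subset[of _ "{x}"]) (auto simp: free_gen_def)
  then show ?thesis using \<open>x \<in> X\<close> by (auto simp: free_module_carrier) (auto simp: free_gen_def)
qed

text \<open>Induction over a finite set containing the support: removing an element from the set
  corresponds to clearing one value of \<open>f\<close>, and a value that is already zero costs
  nothing.\<close>

lemma free_module_induct:
  assumes K: "cring K" and f: "f \<in> carrier (free_module K X)"
    and zero: "Q (\<lambda>x. \<zero>\<^bsub>K\<^esub>)"
    and gen: "\<And>c x. \<lbrakk>c \<in> carrier K; x \<in> X\<rbrakk> \<Longrightarrow> Q (c \<odot>\<^bsub>free_module K X\<^esub> free_gen K x)"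
    and add: "\<And>f g. \<lbrakk>f \<in> carrier (free_module K X); g \<in> carrier (free_module K X); Q f; Q g\<rbrakk>
       \<Longrightarrow> Q (f \<oplus>\<^bsub>free_module K X\<^esub> g)"
  shows "Q f"
proof -
  interpret cring K by fact
  let ?F = "free_module K X"
  interpret F: module K ?F by (rule free_module_module[OF K])
  have "finite {x. f x \<noteq> \<zero>\<^bsub>K\<^esub>}" using f by (simp add: free_module_carrier)
  moreover have "finite S \<Longrightarrow> {x. f x \<noteq> \<zero>\<^bsub>K\<^esub>} \<subseteq> S \<Longrightarrow> f \<in> carrier ?F \<Longrightarrow> Q f" for S f
  proof (induction S arbitrary: f rule: finite_induct)
    case empty
    then have "f = (\<lambda>x. \<zero>\<^bsub>K\<^esub>)" by auto
    then show ?case using zero by simp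
  next
    case (insert s S)
    show ?case
    proof (cases "f s = \<zero>\<^bsub>K\<^esub>")
      case True
      then show ?thesis using insert.prems by (intro insert.IH) auto
    next
      case False
      then have s: "s \<in> X" using insert.prems(2) by (auto simp: free_module_carrier)
      let ?g = "f(s := \<zero>\<^bsub>K\<^esub>)"
      have fs: "f s \<in> carrier K" using insert.prems(2) s by (auto simp: free_module_carrier)
      have "finite {x. ?g x \<noteq> \<zero>\<^bsub>K\<^esub>}"
        using insert.prems(2) by (auto simp: free_module_carrier elim!: finite_subset[rotated])
      then have g: "?g \<in> carrier ?F" using insert.prems(2) by (auto simp: free_module_carrier)
      have "Q ?g" using insert.prems(1) by (intro insert.IH[OF _ g]) auto
      moreover have "f s \<odot>\<^bsub>?F\<^esub> free_gen K s \<in> carrier ?F"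
        using fs free_gen_in[OF K s] by simp
      ultimately have "Q (f s \<odot>\<^bsub>?F\<^esub> free_gen K s \<oplus>\<^bsub>?F\<^esub> ?g)" using g gen[OF fs s] add by blast
      moreover have "f s \<odot>\<^bsub>?F\<^esub> free_gen K s \<oplus>\<^bsub>?F\<^esub> ?g = f"
        using fs free_module_value[OF K insert.prems(2)]
        by (auto simp: free_module_simps free_gen_def)
      ultimately show ?thesis by simp
    qed
  qed
  ultimately show ?thesis using f by blast
qed

definition free_lift :: "'k ring \<Rightarrow> ('k, 'c) module \<Rightarrow> ('x \<Rightarrow> 'c) \<Rightarrow> ('x \<Rightarrow> 'k) \<Rightarrow> 'c" where
  "free_lift K P g f = (\<Oplus>\<^bsub>P\<^esub>x\<in>{x. f x \<noteq> \<zero>\<^bsub>K\<^esub>}. f x \<odot>\<^bsub>P\<^esub> g x)"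

lemma free_lift_linear:
  assumes K: "cring K" and P: "module K P" and g: "\<And>x. x \<in> X \<Longrightarrow> g x \<in> carrier P"
  shows "linear_map K (free_module K X) P (free_lift K P g)"
    and "\<And>x. x \<in> X \<Longrightarrow> free_lift K P g (free_gen K x) = g x"
proof -
  interpret cring K by fact
  let ?F = "free_module K X"
  interpret F: module K ?F by (rule free_module_module[OF K])
  interpret P: module K P by fact
  \<comment> \<open>\<open>g\<close> is controlled only on \<open>X\<close>, while the sums below
    range over arbitrary finite sets; extension by zero keeps all summands in
    \<open>P\<close>.\<close>
  define g' where "g' x = (if x \<in> X then g x else \<zero>\<^bsub>P\<^esub>)" for x
  have g': "g' x \<in> carrier P" for x using g by (simp add: g'_def)
  note val = free_module_value[OF K]
  \<comment> \<open>Any finite set containing the support may serve as index set, so that the sums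
    for different functions can be taken over a common one.\<close>
  have supp: "free_lift K P g f = (\<Oplus>\<^bsub>P\<^esub>x\<in>S. f x \<odot>\<^bsub>P\<^esub> g' x)"
    if f: "f \<in> carrier ?F" and S: "finite S" "{x. f x \<noteq> \<zero>\<^bsub>K\<^esub>} \<subseteq> S" for f S
  proof -
    have "free_lift K P g f = (\<Oplus>\<^bsub>P\<^esub>x\<in>{x. f x \<noteq> \<zero>\<^bsub>K\<^esub>}. f x \<odot>\<^bsub>P\<^esub> g' x)"
      unfolding free_lift_def using f val[OF f] g
      by (intro P.finsum_cong') (auto simp: g'_def free_module_carrier)
    also have "\<dots> = (\<Oplus>\<^bsub>P\<^esub>x\<in>S. f x \<odot>\<^bsub>P\<^esub> g' x)"
      using S val[OF f] g' by (intro P.add.finprod_mono_neutral_cong_left) auto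
    finally show ?thesis .
  qed
  show "linear_map K ?F P (free_lift K P g)"
  proof (rule linear_mapI)
    fix f assume f: "f \<in> carrier ?F"
    then have "finite {x. f x \<noteq> \<zero>\<^bsub>K\<^esub>}" by (simp add: free_module_carrier)
    from supp[OF f this order_refl] show "free_lift K P g f \<in> carrier P"
      using val[OF f] g' by auto
  next
    fix f h assume f: "f \<in> carrier ?F" and h: "h \<in> carrier ?F"
    let ?S = "{x. f x \<noteq> \<zero>\<^bsub>K\<^esub>} \<union> {x. h x \<noteq> \<zero>\<^bsub>K\<^esub>}"
    have S: "finite ?S" using f h by (simp add: free_module_carrier)
    have sub: "{x. (f \<oplus>\<^bsub>?F\<^esub> h) x \<noteq> \<zero>\<^bsub>K\<^esub>} \<subseteq> ?S" by (auto simp: free_module_simps)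
    have "free_lift K P g (f \<oplus>\<^bsub>?F\<^esub> h) = (\<Oplus>\<^bsub>P\<^esub>x\<in>?S. f x \<odot>\<^bsub>P\<^esub> g' x \<oplus>\<^bsub>P\<^esub> h x \<odot>\<^bsub>P\<^esub> g' x)"
      unfolding supp[OF F.a_closed[OF f h] S sub]
      using val[OF f] val[OF h] g'
      by (intro P.finsum_cong') (auto simp: free_module_simps P.smult_l_distr)
    also have "\<dots> = (\<Oplus>\<^bsub>P\<^esub>x\<in>?S. f x \<odot>\<^bsub>P\<^esub> g' x) \<oplus>\<^bsub>P\<^esub> (\<Oplus>\<^bsub>P\<^esub>x\<in>?S. h x \<odot>\<^bsub>P\<^esub> g' x)"
      using val[OF f] val[OF h] g' by (intro P.finsum_addf) auto
    also have "\<dots> = free_lift K P g f \<oplus>\<^bsub>P\<^esub> free_lift K P g h"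
      using supp[OF f S] supp[OF h S] by simp
    finally show "free_lift K P g (f \<oplus>\<^bsub>?F\<^esub> h) = free_lift K P g f \<oplus>\<^bsub>P\<^esub> free_lift K P g h" .
  next
    fix c f assume c: "c \<in> carrier K" and f: "f \<in> carrier ?F"
    let ?S = "{x. f x \<noteq> \<zero>\<^bsub>K\<^esub>}"
    have S: "finite ?S" using f by (simp add: free_module_carrier)
    have sub: "{x. (c \<odot>\<^bsub>?F\<^esub> f) x \<noteq> \<zero>\<^bsub>K\<^esub>} \<subseteq> ?S" using c by (auto simp: free_module_simps)
    have "free_lift K P g (c \<odot>\<^bsub>?F\<^esub> f) = (\<Oplus>\<^bsub>P\<^esub>x\<in>?S. c \<odot>\<^bsub>P\<^esub> (f x \<odot>\<^bsub>P\<^esub> g' x))"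
      unfolding supp[OF F.smult_closed[OF c f] S sub]
      using val[OF f] c g' by (intro P.finsum_cong') (auto simp: free_module_simps P.smult_assoc1)
    also have "\<dots> = c \<odot>\<^bsub>P\<^esub> (\<Oplus>\<^bsub>P\<^esub>x\<in>?S. f x \<odot>\<^bsub>P\<^esub> g' x)"
      using val[OF f] c g' S by (subst P.finsum_smult_ldistr) auto
    finally show "free_lift K P g (c \<odot>\<^bsub>?F\<^esub> f) = c \<odot>\<^bsub>P\<^esub> free_lift K P g f"
      using supp[OF f S] by simp
  qed
  show "free_lift K P g (free_gen K x) = g x" if x: "x \<in> X" for x
  proof -
    have "free_lift K P g (free_gen K x) = (\<Oplus>\<^bsub>P\<^esub>y\<in>{x}. free_gen K x y \<odot>\<^bsub>P\<^esub> g' y)"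
      by (rule supp[OF free_gen_in[OF K x]]) (auto simp: free_gen_def)
    also have "\<dots> = g x" using x g by (simp add: free_gen_def g'_def)
    finally show ?thesis .
  qed
qed

section \<open>Tensor products\<close>

lemma submodule_span_properties:
  assumes M: "module K M" and R: "R \<subseteq> carrier M"
  shows submodule_span_submodule: "submodule (submodule_span K M R) K M"
    and submodule_span_superset: "R \<subseteq> submodule_span K M R"
proof -
  interpret M: module K M by fact
  have c: "submodule (carrier M) K M" by (rule M.carrier_is_submodule)
  show "R \<subseteq> submodule_span K M R" by (auto simp: submodule_span_def)
  note E = M.submoduleE
  show "submodule (submodule_span K M R) K M"
  proof (rule M.submoduleI)
    show "submodule_span K M R \<subseteq> carrier M" using c R by (auto simp: submodule_span_def)
    show "\<zero>\<^bsub>M\<^esub> \<in> submodule_span K M R"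
      using subgroup.one_closed[OF submodule.axioms(1)] by (auto simp: submodule_span_def)
  qed (auto simp: submodule_span_def intro: E)
qed

lemma submodule_span_least: "submodule U K M \<Longrightarrow> R \<subseteq> U \<Longrightarrow> submodule_span K M R \<subseteq> U"
  by (auto simp: submodule_span_def)

text \<open>The generators hidden inside \<open>tensor_rel\<close>, named so that a submodule can be
  shown to contain all relations by containing these.\<close>

definition tensor_gens ::
  "'k ring \<Rightarrow> ('k, 'a) module \<Rightarrow> ('k, 'b) module \<Rightarrow> ('a \<times> 'b \<Rightarrow> 'k) set" where
  "tensor_gens K M N = (let F = pair_module K M N; d = (\<lambda>m n. free_gen K (m, n)) in
      ({d (m \<oplus>\<^bsub>M\<^esub> m') n \<ominus>\<^bsub>F\<^esub> (d m n \<oplus>\<^bsub>F\<^esub> d m' n) | m m' n.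
          m \<in> carrier M \<and> m' \<in> carrier M \<and> n \<in> carrier N} \<union>
       {d m (n \<oplus>\<^bsub>N\<^esub> n') \<ominus>\<^bsub>F\<^esub> (d m n \<oplus>\<^bsub>F\<^esub> d m n') | m n n'.
          m \<in> carrier M \<and> n \<in> carrier N \<and> n' \<in> carrier N} \<union>
       {d (c \<odot>\<^bsub>M\<^esub> m) n \<ominus>\<^bsub>F\<^esub> (c \<odot>\<^bsub>F\<^esub> d m n) | c m n.
          c \<in> carrier K \<and> m \<in> carrier M \<and> n \<in> carrier N} \<union>
       {d m (c \<odot>\<^bsub>N\<^esub> n) \<ominus>\<^bsub>F\<^esub> (c \<odot>\<^bsub>F\<^esub> d m n) | c m n.
          c \<in> carrier K \<and> m \<in> carrier M \<and> n \<in> carrier N}))"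

lemma tensor_rel_eq: "tensor_rel K M N = submodule_span K (pair_module K M N) (tensor_gens K M N)"
  by (simp add: tensor_rel_def tensor_gens_def Let_def)

section \<open>The quotient construction and its universal property\<close>

locale tensor_pair = M: module K M + N: module K N
  for K :: "'k ring" and M :: "('k, 'a) module" and N :: "('k, 'b) module"
begin

abbreviation F where "F \<equiv> pair_module K M N"
abbreviation U where "U \<equiv> tensor_rel K M N"
abbreviation T where "T \<equiv> tensor K M N"

sublocale F: module K F
  by (rule free_module_module[OF M.R.is_cring])

lemma gen_in: "m \<in> carrier M \<Longrightarrow> n \<in> carrier N \<Longrightarrow> free_gen K (m, n) \<in> carrier F"
  by (simp add: free_gen_in M.R.is_cring)

lemma tensor_gens_subset: "tensor_gens K M N \<subseteq> carrier F"
  by (auto simp: tensor_gens_def Let_def gen_in)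

lemma U_submodule: "submodule U K F" and tensor_gens_U: "tensor_gens K M N \<subseteq> U"
  using submodule_span_properties[OF F.module_axioms tensor_gens_subset]
  by (simp_all add: tensor_rel_eq)

lemma U_additive: "additive_subgroup U F"
  using U_submodule by (simp add: additive_subgroup_def submodule_def)

sublocale U: abelian_subgroup U F
  using U_additive F.abelian_group_axioms by (rule abelian_subgroupI3)

lemma U_smult: "c \<in> carrier K \<Longrightarrow> f \<in> U \<Longrightarrow> c \<odot>\<^bsub>F\<^esub> f \<in> U"
  using submodule.smult_closed[OF U_submodule] .

abbreviation coset where "coset f \<equiv> U +>\<^bsub>F\<^esub> f"

lemma coset_eq_iff:
  assumes f: "f \<in> carrier F" and g: "g \<in> carrier F"
  shows "coset f = coset g \<longleftrightarrow> f \<ominus>\<^bsub>F\<^esub> g \<in> U"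
proof -
  have "f \<in> coset g \<longleftrightarrow> f \<ominus>\<^bsub>F\<^esub> g \<in> U"
    using U.a_rcos_module[OF g f] by (simp add: a_minus_def)
  moreover have "f \<in> coset g \<longleftrightarrow> coset f = coset g"
    using U.a_repr_independence'[of f g] U.a_rcos_self[OF f] g by auto
  ultimately show ?thesis by simp
qed

lemma tensor_simps:
  "carrier T = a_rcosets\<^bsub>F\<^esub> U" "zero T = U" "add T = (\<lambda>C D. C <+>\<^bsub>F\<^esub> D)"
  by (simp_all add: tensor_def Let_def)

lemma tensor_carrier: "carrier T = coset ` carrier F"
  by (auto simp: tensor_simps A_RCOSETS_def' )

lemma coset_in: "f \<in> carrier F \<Longrightarrow> coset f \<in> carrier T"
  by (simp add: tensor_carrier)

lemma coset_zero: "coset \<zero>\<^bsub>F\<^esub> = zero T"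
  using U.a_rcos_const[OF U.zero_closed] by (simp add: tensor_simps)

lemma coset_add: "\<lbrakk>f \<in> carrier F; g \<in> carrier F\<rbrakk> \<Longrightarrow> coset (f \<oplus>\<^bsub>F\<^esub> g) = coset f \<oplus>\<^bsub>T\<^esub> coset g"
  by (simp add: tensor_simps U.a_rcos_sum)

text \<open>\<open>smult\<close> of a coset is a union over all its representatives. Multiplication
  by \<open>c\<close> preserves \<open>U\<close>, so all members of that union are one and the same
  coset.\<close>

lemma coset_smult:
  assumes c: "c \<in> carrier K" and f: "f \<in> carrier F"
  shows "coset (c \<odot>\<^bsub>F\<^esub> f) = c \<odot>\<^bsub>T\<^esub> coset f"
proof -
  have "coset (c \<odot>\<^bsub>F\<^esub> g) = coset (c \<odot>\<^bsub>F\<^esub> f)" if g: "g \<in> coset f" for g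
  proof -
    have gF: "g \<in> carrier F" using U.a_elemrcos_carrier[OF f g] .
    have "c \<odot>\<^bsub>F\<^esub> (g \<oplus>\<^bsub>F\<^esub> \<ominus>\<^bsub>F\<^esub> f) \<in> U" using U_smult[OF c] U.a_rcos_module_imp[OF f g] by blast
    then show ?thesis
      using c f gF by (simp add: coset_eq_iff a_minus_def F.smult_r_distr F.smult_r_minus)
  qed
  then have "c \<odot>\<^bsub>T\<^esub> coset f = (\<Union>g\<in>coset f. coset (c \<odot>\<^bsub>F\<^esub> f))"
    by (simp add: tensor_def Let_def)
  then show ?thesis using U.a_rcos_self[OF f] by auto
qed

lemma tensor_module: "module K T"
proof (rule moduleI)
  show "cring K" by (rule M.R.is_cring)
  show "abelian_group T"
  proof (rule abelian_groupI)
    fix t assume "t \<in> carrier T"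
    then obtain f where "f \<in> carrier F" "t = coset f" by (auto simp: tensor_carrier)
    then show "\<exists>s\<in>carrier T. s \<oplus>\<^bsub>T\<^esub> t = \<zero>\<^bsub>T\<^esub>"
      by (intro bexI[of _ "coset (\<ominus>\<^bsub>F\<^esub> f)"])
        (simp_all add: coset_in coset_add[symmetric] coset_zero[symmetric] F.l_neg)
  qed (auto simp: tensor_carrier coset_add[symmetric] coset_zero[symmetric] F.a_ac)
qed (auto simp: tensor_carrier coset_smult[symmetric] coset_add[symmetric]
    F.smult_l_distr F.smult_r_distr F.smult_assoc1)

lemma pure_eq: "pure K M N m n = coset (free_gen K (m, n))"
  by (simp add: pure_def)

text \<open>Each identity between cosets asks for a difference to lie in \<open>U\<close>, and that
  difference is literally one of the generators.\<close>

lemma pure_bilinear: "bilinear_map K M N T (pure K M N)"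
proof -
  have U: "u \<in> tensor_gens K M N \<Longrightarrow> u \<in> U" for u using tensor_gens_U by auto
  show ?thesis
  proof (rule bilinear_mapI; rule linear_mapI)
    fix m n n' assume mn: "m \<in> carrier M" "n \<in> carrier N" "n' \<in> carrier N"
    show "pure K M N m (n \<oplus>\<^bsub>N\<^esub> n') = pure K M N m n \<oplus>\<^bsub>T\<^esub> pure K M N m n'"
      unfolding pure_eq using mn
      by (subst coset_add[symmetric], (simp_all add: gen_in)[2], subst coset_eq_iff)
        (auto simp: gen_in intro!: U, auto simp: tensor_gens_def Let_def)
  next
    fix m m' n assume mn: "m \<in> carrier M" "m' \<in> carrier M" "n \<in> carrier N"
    show "pure K M N (m \<oplus>\<^bsub>M\<^esub> m') n = pure K M N m n \<oplus>\<^bsub>T\<^esub> pure K M N m' n"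
      unfolding pure_eq using mn
      by (subst coset_add[symmetric], (simp_all add: gen_in)[2], subst coset_eq_iff)
        (auto simp: gen_in intro!: U, auto simp: tensor_gens_def Let_def)
  next
    fix c m n assume mn: "c \<in> carrier K" "m \<in> carrier M" "n \<in> carrier N"
    show "pure K M N m (c \<odot>\<^bsub>N\<^esub> n) = c \<odot>\<^bsub>T\<^esub> pure K M N m n"
      unfolding pure_eq using mn
      by (subst coset_smult[symmetric], (simp_all add: gen_in)[2], subst coset_eq_iff)
        (auto simp: gen_in intro!: U, auto simp: tensor_gens_def Let_def)
    show "pure K M N (c \<odot>\<^bsub>M\<^esub> m) n = c \<odot>\<^bsub>T\<^esub> pure K M N m n"
      unfolding pure_eq using mn
      by (subst coset_smult[symmetric], (simp_all add: gen_in)[2], subst coset_eq_iff)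
        (auto simp: gen_in intro!: U, auto simp: tensor_gens_def Let_def)
  qed (simp_all add: pure_eq coset_in gen_in)
qed

text \<open>Sums of pure tensors exhaust the tensor product, since a scalar in front of a pure
  tensor is absorbed into its second factor.\<close>

lemma tensor_induct:
  assumes t: "t \<in> carrier T"
    and zero: "Q \<zero>\<^bsub>T\<^esub>"
    and pure: "\<And>m n. \<lbrakk>m \<in> carrier M; n \<in> carrier N\<rbrakk> \<Longrightarrow> Q (pure K M N m n)"
    and add: "\<And>s t. \<lbrakk>s \<in> carrier T; t \<in> carrier T; Q s; Q t\<rbrakk> \<Longrightarrow> Q (s \<oplus>\<^bsub>T\<^esub> t)"
  shows "Q t"
proof -
  obtain f where f: "f \<in> carrier F" and tf: "t = coset f" using t by (auto simp: tensor_carrier)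
  have "Q (coset f)"
  proof (rule free_module_induct[OF M.R.is_cring f])
    show "Q (coset (\<lambda>x. \<zero>\<^bsub>K\<^esub>))" using zero coset_zero by (simp add: free_module_simps)
  next
    fix c x assume c: "c \<in> carrier K" and x: "x \<in> carrier M \<times> carrier N"
    obtain m n where x: "x = (m, n)" and m: "m \<in> carrier M" and n: "n \<in> carrier N" using x by auto
    have "coset (c \<odot>\<^bsub>F\<^esub> free_gen K x) = pure K M N m (c \<odot>\<^bsub>N\<^esub> n)"
      using pure_bilinear c m n x linear_map_smult[of K N T "pure K M N m" c n]
      by (simp add: coset_smult gen_in pure_eq[symmetric] bilinear_map_def)
    then show "Q (coset (c \<odot>\<^bsub>F\<^esub> free_gen K x))" using pure m n c by simp
  next
    fix f g assume "f \<in> carrier F" "g \<in> carrier F" "Q (coset f)" "Q (coset g)"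
    then show "Q (coset (f \<oplus>\<^bsub>F\<^esub> g))" by (simp add: coset_add coset_in add)
  qed
  then show ?thesis by (simp add: tf)
qed

lemma tensor_ext:
  assumes t: "t \<in> carrier T" and P: "module K P"
    and f: "linear_map K T P f" and g: "linear_map K T P g"
    and eq: "\<And>m n. \<lbrakk>m \<in> carrier M; n \<in> carrier N\<rbrakk> \<Longrightarrow> f (pure K M N m n) = g (pure K M N m n)"
  shows "f t = g t"
  by (rule tensor_induct[OF t])
    (simp_all add: linear_map_zero[OF f tensor_module P] linear_map_zero[OF g tensor_module P]
      linear_map_add[OF f] linear_map_add[OF g] eq)

text \<open>The linear extension of \<open>b\<close> to the free module vanishes on the relations,
  hence is constant on cosets. Uniqueness holds because a linear map is determined by its values on
  pure tensors.\<close>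

lemma tensor_lift_ex:
  assumes P: "module K P" and b: "bilinear_map K M N P b"
  shows "\<exists>!h. h \<in> lin_hom K T P \<and>
     (\<forall>m\<in>carrier M. \<forall>n\<in>carrier N. h (pure K M N m n) = b m n)"
proof (rule ex_ex1I)
  interpret P: module K P by fact
  have bc: "b m n \<in> carrier P" if "m \<in> carrier M" "n \<in> carrier N" for m n
    using b that linear_map_closed by (fastforce simp: bilinear_map_def)
  let ?b = "\<lambda>(m, n). b m n"
  let ?L = "free_lift K P ?b"
  have L: "linear_map K F P ?L"
    by (rule free_lift_linear(1)[OF M.R.is_cring P]) (auto simp: bc)
  have Lg: "?L (free_gen K (m, n)) = b m n" if "m \<in> carrier M" "n \<in> carrier N" for m n
    using free_lift_linear(2)[OF M.R.is_cring P, of "carrier M \<times> carrier N" ?b] bc that by auto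
  \<comment> \<open>The kernel of \<open>?L\<close>. As it is a submodule, minimality of the span
    reduces \<open>U \<subseteq> ?Z\<close> to the four kinds of generators.\<close>
  let ?Z = "{f \<in> carrier F. ?L f = \<zero>\<^bsub>P\<^esub>}"
  have Lminus: "?L (f \<ominus>\<^bsub>F\<^esub> g) = ?L f \<ominus>\<^bsub>P\<^esub> ?L g" if "f \<in> carrier F" "g \<in> carrier F" for f g
    using that by (simp add: a_minus_def linear_map_add[OF L]
        linear_map_minus[OF L F.module_axioms P])
  have Z: "submodule ?Z K F"
    by (rule F.submoduleI) (auto simp: linear_map_add[OF L] linear_map_smult[OF L]
      linear_map_zero[OF L F.module_axioms P] linear_map_minus[OF L F.module_axioms P])
  have gens: "tensor_gens K M N \<subseteq> ?Z"
  proof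
    fix u assume u: "u \<in> tensor_gens K M N"
    have b1: "linear_map K N P (b m)" if "m \<in> carrier M" for m
      using b that by (simp add: bilinear_map_def)
    have b2: "linear_map K M P (\<lambda>m. b m n)" if "n \<in> carrier N" for n
      using b that by (simp add: bilinear_map_def)
    have "?L u = \<zero>\<^bsub>P\<^esub>"
      using u by (auto simp: tensor_gens_def Let_def Lminus gen_in linear_map_add[OF L]
        linear_map_smult[OF L] Lg linear_map_add[OF b1] linear_map_add[OF b2]
        linear_map_smult[OF b1] linear_map_smult[OF b2] bc P.r_neg a_minus_def[of P])
    then show "u \<in> ?Z" using u tensor_gens_subset by auto
  qed
  have UZ: "U \<subseteq> ?Z" unfolding tensor_rel_eq by (rule submodule_span_least[OF Z gens])
  \<comment> \<open>The value is read off at a chosen representative; \<open>UZ\<close> makes it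
    independent of the choice.\<close>
  define h where "h = (\<lambda>t\<in>carrier T. ?L (SOME f. f \<in> carrier F \<and> t = coset f))"
  have h: "h (coset f) = ?L f" if f: "f \<in> carrier F" for f
  proof -
    let ?g = "SOME g. g \<in> carrier F \<and> coset f = coset g"
    have g: "?g \<in> carrier F \<and> coset f = coset ?g" using f by (intro someI_ex[of "\<lambda>g. g \<in>
        carrier F \<and> coset f = coset g"]) blast
    then have "?L (f \<ominus>\<^bsub>F\<^esub> ?g) = \<zero>\<^bsub>P\<^esub>" using UZ f coset_eq_iff[OF f, of ?g] by blast
    then have "?L f \<ominus>\<^bsub>P\<^esub> ?L ?g = \<zero>\<^bsub>P\<^esub>" using Lminus[OF f conjunct1[OF g]] by simp
    then have "?L f = ?L ?g"
      using f g linear_map_closed[OF L] P.minus_equality[of "?L f" "\<ominus>\<^bsub>P\<^esub> ?L ?g"]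
      by (simp add: a_minus_def)
    then show ?thesis using f by (simp add: h_def coset_in)
  qed
  have "linear_map K T P h"
    by (rule linear_mapI) (auto simp: tensor_carrier h linear_map_closed[OF L] linear_map_add[OF L]
      linear_map_smult[OF L] coset_add[symmetric] coset_smult[symmetric])
  then have "h \<in> lin_hom K T P" by (auto simp: lin_hom_def h_def)
  moreover have "\<forall>m\<in>carrier M. \<forall>n\<in>carrier N. h (pure K M N m n) = b m n"
    by (simp add: pure_eq h gen_in Lg)
  ultimately show "\<exists>h. h \<in> lin_hom K T P \<and>
     (\<forall>m\<in>carrier M. \<forall>n\<in>carrier N. h (pure K M N m n) = b m n)" by blast
next
  fix h h'
  assume h: "h \<in> lin_hom K T P \<and> (\<forall>m\<in>carrier M. \<forall>n\<in>carrier N. h (pure K M N m n) = b m n)"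
    and h': "h' \<in> lin_hom K T P \<and> (\<forall>m\<in>carrier M. \<forall>n\<in>carrier N. h' (pure K M N m n) = b m n)"
  show "h = h'"
  proof (rule extensionalityI)
    show "h \<in> extensional (carrier T)" "h' \<in> extensional (carrier T)"
      using h h' by (auto simp: lin_hom_def)
    fix t assume "t \<in> carrier T"
    then show "h t = h' t" by (rule tensor_ext[OF _ P]) (use h h' in \<open>auto simp: lin_hom_def\<close>)
  qed
qed

lemma tensor_lift_lin_hom:
  assumes "module K P" and "bilinear_map K M N P b"
  shows "tensor_lift K M N P b \<in> lin_hom K T P"
  using theI'[OF tensor_lift_ex[OF assms]] by (simp add: tensor_lift_def)

lemma tensor_lift_pure:
  assumes "module K P" and "bilinear_map K M N P b" and "m \<in> carrier M" "n \<in> carrier N"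
  shows "tensor_lift K M N P b (pure K M N m n) = b m n"
  using theI'[OF tensor_lift_ex[OF assms(1,2)]] assms(3,4) by (simp add: tensor_lift_def)

end

section \<open>Linearity and evaluation rules for maps on tensor products\<close>

lemma module_cring: "module K M \<Longrightarrow> cring K"
  by (simp add: module_def)

lemma tensor_pair: "module K M \<Longrightarrow> module K N \<Longrightarrow> tensor_pair K M N"
  by (simp add: tensor_pair_def)

lemma module_tensor [simp]: "module K M \<Longrightarrow> module K N \<Longrightarrow> module K (tensor K M N)"
  by (rule tensor_pair.tensor_module) (rule tensor_pair)

text \<open>Linearity rules carry an inner map \<open>F\<close>, so that the simplifier can peel a
  composite from the outside until it reaches \<open>linear_map_ident\<close>.\<close>

lemma pure_linear_left [simp]:
  assumes "module K M" "module K N" "linear_map K L M F" "n \<in> carrier N"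
  shows "linear_map K L (tensor K M N) (\<lambda>t. pure K M N (F t) n)"
  using tensor_pair.pure_bilinear[OF tensor_pair[OF assms(1,2)]] assms(3,4)
    linear_map_comp[of K M "tensor K M N" "\<lambda>m. pure K M N m n" L F]
  by (simp add: bilinear_map_def)

lemma pure_linear_right [simp]:
  assumes "module K M" "module K N" "linear_map K L N F" "m \<in> carrier M"
  shows "linear_map K L (tensor K M N) (\<lambda>t. pure K M N m (F t))"
  using tensor_pair.pure_bilinear[OF tensor_pair[OF assms(1,2)]] assms(3,4)
    linear_map_comp[of K N "tensor K M N" "pure K M N m" L F]
  by (simp add: bilinear_map_def)

lemma pure_closed [simp]:
  "\<lbrakk>module K M; module K N; m \<in> carrier M; n \<in> carrier N\<rbrakk> \<Longrightarrow> pure K M N m n \<in> carrier (tensor K M N)"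
  by (rule linear_map_closed[OF pure_linear_left[OF _ _ linear_map_ident]])

text \<open>Resolution with this rule eta-expands identities inside \<open>f\<close> and \<open>g\<close>, which the simplifier
  then turns into \<open>\<lambda>a. a\<close>; this is why \<open>id_def\<close> is unfolded in many proofs below.\<close>

lemma tensor_eqI:
  assumes "t \<in> carrier (tensor K M N)" "module K M" "module K N" "module K P"
    and "linear_map K (tensor K M N) P f" "linear_map K (tensor K M N) P g"
    and "\<And>m n. \<lbrakk>m \<in> carrier M; n \<in> carrier N\<rbrakk> \<Longrightarrow> f (pure K M N m n) = g (pure K M N m n)"
  shows "f t = g t"
  using tensor_pair.tensor_ext[OF tensor_pair[OF assms(2,3)] assms(1,4-7)] .

lemma linear_map_plus:
  assumes f: "linear_map K M N f" and g: "linear_map K M N g" and N: "module K N"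
  shows "linear_map K M N (\<lambda>x. f x \<oplus>\<^bsub>N\<^esub> g x)"
proof -
  interpret N: module K N by fact
  show ?thesis
    by (rule linear_mapI) (simp_all add: linear_map_closed[OF f] linear_map_closed[OF g]
        linear_map_add[OF f] linear_map_add[OF g] linear_map_smult[OF f] linear_map_smult[OF g]
        N.smult_r_distr N.a_ac)
qed

lemma linear_map_scale:
  assumes f: "linear_map K M N f" and N: "module K N" and c: "c \<in> carrier K"
  shows "linear_map K M N (\<lambda>x. c \<odot>\<^bsub>N\<^esub> f x)"
proof -
  interpret N: module K N by fact
  show ?thesis
    by (rule linear_mapI) (simp_all add: linear_map_closed[OF f] c
        linear_map_add[OF f] linear_map_smult[OF f] N.smult_r_distr N.smult_assoc1[symmetric]
        N.R.m_comm)
qed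

lemma tensor_lift_linear [simp]:
  assumes "module K M" "module K N" "module K P" "bilinear_map K M N P b"
    and "linear_map K L (tensor K M N) F"
  shows "linear_map K L P (\<lambda>x. tensor_lift K M N P b (F x))"
  using tensor_pair.tensor_lift_lin_hom[OF tensor_pair[OF assms(1,2)] assms(3,4)] assms(5)
  by (auto simp: lin_hom_def intro: linear_map_comp)

lemma tensor_lift_pure [simp]:
  assumes "module K M" "module K N" "module K P" "bilinear_map K M N P b"
    and "m \<in> carrier M" "n \<in> carrier N"
  shows "tensor_lift K M N P b (pure K M N m n) = b m n"
  using tensor_pair.tensor_lift_pure[OF tensor_pair[OF assms(1,2)] assms(3-6)] .

lemma tensor_lift_closed [simp]:
  assumes "module K M" "module K N" "module K P" "bilinear_map K M N P b"
    and "t \<in> carrier (tensor K M N)"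
  shows "tensor_lift K M N P b t \<in> carrier P"
  by (rule linear_map_closed[of K "tensor K M N"]) (simp_all add: assms)

text \<open>Serves the nested lifts in \<open>tensor_assoc\<close> and \<open>middle_flip\<close>:
  the outer map is bilinear only if the inner lift depends linearly on the parameters of its
  bilinear map.\<close>

lemma tensor_lift_linear_param [simp]:
  assumes L: "module K L" and M: "module K M" and N: "module K N" and P: "module K P"
    and b: "\<And>x. x \<in> carrier L \<Longrightarrow> bilinear_map K M N P (b x)"
    and lin: "\<And>m n. \<lbrakk>m \<in> carrier M; n \<in> carrier N\<rbrakk> \<Longrightarrow> linear_map K L P (\<lambda>x. b x m n)"
    and s: "s \<in> carrier (tensor K M N)"
  shows "linear_map K L P (\<lambda>x. tensor_lift K M N P (b x) s)"
proof (rule linear_mapI)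
  interpret L: module K L by fact
  fix x y assume x: "x \<in> carrier L"
  show "tensor_lift K M N P (b x) s \<in> carrier P" using assms x by simp
  assume y: "y \<in> carrier L"
  show "tensor_lift K M N P (b (x \<oplus>\<^bsub>L\<^esub> y)) s =
      tensor_lift K M N P (b x) s \<oplus>\<^bsub>P\<^esub> tensor_lift K M N P (b y) s"
    by (rule tensor_eqI[OF s M N P]) (use M N P x y b lin in
      \<open>auto intro!: linear_map_plus simp: linear_map_add[OF lin]\<close>)
next
  interpret L: module K L by fact
  fix c x assume c: "c \<in> carrier K" and x: "x \<in> carrier L"
  show "tensor_lift K M N P (b (c \<odot>\<^bsub>L\<^esub> x)) s = c \<odot>\<^bsub>P\<^esub> tensor_lift K M N P (b x) s"
    by (rule tensor_eqI[OF s M N P]) (use M N P x c b lin in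
      \<open>auto intro!: linear_map_scale simp: linear_map_smult[OF lin]\<close>)
qed

lemma tensor_map_bilinear:
  assumes "module K M" "module K N" "module K M'" "module K N'"
    and f: "linear_map K M M' f" and g: "linear_map K N N' g"
  shows "bilinear_map K M N (tensor K M' N') (\<lambda>m n. pure K M' N' (f m) (g n))"
  using assms by (intro bilinear_mapI) (simp_all add: linear_map_closed[OF f] linear_map_closed[OF
      g])

lemma tensor_map_linear [simp]:
  assumes "module K M" "module K N" "module K M'" "module K N'"
    and "linear_map K M M' f" "linear_map K N N' g" "linear_map K L (tensor K M N) F"
  shows "linear_map K L (tensor K M' N') (\<lambda>t. tensor_map K M N M' N' f g (F t))"
  using assms by (simp add: tensor_map_def tensor_map_bilinear)

lemma tensor_map_closed [simp]:
  assumes "module K M" "module K N" "module K M'" "module K N'"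
    and "linear_map K M M' f" "linear_map K N N' g" "t \<in> carrier (tensor K M N)"
  shows "tensor_map K M N M' N' f g t \<in> carrier (tensor K M' N')"
  using assms by (simp add: tensor_map_def tensor_map_bilinear)

lemma tensor_map_pure [simp]:
  assumes "module K M" "module K N" "module K M'" "module K N'"
    and "linear_map K M M' f" "linear_map K N N' g" "m \<in> carrier M" "n \<in> carrier N"
  shows "tensor_map K M N M' N' f g (pure K M N m n) = pure K M' N' (f m) (g n)"
  using assms by (simp add: tensor_map_def tensor_map_bilinear)

lemma tensor_map_comp:
  assumes "module K M" "module K N" "module K M'" "module K N'" "module K M''" "module K N''"
    and "linear_map K M M' f" "linear_map K N N' g"
    and f': "linear_map K M' M'' f'" and g': "linear_map K N' N'' g'"
    and "t \<in> carrier (tensor K M N)"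
  shows "tensor_map K M' N' M'' N'' f' g' (tensor_map K M N M' N' f g t) =
    tensor_map K M N M'' N'' (\<lambda>m. f' (f m)) (\<lambda>n. g' (g n)) t"
  by (rule tensor_eqI[OF assms(11,1,2), of "tensor K M'' N''"])
    (use assms in \<open>simp_all add: linear_map_comp[OF f'] linear_map_comp[OF g']
      linear_map_closed[OF assms(7)] linear_map_closed[OF assms(8)]\<close>)

text \<open>The factors enter \<open>tensor_map\<close> as whole functions, although only their
  values on the carriers matter. This rule makes a map interchangeable with any other that agrees
  with it there, such as its restriction.\<close>

lemma tensor_map_cong:
  assumes "module K M" "module K N" "module K M'" "module K N'"
    and "linear_map K M M' f" "linear_map K N N' g"
    and "\<And>m. m \<in> carrier M \<Longrightarrow> f m = f' m" "\<And>n. n \<in> carrier N \<Longrightarrow> g n = g' n"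
    and "t \<in> carrier (tensor K M N)"
  shows "tensor_map K M N M' N' f g t = tensor_map K M N M' N' f' g' t"
  by (rule tensor_eqI[OF assms(9,1,2), of "tensor K M' N'"])
    (use assms linear_map_cong[OF assms(5,1,7)] linear_map_cong[OF assms(6,2,8)] in simp_all)

lemma tensor_map_ident:
  assumes "module K M" "module K N" "t \<in> carrier (tensor K M N)"
    and "\<And>m. m \<in> carrier M \<Longrightarrow> f m = m" "\<And>n. n \<in> carrier N \<Longrightarrow> g n = n"
  shows "tensor_map K M N M N f g t = t"
proof -
  have f: "linear_map K M M f"
    by (rule linear_map_cong[OF linear_map_ident assms(1)]) (simp add: assms(4))
  have g: "linear_map K N N g"
    by (rule linear_map_cong[OF linear_map_ident assms(2)]) (simp add: assms(5))
  show ?thesis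
    by (rule tensor_eqI[OF assms(3,1,2), of "tensor K M N"]) (use f g assms in simp_all)
qed

section \<open>Associativity of the tensor product\<close>

context
  fixes K :: "'k ring" and M :: "('k, 'a) module" and N :: "('k, 'b) module"
    and P :: "('k, 'c) module"
  assumes M [simp]: "module K M" and N [simp]: "module K N" and P [simp]: "module K P"
begin

text \<open>\<open>tensor_assoc\<close> is a lift inside a lift, and each of the two unique choices
  is meaningful only once its argument is bilinear: for fixed \<open>p\<close> here, in both
  variables in \<open>tensor_assoc_outer\<close>.\<close>

lemma tensor_assoc_inner:
  "p \<in> carrier P \<Longrightarrow> bilinear_map K M N (tensor K M (tensor K N P))
     (\<lambda>m n. pure K M (tensor K N P) m (pure K N P n p))"
  by (rule bilinear_mapI) simp_all

lemma tensor_assoc_outer: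
  "bilinear_map K (tensor K M N) P (tensor K M (tensor K N P)) (\<lambda>s p.
     tensor_lift K M N (tensor K M (tensor K N P))
       (\<lambda>m n. pure K M (tensor K N P) m (pure K N P n p)) s)"
  by (rule bilinear_mapI) (simp_all add: tensor_assoc_inner)

lemma tensor_assoc_linear [simp]:
  "linear_map K L (tensor K (tensor K M N) P) F \<Longrightarrow>
     linear_map K L (tensor K M (tensor K N P)) (\<lambda>t. tensor_assoc K M N P (F t))"
  by (simp add: tensor_assoc_def Let_def tensor_assoc_outer)

lemma tensor_assoc_closed [simp]:
  "t \<in> carrier (tensor K (tensor K M N) P) \<Longrightarrow>
     tensor_assoc K M N P t \<in> carrier (tensor K M (tensor K N P))"
  by (simp add: tensor_assoc_def Let_def tensor_assoc_outer)

lemma tensor_assoc_pure [simp]: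
  "\<lbrakk>m \<in> carrier M; n \<in> carrier N; p \<in> carrier P\<rbrakk> \<Longrightarrow>
     tensor_assoc K M N P (pure K (tensor K M N) P (pure K M N m n) p) =
     pure K M (tensor K N P) m (pure K N P n p)"
  by (simp add: tensor_assoc_def Let_def tensor_assoc_outer tensor_assoc_inner)

lemma tensor_assoc_inv_inner:
  "m \<in> carrier M \<Longrightarrow> bilinear_map K N P (tensor K (tensor K M N) P)
     (\<lambda>n p. pure K (tensor K M N) P (pure K M N m n) p)"
  by (rule bilinear_mapI) simp_all

lemma tensor_assoc_inv_outer:
  "bilinear_map K M (tensor K N P) (tensor K (tensor K M N) P) (\<lambda>m s.
     tensor_lift K N P (tensor K (tensor K M N) P)
       (\<lambda>n p. pure K (tensor K M N) P (pure K M N m n) p) s)"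
  by (rule bilinear_mapI) (simp_all add: tensor_assoc_inv_inner)

lemma tensor_assoc_inv_linear [simp]:
  "linear_map K L (tensor K M (tensor K N P)) F \<Longrightarrow>
     linear_map K L (tensor K (tensor K M N) P) (\<lambda>t. tensor_assoc_inv K M N P (F t))"
  by (simp add: tensor_assoc_inv_def Let_def tensor_assoc_inv_outer)

lemma tensor_assoc_inv_pure [simp]:
  "\<lbrakk>m \<in> carrier M; n \<in> carrier N; p \<in> carrier P\<rbrakk> \<Longrightarrow>
     tensor_assoc_inv K M N P (pure K M (tensor K N P) m (pure K N P n p)) =
     pure K (tensor K M N) P (pure K M N m n) p"
  by (simp add: tensor_assoc_inv_def Let_def tensor_assoc_inv_outer tensor_assoc_inv_inner)

end

section \<open>Exchange of the two middle factors\<close>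

context
  fixes K :: "'k ring" and M :: "('k, 'a) module" and N :: "('k, 'b) module"
    and P :: "('k, 'c) module" and Q :: "('k, 'd) module"
  assumes M [simp]: "module K M" and N [simp]: "module K N"
    and P [simp]: "module K P" and Q [simp]: "module K Q"
begin

private abbreviation "T \<equiv> tensor K (tensor K M P) (tensor K N Q)"
private abbreviation "b m n p q \<equiv> pure K (tensor K M P) (tensor K N Q) (pure K M P m p) (pure K N
    Q n q)"

text \<open>\<open>middle_flip\<close> nests three lifts; this lemma and the next two justify them
  from the inside out.\<close>

lemma middle_flip_1: "m \<in> carrier M \<Longrightarrow> n \<in> carrier N \<Longrightarrow> bilinear_map K P Q T (b m n)"
  by (rule bilinear_mapI) simp_all

lemma middle_flip_2:
  "t \<in> carrier (tensor K P Q) \<Longrightarrow> bilinear_map K M N T (\<lambda>m n. tensor_lift K P Q T (b m n) t)"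
  by (rule bilinear_mapI) (simp_all add: middle_flip_1)

lemma middle_flip_3: "bilinear_map K (tensor K M N) (tensor K P Q) T
  (\<lambda>s t. tensor_lift K M N T (\<lambda>m n. tensor_lift K P Q T (b m n) t) s)"
  by (rule bilinear_mapI) (simp_all add: middle_flip_1 middle_flip_2)

lemma middle_flip_linear [simp]:
  "linear_map K L (tensor K (tensor K M N) (tensor K P Q)) F \<Longrightarrow>
     linear_map K L (tensor K (tensor K M P) (tensor K N Q)) (\<lambda>t. middle_flip K M N P Q (F t))"
  by (simp add: middle_flip_def Let_def middle_flip_3)

lemma middle_flip_closed [simp]:
  "t \<in> carrier (tensor K (tensor K M N) (tensor K P Q)) \<Longrightarrow>
     middle_flip K M N P Q t \<in> carrier (tensor K (tensor K M P) (tensor K N Q))"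
  by (simp add: middle_flip_def Let_def middle_flip_3)

lemma middle_flip_pure [simp]:
  "\<lbrakk>m \<in> carrier M; n \<in> carrier N; p \<in> carrier P; q \<in> carrier Q\<rbrakk> \<Longrightarrow>
     middle_flip K M N P Q (pure K (tensor K M N) (tensor K P Q) (pure K M N m n) (pure K P Q p
         q)) =
     pure K (tensor K M P) (tensor K N Q) (pure K M P m p) (pure K N Q n q)"
  by (simp add: middle_flip_def Let_def middle_flip_1 middle_flip_2 middle_flip_3)

end

section \<open>The ground ring as a module and the unit isomorphisms\<close>

lemma self_module_simps [simp]:
  "carrier (self_module K) = carrier K" "add (self_module K) = add K"
  "smult (self_module K) = mult K" "one (self_module K) = \<one>\<^bsub>K\<^esub>"
  by (simp_all add: self_module_def)

lemma module_self_module [simp]: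
  assumes "cring K" shows "module K (self_module K)"
proof -
  interpret cring K by fact
  have "abelian_group (self_module K)"
  proof (rule abelian_groupI)
    fix x assume "x \<in> carrier (self_module K)"
    then show "\<exists>y\<in>carrier (self_module K). y \<oplus>\<^bsub>self_module K\<^esub> x = \<zero>\<^bsub>self_module K\<^esub>"
      by (intro bexI[of _ "\<ominus>\<^bsub>K\<^esub> x"]) (simp_all add: self_module_def l_neg)
  qed (simp_all add: self_module_def a_ac)
  then show ?thesis
    by (intro moduleI assms) (auto simp: self_module_def l_distr r_distr m_assoc)
qed

context
  fixes K :: "'k ring" and M :: "('k, 'a) module"
  assumes M [simp]: "module K M"
begin

interpretation M: module K M by (rule M)

private lemma K_module [simp]: "module K (self_module K)"
  by (simp add: M.R.is_cring)

lemma tensor_unit_left_bilinear: "bilinear_map K (self_module K) M M (\<lambda>c m. c \<odot>\<^bsub>M\<^esub> m)"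
proof (intro bilinear_mapI linear_mapI)
  fix c d m assume "c \<in> carrier (self_module K)" "d \<in> carrier K" "m \<in> carrier M"
  then show "c \<odot>\<^bsub>M\<^esub> (d \<odot>\<^bsub>M\<^esub> m) = d \<odot>\<^bsub>M\<^esub> (c \<odot>\<^bsub>M\<^esub> m)"
    by (simp flip: M.smult_assoc1 add: M.R.m_comm)
qed (simp_all add: M.smult_r_distr M.smult_l_distr M.smult_assoc1)

lemma tensor_unit_right_bilinear: "bilinear_map K M (self_module K) M (\<lambda>m c. c \<odot>\<^bsub>M\<^esub> m)"
  using tensor_unit_left_bilinear by (simp add: bilinear_map_def)

lemma tensor_unit_left_linear [simp]:
  "linear_map K L (tensor K (self_module K) M) F \<Longrightarrow>
     linear_map K L M (\<lambda>t. tensor_unit_left K M (F t))"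
  by (simp add: tensor_unit_left_def tensor_unit_left_bilinear)

lemma tensor_unit_left_closed [simp]:
  "t \<in> carrier (tensor K (self_module K) M) \<Longrightarrow> tensor_unit_left K M t \<in> carrier M"
  by (simp add: tensor_unit_left_def tensor_unit_left_bilinear)

lemma tensor_unit_left_pure [simp]:
  "\<lbrakk>c \<in> carrier K; m \<in> carrier M\<rbrakk> \<Longrightarrow>
     tensor_unit_left K M (pure K (self_module K) M c m) = c \<odot>\<^bsub>M\<^esub> m"
  by (simp add: tensor_unit_left_def tensor_unit_left_bilinear)

lemma tensor_unit_right_linear [simp]:
  "linear_map K L (tensor K M (self_module K)) F \<Longrightarrow>
     linear_map K L M (\<lambda>t. tensor_unit_right K M (F t))"
  by (simp add: tensor_unit_right_def tensor_unit_right_bilinear)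

lemma tensor_unit_right_pure [simp]:
  "\<lbrakk>m \<in> carrier M; c \<in> carrier K\<rbrakk> \<Longrightarrow>
     tensor_unit_right K M (pure K M (self_module K) m c) = c \<odot>\<^bsub>M\<^esub> m"
  by (simp add: tensor_unit_right_def tensor_unit_right_bilinear)

end

section \<open>Algebras and their multiplication maps\<close>

lemma k_algebra_module: "k_algebra K A \<Longrightarrow> module K A"
  by (simp add: k_algebra_def)

lemma k_algebra_ring: "k_algebra K A \<Longrightarrow> ring A"
  by (simp add: k_algebra_def)

context
  fixes K :: "'k ring" and A :: "('k, 'a) module"
  assumes A: "k_algebra K A"
begin

interpretation A: ring A by (rule k_algebra_ring[OF A])

private lemma A_module [simp]: "module K A"
  by (rule k_algebra_module[OF A])

lemma mult_bilinear: "bilinear_map K A A A (\<lambda>a b. a \<otimes>\<^bsub>A\<^esub> b)"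
  using A by (intro bilinear_mapI linear_mapI) (auto simp: A.l_distr A.r_distr k_algebra_def)

lemma mult_linear_left:
  "\<lbrakk>linear_map K L A F; b \<in> carrier A\<rbrakk> \<Longrightarrow> linear_map K L A (\<lambda>t. F t \<otimes>\<^bsub>A\<^esub> b)"
  using mult_bilinear linear_map_comp[of K A A "\<lambda>a. a \<otimes>\<^bsub>A\<^esub> b"] by (simp add: bilinear_map_def)

lemma mult_linear_right:
  "\<lbrakk>linear_map K L A F; b \<in> carrier A\<rbrakk> \<Longrightarrow> linear_map K L A (\<lambda>t. b \<otimes>\<^bsub>A\<^esub> F t)"
  using mult_bilinear linear_map_comp[of K A A "\<lambda>a. b \<otimes>\<^bsub>A\<^esub> a"] by (simp add: bilinear_map_def)

lemma mult_map_linear: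
  "linear_map K L (tensor K A A) F \<Longrightarrow> linear_map K L A (\<lambda>t. mult_map K A (F t))"
  by (simp add: mult_map_def mult_bilinear)

lemma mult_map_closed:
  "t \<in> carrier (tensor K A A) \<Longrightarrow> mult_map K A t \<in> carrier A"
  by (simp add: mult_map_def mult_bilinear)

lemma mult_map_pure:
  "\<lbrakk>a \<in> carrier A; b \<in> carrier A\<rbrakk> \<Longrightarrow> mult_map K A (pure K A A a b) = a \<otimes>\<^bsub>A\<^esub> b"
  by (simp add: mult_map_def mult_bilinear)

end

lemma tensor_algebra_simps [simp]:
  "carrier (tensor_algebra K A B) = carrier (tensor K A B)"
  "add (tensor_algebra K A B) = add (tensor K A B)"
  "smult (tensor_algebra K A B) = smult (tensor K A B)"
  "one (tensor_algebra K A B) = pure K A B \<one>\<^bsub>A\<^esub> \<one>\<^bsub>B\<^esub>"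
  "s \<otimes>\<^bsub>tensor_algebra K A B\<^esub> t =
     tensor_map K (tensor K A A) (tensor K B B) A B (mult_map K A) (mult_map K B)
       (middle_flip K A B A B (pure K (tensor K A B) (tensor K A B) s t))"
  by (simp_all add: tensor_algebra_def)

lemma linear_map_tensor_algebra [simp]:
  "linear_map K M (tensor_algebra K A B) f \<longleftrightarrow> linear_map K M (tensor K A B) f"
  by (simp add: linear_map_def)

section \<open>Hopf modules\<close>

sublocale crossed_module \<subseteq> H: group "XH X"
  by (rule group_H)

sublocale crossed_module \<subseteq> E: group "XE X"
  by (rule group_E)

context crossed_module
begin

abbreviation H where "H \<equiv> carrier (XH X)"
abbreviation E where "E \<equiv> carrier (XE X)"
abbreviation H_mult (infixl \<open>\<cdot>\<close> 70) where "x \<cdot> y \<equiv> x \<otimes>\<^bsub>XH X\<^esub> y"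
abbreviation H_one (\<open>\<e>\<close>) where "\<e> \<equiv> \<one>\<^bsub>XH X\<^esub>"
abbreviation H_inv where "H_inv x \<equiv> inv\<^bsub>XH X\<^esub> x"

lemma bdry_closed [simp]: "e \<in> E \<Longrightarrow> bdry X e \<in> H"
  using bdry_hom by (auto simp: hom_def)

lemma bdry_one [simp]: "bdry X \<one>\<^bsub>XE X\<^esub> = \<e>"
  using hom_one[OF bdry_hom group_E group_H] .

lemma shift_closed [simp]: "\<lbrakk>e \<in> E; x \<in> H\<rbrakk> \<Longrightarrow> shift X e x \<in> H"
  by (simp add: shift_def)

lemma shift_one [simp]: "x \<in> H \<Longrightarrow> shift X \<one>\<^bsub>XE X\<^esub> x = x"
  by (simp add: shift_def)

lemma shift_mult [simp]:
  "\<lbrakk>e \<in> E; f \<in> E; x \<in> H\<rbrakk> \<Longrightarrow> shift X (f \<otimes>\<^bsub>XE X\<^esub> e) x = shift X f (shift X e x)"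
  using bdry_hom by (simp add: shift_def hom_def H.m_assoc)

lemma xact_closed [simp]: "\<lbrakk>x \<in> H; e \<in> E\<rbrakk> \<Longrightarrow> xact X x e \<in> E"
  using act_auto by (auto simp: iso_def hom_def)

lemma xact_one [simp]: "x \<in> H \<Longrightarrow> xact X x \<one>\<^bsub>XE X\<^esub> = \<one>\<^bsub>XE X\<^esub>"
  using act_auto[of x] hom_one[OF _ group_E group_E] by (auto simp: iso_def)

lemma twist_closed [simp]: "\<lbrakk>e \<in> E; f \<in> E; x \<in> H\<rbrakk> \<Longrightarrow> twist X e x f \<in> E"
  by (simp add: twist_def)

lemma twist_one [simp]: "\<lbrakk>e \<in> E; x \<in> H\<rbrakk> \<Longrightarrow> twist X e x \<one>\<^bsub>XE X\<^esub> = e"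
  by (simp add: twist_def)

text \<open>Puts the two sides of \<open>phi_comul\<close> and of \<open>psi_coact\<close> over the
  same index. Equivariance gives \<open>xact X x f\<close> the boundary
  \<open>x \<cdot> bdry X f \<cdot> H_inv x\<close>, and its last factor cancels against the
  \<open>x\<close> in \<open>x \<cdot> y\<close>.\<close>

lemma shift_twist [simp]:
  assumes "e \<in> E" "f \<in> E" "x \<in> H" "y \<in> H"
  shows "shift X (twist X e x f) (x \<cdot> y) = shift X e x \<cdot> shift X f y"
proof -
  have "bdry X (e \<otimes>\<^bsub>XE X\<^esub> xact X x f) = bdry X e \<cdot> (x \<cdot> bdry X f \<cdot> H_inv x)"
    using assms bdry_hom by (simp add: hom_def equivariance)
  moreover have "H_inv x \<cdot> (x \<cdot> y) = y"
    using assms by (simp add: H.m_assoc[symmetric])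
  ultimately show ?thesis using assms by (simp add: shift_def twist_def H.m_assoc)
qed

end

section \<open>Rules for the structure maps of the Hopf coalgebra\<close>

context hopf_coalgebra
begin

abbreviation AT where "AT x V \<equiv> tensor K (alg A x) V"
abbreviation un where "un x \<equiv> \<one>\<^bsub>alg A x\<^esub>"
abbreviation AA where "AA x y \<equiv> tensor K (alg A x) (alg A y)"
abbreviation id_map where "id_map x V W f \<equiv> tensor_map K (alg A x) V (alg A x) W id f"
abbreviation ten where "ten x V a v \<equiv> pure K (alg A x) V a v"
abbreviation Triv where "Triv V \<equiv> triv K X A V"
abbreviation assoc where "assoc x y V \<equiv> tensor_assoc K (alg A x) (alg A y) V"
abbreviation comul_id where
  "comul_id x y V \<equiv> tensor_map K (alg A (x \<cdot> y)) V (AA x y) V (comul A x y) id"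

lemma algebra_alg [simp]: "x \<in> H \<Longrightarrow> k_algebra K (alg A x)"
  by (rule algebras)

lemma module_alg [simp]: "x \<in> H \<Longrightarrow> module K (alg A x)"
  by (simp add: k_algebra_module)

lemma cring_K [simp]: "cring K"
  using module_cring[OF module_alg[OF H.one_closed]] .

lemma ring_alg: "x \<in> H \<Longrightarrow> ring (alg A x)"
  using algebras k_algebra_ring by blast

lemma alg_simps [simp]:
  assumes "x \<in> H"
  shows "un x \<in> carrier (alg A x)"
    and "\<lbrakk>a \<in> carrier (alg A x); b \<in> carrier (alg A x)\<rbrakk> \<Longrightarrow> a \<otimes>\<^bsub>alg A x\<^esub> b \<in> carrier (alg A x)"
    and "a \<in> carrier (alg A x) \<Longrightarrow> a \<otimes>\<^bsub>alg A x\<^esub> un x = a"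
    and "a \<in> carrier (alg A x) \<Longrightarrow> un x \<otimes>\<^bsub>alg A x\<^esub> a = a"
    and "\<lbrakk>a \<in> carrier (alg A x); b \<in> carrier (alg A x); c \<in> carrier (alg A x)\<rbrakk> \<Longrightarrow>
      a \<otimes>\<^bsub>alg A x\<^esub> b \<otimes>\<^bsub>alg A x\<^esub> c = a \<otimes>\<^bsub>alg A x\<^esub> (b \<otimes>\<^bsub>alg A x\<^esub> c)"
  using ring_alg[OF assms] monoid.r_one[OF ring.is_monoid[OF ring_alg[OF assms]]]
  by (simp_all add: ring.ring_simprules)

lemma alg_mult_linear [simp]:
  assumes "x \<in> H"
  shows "\<lbrakk>linear_map K L (alg A x) F; b \<in> carrier (alg A x)\<rbrakk> \<Longrightarrow>
      linear_map K L (alg A x) (\<lambda>t. F t \<otimes>\<^bsub>alg A x\<^esub> b)"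
    and "\<lbrakk>linear_map K L (alg A x) F; b \<in> carrier (alg A x)\<rbrakk> \<Longrightarrow>
      linear_map K L (alg A x) (\<lambda>t. b \<otimes>\<^bsub>alg A x\<^esub> F t)"
    and "linear_map K L (AA x x) G \<Longrightarrow>
      linear_map K L (alg A x) (\<lambda>t. mult_map K (alg A x) (G t))"
    and "t \<in> carrier (AA x x) \<Longrightarrow> mult_map K (alg A x) t \<in> carrier (alg A x)"
    and "\<lbrakk>a \<in> carrier (alg A x); b \<in> carrier (alg A x)\<rbrakk> \<Longrightarrow>
      mult_map K (alg A x) (ten x (alg A x) a b) = a \<otimes>\<^bsub>alg A x\<^esub> b"
  using algebras[OF assms]
  by (simp_all add: mult_linear_left mult_linear_right mult_map_linear mult_map_closed
      mult_map_pure)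

lemma comul_linear [simp]:
  "\<lbrakk>x \<in> H; y \<in> H; linear_map K L (alg A (x \<cdot> y)) F\<rbrakk> \<Longrightarrow>
     linear_map K L (AA x y) (\<lambda>t. comul A x y (F t))"
  using comul_hom[of x y]
  by (auto simp: algebra_hom_def intro: linear_map_comp[of K "alg A (x \<cdot> y)"])

lemma comul_closed [simp]:
  "\<lbrakk>x \<in> H; y \<in> H; a \<in> carrier (alg A (x \<cdot> y))\<rbrakk> \<Longrightarrow>
     comul A x y a \<in> carrier (AA x y)"
  by (rule linear_map_closed[OF comul_linear[OF _ _ linear_map_ident]])

lemma comul_one [simp]:
  "\<lbrakk>x \<in> H; y \<in> H\<rbrakk> \<Longrightarrow>
     comul A x y \<one>\<^bsub>alg A (x \<cdot> y)\<^esub> = ten x (alg A y) (un x) (un y)"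
  using comul_hom[of x y] ring_hom_one by (fastforce simp: algebra_hom_def)

lemma comul_mult:
  "\<lbrakk>x \<in> H; y \<in> H; a \<in> carrier (alg A (x \<cdot> y)); b \<in> carrier (alg A (x \<cdot> y))\<rbrakk> \<Longrightarrow>
     comul A x y (a \<otimes>\<^bsub>alg A (x \<cdot> y)\<^esub> b) =
     tensor_map K (AA x x) (AA y y) (alg A x) (alg A y)
       (mult_map K (alg A x)) (mult_map K (alg A y))
       (middle_flip K (alg A x) (alg A y) (alg A x) (alg A y)
         (pure K (AA x y) (AA x y)
           (comul A x y a) (comul A x y b)))"
  using comul_hom[of x y] ring_hom_mult by (fastforce simp: algebra_hom_def)

lemma counit_linear [simp]:
  "linear_map K L (alg A \<e>) F \<Longrightarrow> linear_map K L (self_module K) (\<lambda>t. counit A (F t))"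
  using counit_hom by (auto simp: algebra_hom_def intro: linear_map_comp[of K "alg A \<e>"])

lemma counit_closed [simp]: "a \<in> carrier (alg A \<e>) \<Longrightarrow> counit A a \<in> carrier K"
  using linear_map_closed[OF counit_linear[OF linear_map_ident]] by simp

lemma counit_one [simp]: "counit A (un \<e>) = \<one>\<^bsub>K\<^esub>"
  using counit_hom ring_hom_one by (fastforce simp: algebra_hom_def)

lemma antipode_linear' [simp]:
  "\<lbrakk>x \<in> H; linear_map K L (alg A (H_inv x)) F\<rbrakk> \<Longrightarrow>
     linear_map K L (alg A x) (\<lambda>t. antipode A x (F t))"
  using linear_map_comp[OF antipode_linear] .

lemma antipode_closed [simp]:
  "\<lbrakk>x \<in> H; a \<in> carrier (alg A (H_inv x))\<rbrakk> \<Longrightarrow> antipode A x a \<in> carrier (alg A x)"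
  by (rule linear_map_closed[OF antipode_linear])

lemma phi_linear [simp]:
  "\<lbrakk>x \<in> H; e \<in> E; linear_map K L (alg A x) F\<rbrakk> \<Longrightarrow>
     linear_map K L (alg A (shift X e x)) (\<lambda>t. phi A x e (F t))"
  using phi_hom[of x e] by (auto simp: algebra_hom_def intro: linear_map_comp[of K "alg A x"])

lemma phi_closed [simp]:
  "\<lbrakk>x \<in> H; e \<in> E; a \<in> carrier (alg A x)\<rbrakk> \<Longrightarrow> phi A x e a \<in> carrier (alg A (shift X e x))"
  by (rule linear_map_closed[OF phi_linear[OF _ _ linear_map_ident]])

lemma phi_unit [simp]: "\<lbrakk>x \<in> H; e \<in> E\<rbrakk> \<Longrightarrow> phi A x e (un x) = \<one>\<^bsub>alg A (shift X e x)\<^esub>"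
  using phi_hom[of x e] ring_hom_one by (fastforce simp: algebra_hom_def)

lemma phi_times [simp]:
  "\<lbrakk>x \<in> H; e \<in> E; a \<in> carrier (alg A x); b \<in> carrier (alg A x)\<rbrakk> \<Longrightarrow>
     phi A x e (a \<otimes>\<^bsub>alg A x\<^esub> b) = phi A x e a \<otimes>\<^bsub>alg A (shift X e x)\<^esub> phi A x e b"
  using phi_hom[of x e] ring_hom_mult by (fastforce simp: algebra_hom_def)

end

text \<open>Only the typing and linearity of the structure maps. This is what maps of Hopf modules
  and the transport of structure require of a family whose Hopf module axioms are still to be
  proved.\<close>

locale hmod_data = hopf_coalgebra K X A
  for K :: "'k ring" and X :: "('e, 'h) xmod" and A :: "('k, 'h, 'e, 'a) hcoalg" +
  fixes M :: "('k, 'h, 'e, 'a, 'm) hmod"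
  assumes modl_module: "x \<in> carrier (XH X) \<Longrightarrow> module K (modl M x)"
    and act_linear: "x \<in> carrier (XH X) \<Longrightarrow>
       linear_map K (tensor K (alg A x) (modl M x)) (modl M x) (hact M x)"
    and coact_lin: "\<lbrakk>x \<in> carrier (XH X); y \<in> carrier (XH X)\<rbrakk> \<Longrightarrow>
       linear_map K (modl M (x \<otimes>\<^bsub>XH X\<^esub> y)) (tensor K (alg A x) (modl M y)) (coact M x y)"
    and psi_lin: "\<lbrakk>x \<in> carrier (XH X); e \<in> carrier (XE X)\<rbrakk> \<Longrightarrow>
       linear_map K (modl M x) (modl M (shift X e x)) (psi M x e)"
begin

lemma module_modl [simp]: "x \<in> H \<Longrightarrow> module K (modl M x)"
  by (rule modl_module)

lemma hact_linear' [simp]: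
  "\<lbrakk>x \<in> H; linear_map K L (AT x (modl M x)) F\<rbrakk> \<Longrightarrow>
     linear_map K L (modl M x) (\<lambda>t. hact M x (F t))"
  using linear_map_comp[OF act_linear] .

lemma hact_closed [simp]:
  "\<lbrakk>x \<in> H; t \<in> carrier (AT x (modl M x))\<rbrakk> \<Longrightarrow> hact M x t \<in> carrier (modl M x)"
  by (rule linear_map_closed[OF act_linear])

lemma coact_linear' [simp]:
  "\<lbrakk>x \<in> H; y \<in> H; linear_map K L (modl M (x \<cdot> y)) F\<rbrakk> \<Longrightarrow>
     linear_map K L (AT x (modl M y)) (\<lambda>t. coact M x y (F t))"
  using linear_map_comp[OF coact_lin] .

lemma coact_closed [simp]:
  "\<lbrakk>x \<in> H; y \<in> H; m \<in> carrier (modl M (x \<cdot> y))\<rbrakk> \<Longrightarrow>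
     coact M x y m \<in> carrier (AT x (modl M y))"
  by (rule linear_map_closed[OF coact_lin])

lemma psi_linear' [simp]:
  "\<lbrakk>x \<in> H; e \<in> E; linear_map K L (modl M x) F\<rbrakk> \<Longrightarrow>
     linear_map K L (modl M (shift X e x)) (\<lambda>t. psi M x e (F t))"
  using linear_map_comp[OF psi_lin] .

lemma psi_closed [simp]:
  "\<lbrakk>x \<in> H; e \<in> E; m \<in> carrier (modl M x)\<rbrakk> \<Longrightarrow> psi M x e m \<in> carrier (modl M (shift X e x))"
  by (rule linear_map_closed[OF psi_lin])

text \<open>The factorwise action of A_x \<otimes> A_y on A_x \<otimes> M_y. Precomposed with
  \<open>comul A x y\<close> it becomes the action through which \<open>coact_hact\<close> says that
  the coaction is a map of modules.\<close>

definition diag_act where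
  "diag_act x y t = tensor_map K (AA x x) (AT y (modl M y))
     (alg A x) (modl M y) (mult_map K (alg A x)) (hact M y)
     (middle_flip K (alg A x) (alg A y) (alg A x) (modl M y) t)"

lemma diag_act_linear [simp]:
  "\<lbrakk>x \<in> H; y \<in> H;
    linear_map K L (tensor K (AA x y) (AT x (modl M y))) F\<rbrakk> \<Longrightarrow>
     linear_map K L (AT x (modl M y)) (\<lambda>t. diag_act x y (F t))"
  by (simp add: diag_act_def)

lemma diag_act_closed [simp]:
  "\<lbrakk>x \<in> H; y \<in> H; t \<in> carrier (tensor K (AA x y) (AT x (modl M y)))\<rbrakk>
     \<Longrightarrow> diag_act x y t \<in> carrier (AT x (modl M y))"
  by (simp add: diag_act_def)

lemma diag_act_pure [simp]:
  "\<lbrakk>x \<in> H; y \<in> H; a \<in> carrier (alg A x); b \<in> carrier (alg A y); c \<in> carrier (alg A x);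
    m \<in> carrier (modl M y)\<rbrakk> \<Longrightarrow>
   diag_act x y (pure K (AA x y) (AT x (modl M y))
     (ten x (alg A y) a b) (ten x (modl M y) c m)) =
   ten x (modl M y) (a \<otimes>\<^bsub>alg A x\<^esub> c) (hact M y (ten y (modl M y) b m))"
  by (simp add: diag_act_def)

end

locale hopf_module_over = hopf_coalgebra K X A + hopf_module K X A M
  for K :: "'k ring" and X :: "('e, 'h) xmod" and A :: "('k, 'h, 'e, 'a) hcoalg"
    and M :: "('k, 'h, 'e, 'a, 'm) hmod"

sublocale hopf_module_over \<subseteq> hmod_data
  by (intro hmod_data.intro hmod_data_axioms.intro hopf_coalgebra_axioms modules hact_linear
      coact_linear psi_linear)

section \<open>The projection to the coinvariants\<close>

context hopf_module_over
begin

text \<open>With \<open>\<Phi> = B (id \<otimes> F) \<rho>\<^sub>z\<^sub>,\<^sub>1\<close>, the formula reads \<open>F = B (S \<otimes> \<Phi>) \<rho>\<close>,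
    so \<open>F\<close> is determined by \<open>\<Phi>\<close>.
  The two uses below replace the anticomultiplicativity of \<open>S\<close> and its compatibility with \<open>\<phi>\<close>.\<close>

lemma determined_by_coaction:
  assumes z: "z \<in> H" and N [simp]: "module K N"
    and B: "linear_map K (AT z N) N B"
    and B_one: "\<And>n. n \<in> carrier N \<Longrightarrow> B (ten z N (un z) n) = n"
    and B_mult: "\<And>a b n. \<lbrakk>a \<in> carrier (alg A z); b \<in> carrier (alg A z); n \<in> carrier N\<rbrakk> \<Longrightarrow>
      B (ten z N (a \<otimes>\<^bsub>alg A z\<^esub> b) n) =
      B (ten z N a (B (ten z N b n)))"
    and F: "linear_map K (modl M \<e>) N F"
    and m: "m \<in> carrier (modl M \<e>)"
  shows "F m = B (tensor_map K (alg A (H_inv z)) (modl M z) (alg A z) N (antipode A z)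
      (\<lambda>m'. B (id_map z (modl M \<e>) N F (coact M z \<e> m')))
      (coact M (H_inv z) z m))"
proof -
  interpret N: module K N by fact
  note [simp] = z m linear_map_comp[OF B] linear_map_closed[OF B] linear_map_comp[OF F]
    linear_map_closed[OF F] F
  let ?z = "H_inv z"
  let ?BF = "\<lambda>u. B (id_map z (modl M \<e>) N F u)"
  let ?L = "\<lambda>t. B (tensor_map K (alg A ?z) (AT z (modl M \<e>)) (alg A z) N
      (antipode A z) ?BF (assoc ?z z (modl M \<e>) t))"
  \<comment> \<open>Acting with the second factor of \<open>s\<close> and then with the antipode of
    the first is a single action by their product, by \<open>B_mult\<close>; this is the shape that
    \<open>antipode_left\<close> evaluates.\<close>
  have inner: "?L (pure K (AA ?z z) (modl M \<e>) s n) =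
      B (ten z N (mult_map K (alg A z)
        (tensor_map K (alg A ?z) (alg A z) (alg A z) (alg A z) (antipode A z) id s)) (F n))"
    if s: "s \<in> carrier (AA ?z z)" and n: "n \<in> carrier (modl M \<e>)" for s n
    by (rule tensor_eqI[OF s, of N]) (simp_all add: n B_mult)
  have outer: "?L (tensor_map K (alg A \<e>) (modl M \<e>) (AA ?z z) (modl M \<e>)
      (comul A ?z z) id t) = F (tensor_unit_left K (modl M \<e>)
        (tensor_map K (alg A \<e>) (modl M \<e>) (self_module K) (modl M \<e>) (counit A) id t))"
    if t: "t \<in> carrier (AT \<e> (modl M \<e>))" for t
  proof (rule tensor_eqI[OF t, of N], goal_cases)
    \<comment> \<open>Once the tensor is supplied, the sixth goal of \<open>tensor_eqI\<close> is
      the comparison on pure tensors; the first five are the module and linearity conditions. The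
      same numbering recurs below.\<close>
    case (6 a n)
    have "B (ten z N (counit A a \<odot>\<^bsub>alg A z\<^esub> (un z)) (F n)) =
        counit A a \<odot>\<^bsub>N\<^esub> B (ten z N (un z) (F n))"
      by (rule linear_map_smult[where M = "alg A z" and K = K]) (simp_all add: 6)
    then show ?case
      using 6 by (simp add: inner[unfolded id_def] antipode_left[unfolded id_def] id_def B_one
        linear_map_smult[OF F])
  qed simp_all
  have "B (tensor_map K (alg A ?z) (modl M z) (alg A z) N (antipode A z)
      (\<lambda>m'. ?BF (coact M z \<e> m')) (coact M ?z z m)) =
    B (tensor_map K (alg A ?z) (AT z (modl M \<e>)) (alg A z) N (antipode A z) ?BF
      (id_map ?z (modl M z) (AT z (modl M \<e>)) (coact M z \<e>) (coact M ?z z m)))"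
    by (subst tensor_map_comp) simp_all
  \<comment> \<open>Coassociativity at \<open>(?z, z, \<e>)\<close>: as \<open>?z \<cdot> z\<close>
    is \<open>\<e>\<close>, the iterated coaction is \<open>comul A ?z z\<close> applied after
    \<open>coact M \<e> \<e>\<close>, which is where \<open>outer\<close> applies.\<close>
  also have "id_map ?z (modl M z) (AT z (modl M \<e>)) (coact M z \<e>) (coact M ?z z m) =
      assoc ?z z (modl M \<e>) (tensor_map K (alg A \<e>) (modl M \<e>)
        (AA ?z z) (modl M \<e>) (comul A ?z z) id (coact M \<e> \<e> m))"
    using coact_coassoc[of ?z z \<e> m] by simp
  also have "?L (tensor_map K (alg A \<e>) (modl M \<e>)
        (AA ?z z) (modl M \<e>) (comul A ?z z) id (coact M \<e> \<e> m)) = F m"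
    by (simp add: outer coact_counit)
  finally show ?thesis by (simp add: id_def)
qed

lemma coaction_ext:
  assumes z: "z \<in> H" and N: "module K N"
    and B: "linear_map K (AT z N) N B"
    and B_one: "\<And>n. n \<in> carrier N \<Longrightarrow> B (ten z N (un z) n) = n"
    and B_mult: "\<And>a b n. \<lbrakk>a \<in> carrier (alg A z); b \<in> carrier (alg A z); n \<in> carrier N\<rbrakk> \<Longrightarrow>
      B (ten z N (a \<otimes>\<^bsub>alg A z\<^esub> b) n) =
      B (ten z N a (B (ten z N b n)))"
    and F: "linear_map K (modl M \<e>) N F" and G: "linear_map K (modl M \<e>) N G"
    and eq: "\<And>m'. m' \<in> carrier (modl M z) \<Longrightarrow>
      B (id_map z (modl M \<e>) N F (coact M z \<e> m')) =
      B (id_map z (modl M \<e>) N G (coact M z \<e> m'))"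
    and m: "m \<in> carrier (modl M \<e>)"
  shows "F m = G m"
proof -
  have "tensor_map K (alg A (H_inv z)) (modl M z) (alg A z) N (antipode A z)
      (\<lambda>m'. B (id_map z (modl M \<e>) N F (coact M z \<e> m')))
      (coact M (H_inv z) z m) =
    tensor_map K (alg A (H_inv z)) (modl M z) (alg A z) N (antipode A z)
      (\<lambda>m'. B (id_map z (modl M \<e>) N G (coact M z \<e> m')))
      (coact M (H_inv z) z m)"
    by (rule tensor_map_cong) (simp_all add: eq z N F m linear_map_comp[OF B])
  then show ?thesis
    using determined_by_coaction[OF z N B B_one B_mult F m]
      determined_by_coaction[OF z N B B_one B_mult G m] by simp
qed

text \<open>\<open>proj x\<close> is \<open>P\<^sub>x\<close> and \<open>proj_family\<close> is \<open>P\<close> in the notation of the introduction.\<close>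

definition proj where
  "proj x m = hact M x (tensor_map K (alg A (H_inv x)) (modl M x) (alg A x) (modl M x)
     (antipode A x) id (coact M (H_inv x) x m))"

lemma proj_linear [simp]:
  "\<lbrakk>x \<in> H; linear_map K L (modl M \<e>) F\<rbrakk> \<Longrightarrow> linear_map K L (modl M x) (\<lambda>t. proj x (F t))"
  by (simp add: proj_def)

lemma proj_closed [simp]: "\<lbrakk>x \<in> H; m \<in> carrier (modl M \<e>)\<rbrakk> \<Longrightarrow> proj x m \<in> carrier (modl M x)"
  by (simp add: proj_def)

lemma hact_scalar:
  assumes "x \<in> H" "c \<in> carrier K" "m \<in> carrier (modl M x)"
  shows "hact M x (ten x (modl M x) (c \<odot>\<^bsub>alg A x\<^esub> (un x)) m) = c \<odot>\<^bsub>modl M x\<^esub> m"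
proof -
  have "hact M x (ten x (modl M x) (c \<odot>\<^bsub>alg A x\<^esub> (un x)) m) =
      c \<odot>\<^bsub>modl M x\<^esub> hact M x (ten x (modl M x) (un x) m)"
    by (rule linear_map_smult[where M = "alg A x" and K = K]) (simp_all add: assms)
  then show ?thesis using assms by (simp add: hact_one)
qed

text \<open>Mirror image of \<open>determined_by_coaction\<close>: the antipode now falls on the
  second of the two factors to be multiplied, so the sum collapses by \<open>antipode_right\<close>
  instead of \<open>antipode_left\<close>.\<close>

lemma reconstruct:
  assumes x [simp]: "x \<in> H" and m [simp]: "m \<in> carrier (modl M x)"
  shows "hact M x (id_map x (modl M \<e>) (modl M x) (proj x)
    (coact M x \<e> m)) = m"
proof -
  interpret Mx: module K "modl M x" by simp
  let ?x = "H_inv x"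
  let ?L = "\<lambda>t. hact M x (id_map x (AT ?x (modl M x)) (modl M x) (\<lambda>u. hact M x (tensor_map K (alg
      A ?x) (modl M x) (alg A x) (modl M x) (antipode A x) id u))
      (assoc x ?x (modl M x) t))"
  have inner: "?L (pure K (AA x ?x) (modl M x) s n) =
      hact M x (ten x (modl M x) (mult_map K (alg A x)
        (id_map x (alg A ?x) (alg A x) (antipode A x) s)) n)"
    if s: "s \<in> carrier (AA x ?x)" and n: "n \<in> carrier (modl M x)" for s n
    by (rule tensor_eqI[OF s, of "modl M x"]) (simp_all add: n hact_mult)
  have outer: "?L (tensor_map K (alg A \<e>) (modl M x) (AA x ?x) (modl M x)
      (comul A x ?x) id t) = tensor_unit_left K (modl M x)
        (tensor_map K (alg A \<e>) (modl M x) (self_module K) (modl M x) (counit A) id t)"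
    if t: "t \<in> carrier (AT \<e> (modl M x))" for t
    by (rule tensor_eqI[OF t, of "modl M x"]) (simp_all add: inner[unfolded id_def]
      antipode_right[unfolded id_def] hact_scalar id_def)
  have "hact M x (id_map x (modl M \<e>) (modl M x) (proj x)
      (coact M x \<e> m)) =
    hact M x (id_map x (AT ?x (modl M x)) (modl M x) (\<lambda>u. hact M x (tensor_map K (alg A ?x) (modl
        M x) (alg A x) (modl M x) (antipode A x) id u))
      (id_map x (modl M \<e>) (AT ?x (modl M x)) (coact M ?x x) (coact M x \<e> m)))"
    by (subst tensor_map_comp) (simp_all add: proj_def[abs_def] id_def)
  also have "id_map x (modl M \<e>) (AT ?x (modl M x)) (coact M ?x x) (coact M x \<e> m) =
      assoc x ?x (modl M x) (tensor_map K (alg A \<e>) (modl M x)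
        (AA x ?x) (modl M x) (comul A x ?x) id (coact M \<e> x m))"
    using coact_coassoc[of x ?x x m] by simp
  also have "?L (tensor_map K (alg A \<e>) (modl M x)
        (AA x ?x) (modl M x) (comul A x ?x) id (coact M \<e> x m)) = m"
    by (simp add: outer coact_counit)
  finally show ?thesis .
qed

lemma coact_hact':
  assumes "x \<in> H" "y \<in> H" "t \<in> carrier (AT (x \<cdot> y) (modl M (x \<cdot> y)))"
  shows "coact M x y (hact M (x \<cdot> y) t) = diag_act x y
    (tensor_map K (alg A (x \<cdot> y)) (modl M (x \<cdot> y))
      (AA x y) (AT x (modl M y)) (comul A x y) (coact M x y) t)"
  unfolding diag_act_def by (rule coact_hact[OF assms])

lemma diag_act_one:
  assumes [simp]: "x \<in> H" "y \<in> H" and n: "n \<in> carrier (AT x (modl M y))"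
  shows "diag_act x y (pure K (AA x y) (AT x (modl M y))
    (ten x (alg A y) (un x) (un y)) n) = n"
  by (rule tensor_eqI[OF n, of "AT x (modl M y)"]) (simp_all add: hact_one)

text \<open>The product of \<open>s\<close> and \<open>s'\<close> in \<open>tensor_algebra\<close>
  is written out because \<open>comul_mult\<close> delivers it in this form; together they make the
  action pulled back along \<open>comul\<close> multiplicative.\<close>

lemma diag_act_mult:
  assumes [simp]: "x \<in> H" "y \<in> H"
    and s: "s \<in> carrier (AA x y)"
    and s': "s' \<in> carrier (AA x y)"
    and n: "n \<in> carrier (AT x (modl M y))"
  shows "diag_act x y (pure K (AA x y) (AT x (modl M y))
      (tensor_map K (AA x x) (AA y y) (alg A x) (alg A y)
        (mult_map K (alg A x)) (mult_map K (alg A y))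
        (middle_flip K (alg A x) (alg A y) (alg A x) (alg A y)
          (pure K (AA x y) (AA x y) s s'))) n) =
    diag_act x y (pure K (AA x y) (AT x (modl M y)) s
      (diag_act x y (pure K (AA x y) (AT x (modl M y)) s' n)))"
proof (rule tensor_eqI[OF s, of "AT x (modl M y)"], goal_cases)
  case (6 a b)
  show ?case
  proof (rule tensor_eqI[OF s', of "AT x (modl M y)"], goal_cases)
    case (6 a' b')
    show ?case
      by (rule tensor_eqI[OF n, of "AT x (modl M y)"])
        (simp_all add: 6 \<open>a \<in> _\<close> \<open>b \<in> _\<close> hact_mult)
  qed (simp_all add: 6 n)
qed (simp_all add: s' n)

text \<open>Coinvariant elements have coactions of the form 1 \<otimes> m, and on these the diagonal
  action only uses the action on \<open>m\<close>.\<close>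

lemma diag_act_unit:
  assumes [simp]: "x \<in> H" "y \<in> H" and s: "s \<in> carrier (AA x y)"
    and m [simp]: "m \<in> carrier (modl M y)"
  shows "diag_act x y (pure K (AA x y) (AT x (modl M y)) s
      (ten x (modl M y) (un x) m)) =
    id_map x (alg A y) (modl M y) (\<lambda>b. hact M y (ten y (modl M y) b m)) s"
  by (rule tensor_eqI[OF s, of "AT x (modl M y)"]) simp_all

lemma coact_proj:
  assumes x [simp]: "x \<in> H" and y [simp]: "y \<in> H" and m: "m \<in> carrier (modl M \<e>)"
  shows "coact M x y (proj (x \<cdot> y) m) = ten x (modl M y) (un x) (proj y m)"
proof -
  let ?z = "x \<cdot> y"
  let ?N = "AT x (modl M y)"
  \<comment> \<open>The diagonal action pulled back along the algebra map
    \<open>comul A x y\<close>. With it both \<open>?F\<close> and \<open>?G\<close> induce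
    \<open>coact M x y\<close>.\<close>
  let ?B = "\<lambda>t. diag_act x y (tensor_map K (alg A ?z) ?N (AA x y) ?N
    (comul A x y) id t)"
  let ?F = "\<lambda>m. coact M x y (proj ?z m)"
  let ?G = "\<lambda>m. ten x (modl M y) (un x) (proj y m)"
  have B: "linear_map K (AT ?z ?N) ?N ?B"
    and B_one: "\<And>n. n \<in> carrier ?N \<Longrightarrow> ?B (ten ?z ?N (un ?z) n) = n"
    and B_mult: "\<And>a b n. \<lbrakk>a \<in> carrier (alg A ?z); b \<in> carrier (alg A ?z); n \<in> carrier ?N\<rbrakk> \<Longrightarrow>
      ?B (ten ?z ?N (a \<otimes>\<^bsub>alg A ?z\<^esub> b) n) =
      ?B (ten ?z ?N a (?B (ten ?z ?N b n)))"
    by (simp_all add: diag_act_one comul_mult diag_act_mult)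
  \<comment> \<open>\<open>reconstruct\<close> expresses \<open>n\<close> through the action on its
    projected coaction; \<open>coact_hact'\<close> turns the coaction of that expression into the
    left-hand side.\<close>
  have \<Phi>F: "?B (id_map ?z (modl M \<e>) ?N ?F (coact M ?z \<e> n)) = coact M x y n"
    if n [simp]: "n \<in> carrier (modl M ?z)" for n
  proof -
    let ?t = "id_map ?z (modl M \<e>) (modl M ?z) (proj ?z) (coact M ?z \<e> n)"
    have "coact M x y n = coact M x y (hact M ?z ?t)" by (simp add: reconstruct)
    also have "\<dots> = diag_act x y (tensor_map K (alg A ?z) (modl M ?z)
        (AA x y) ?N (comul A x y) (coact M x y) ?t)"
      by (simp add: coact_hact')
    finally show ?thesis by (simp add: tensor_map_comp)
  qed
  \<comment> \<open>By coassociativity the left-hand side is \<open>coact M x y n\<close> with its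
    second factor expanded by \<open>coact M y \<e>\<close> and reassembled by \<open>?R\<close>.
    Expanding and reassembling is the identity, by \<open>reconstruct\<close> over
    \<open>y\<close>.\<close>
  have \<Phi>G: "?B (id_map ?z (modl M \<e>) ?N ?G (coact M ?z \<e> n)) = coact M x y n"
    if n [simp]: "n \<in> carrier (modl M ?z)" for n
  proof -
    let ?R = "\<lambda>u. hact M y (id_map y (modl M \<e>) (modl M y) (proj y) u)"
    let ?A = "assoc x y (modl M \<e>)"
    let ?RA = "\<lambda>t. id_map x (AT y (modl M \<e>)) (modl M y) ?R (?A t)"
    have step: "?B (id_map ?z (modl M \<e>) ?N ?G t) =
        ?RA (tensor_map K (alg A ?z) (modl M \<e>) (AA x y) (modl M \<e>) (comul A x y) id t)"
      if t: "t \<in> carrier (AT ?z (modl M \<e>))" for t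
    proof (rule tensor_eqI[OF t, of ?N], goal_cases)
      case (6 a k)
      have s: "comul A x y a \<in> carrier (AA x y)" using 6 by simp
      have "id_map x (alg A y) (modl M y) (\<lambda>b. hact M y (ten y (modl M y) b (proj y k))) (comul A
          x y a) =
        ?RA (pure K (AA x y) (modl M \<e>) (comul A x y a) k)"
        by (rule tensor_eqI[OF s, of ?N]) (simp_all add: 6)
      then show ?case using 6 by (simp add: diag_act_unit id_def)
    qed simp_all
    have "?B (id_map ?z (modl M \<e>) ?N ?G (coact M ?z \<e> n)) =
      ?RA (tensor_map K (alg A ?z) (modl M \<e>) (AA x y) (modl M \<e>) (comul A x y) id
        (coact M ?z \<e> n))"
      by (rule step) simp
    also have "\<dots> = id_map x (AT y (modl M \<e>)) (modl M y) ?R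
      (id_map x (modl M y) (AT y (modl M \<e>)) (coact M y \<e>)
        (coact M x y n))"
      using coact_coassoc[of x y \<e> n] by simp
    also have "\<dots> = coact M x y n"
      by (subst tensor_map_comp) (simp_all add: tensor_map_ident reconstruct)
    finally show ?thesis .
  qed
  have F: "linear_map K (modl M \<e>) ?N ?F" and G: "linear_map K (modl M \<e>) ?N ?G" by simp_all
  show ?thesis
    by (rule coaction_ext[where F = ?F and G = ?G and B = ?B and z = ?z,
        OF _ _ B B_one B_mult F G _ m])
      (simp_all add: \<Phi>F \<Phi>G)
qed

end

lemma pure_smult_left:
  "\<lbrakk>module K M; module K N; c \<in> carrier K; m \<in> carrier M; n \<in> carrier N\<rbrakk> \<Longrightarrow>
     pure K M N (c \<odot>\<^bsub>M\<^esub> m) n = c \<odot>\<^bsub>tensor K M N\<^esub> pure K M N m n"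
  by (rule linear_map_smult[where f = "\<lambda>m. pure K M N m n"]) simp_all

lemma pure_smult_right:
  "\<lbrakk>module K M; module K N; c \<in> carrier K; m \<in> carrier M; n \<in> carrier N\<rbrakk> \<Longrightarrow>
     pure K M N m (c \<odot>\<^bsub>N\<^esub> n) = c \<odot>\<^bsub>tensor K M N\<^esub> pure K M N m n"
  by (rule linear_map_smult[where f = "\<lambda>n. pure K M N m n"]) simp_all

context hopf_module_over
begin

lemma psi_proj:
  assumes x [simp]: "x \<in> H" and e [simp]: "e \<in> E" and m: "m \<in> carrier (modl M \<e>)"
  shows "psi M x e (proj x m) = proj (shift X e x) m"
proof -
  let ?y = "shift X e x"
  let ?N = "modl M ?y"
  \<comment> \<open>Here the action is pulled back along \<open>phi A x e\<close>, and the map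
    induced by both sides is \<open>psi M x e\<close>.\<close>
  let ?B = "\<lambda>t. hact M ?y (tensor_map K (alg A x) ?N (alg A ?y) ?N (phi A x e) id t)"
  let ?F = "\<lambda>m. psi M x e (proj x m)"
  let ?G = "proj ?y"
  have B: "linear_map K (AT x ?N) ?N ?B"
    and B_one: "\<And>n. n \<in> carrier ?N \<Longrightarrow> ?B (ten x ?N (un x) n) = n"
    and B_mult: "\<And>a b n. \<lbrakk>a \<in> carrier (alg A x); b \<in> carrier (alg A x); n \<in> carrier ?N\<rbrakk> \<Longrightarrow>
      ?B (ten x ?N (a \<otimes>\<^bsub>alg A x\<^esub> b) n) =
      ?B (ten x ?N a (?B (ten x ?N b n)))"
    by (simp_all add: hact_one hact_mult)
  have \<Phi>F: "?B (id_map x (modl M \<e>) ?N ?F (coact M x \<e> n)) = psi M x e n"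
    if n [simp]: "n \<in> carrier (modl M x)" for n
  proof -
    let ?t = "id_map x (modl M \<e>) (modl M x) (proj x) (coact M x \<e> n)"
    have "psi M x e n = psi M x e (hact M x ?t)" by (simp add: reconstruct)
    also have "\<dots> = hact M ?y (tensor_map K (alg A x) (modl M x) (alg A ?y) ?N (phi A x e) (psi M x
        e) ?t)"
      by (simp add: psi_hact)
    finally show ?thesis by (simp add: tensor_map_comp)
  qed
  have \<Phi>G: "?B (id_map x (modl M \<e>) ?N ?G (coact M x \<e> n)) = psi M x e n"
    if n [simp]: "n \<in> carrier (modl M x)" for n
  proof -
    have "tensor_map K (alg A x) ?N (alg A ?y) ?N (phi A x e) id
        (id_map x (modl M \<e>) ?N ?G (coact M x \<e> n)) =
      tensor_map K (alg A x) (modl M \<e>) (alg A ?y) ?N (\<lambda>a. phi A x e a) (\<lambda>m. ?G (psi M \<e> \<one>\<^bsub>XE X\<^esub> m))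
        (coact M x \<e> n)"
      by (subst tensor_map_comp, simp_all)
        (rule tensor_map_cong, simp_all add: psi_one)
    also have "\<dots> = id_map ?y (modl M \<e>) ?N ?G
      (tensor_map K (alg A x) (modl M \<e>) (alg A ?y) (modl M \<e>) (phi A x e) (psi M \<e> \<one>\<^bsub>XE X\<^esub>)
        (coact M x \<e> n))"
      using psi_linear[of \<e> "\<one>\<^bsub>XE X\<^esub>"] by (subst tensor_map_comp) simp_all
    also have "tensor_map K (alg A x) (modl M \<e>) (alg A ?y) (modl M \<e>) (phi A x e) (psi M \<e> \<one>\<^bsub>XE X\<^esub>)
        (coact M x \<e> n) = coact M ?y \<e> (psi M x e n)"
      using psi_coact[of x \<e> e "\<one>\<^bsub>XE X\<^esub>" n] by simp
    finally show ?thesis by (simp add: reconstruct[unfolded id_def] id_def)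
  qed
  have F: "linear_map K (modl M \<e>) ?N ?F" and G: "linear_map K (modl M \<e>) ?N ?G" by simp_all
  show ?thesis
    by (rule coaction_ext[where F = ?F and G = ?G and B = ?B and z = x,
        OF _ _ B B_one B_mult F G _ m])
      (simp_all add: \<Phi>F \<Phi>G)
qed

section \<open>The module of coinvariants\<close>

abbreviation coinvariants where "coinvariants \<equiv> coinv K X A M"

lemma coinv_iff:
  "m \<in> carrier coinvariants \<longleftrightarrow> m \<in> (\<Pi>\<^sub>E x\<in>H. carrier (modl M x)) \<and>
     (\<forall>x\<in>H. \<forall>y\<in>H. coact M x y (m (x \<cdot> y)) = ten x (modl M y) (un x) (m y)) \<and>
     (\<forall>x\<in>H. \<forall>e\<in>E. psi M x e (m x) = m (shift X e x))"
  by (simp add: coinv_def)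

lemma coinv_value: "\<lbrakk>m \<in> carrier coinvariants; x \<in> H\<rbrakk> \<Longrightarrow> m x \<in> carrier (modl M x)"
  by (auto simp: coinv_iff)

lemma coinv_coact:
  "\<lbrakk>m \<in> carrier coinvariants; x \<in> H; y \<in> H\<rbrakk> \<Longrightarrow>
     coact M x y (m (x \<cdot> y)) = ten x (modl M y) (un x) (m y)"
  by (auto simp: coinv_iff)

lemma coinv_psi:
  "\<lbrakk>m \<in> carrier coinvariants; x \<in> H; e \<in> E\<rbrakk> \<Longrightarrow> psi M x e (m x) = m (shift X e x)"
  by (auto simp: coinv_iff)

lemma coinv_eqI:
  "\<lbrakk>m \<in> carrier coinvariants; n \<in> carrier coinvariants; \<And>x. x \<in> H \<Longrightarrow> m x = n x\<rbrakk> \<Longrightarrow> m = n"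
  by (auto simp: coinv_iff intro: PiE_ext)

lemma coinv_restrict: "m \<in> carrier coinvariants \<Longrightarrow> (\<lambda>x\<in>H. m x) = m"
  by (auto simp: coinv_iff PiE_iff intro: extensional_restrict)

lemma coinvI:
  assumes "\<And>x. x \<in> H \<Longrightarrow> f x \<in> carrier (modl M x)"
    and "\<And>x y. \<lbrakk>x \<in> H; y \<in> H\<rbrakk> \<Longrightarrow>
      coact M x y (f (x \<cdot> y)) = ten x (modl M y) (un x) (f y)"
    and "\<And>x e. \<lbrakk>x \<in> H; e \<in> E\<rbrakk> \<Longrightarrow> psi M x e (f x) = f (shift X e x)"
  shows "(\<lambda>x\<in>H. f x) \<in> carrier coinvariants"
  using assms by (simp add: coinv_iff)

lemma coinv_ops:
  "\<zero>\<^bsub>coinvariants\<^esub> = (\<lambda>x\<in>H. \<zero>\<^bsub>modl M x\<^esub>)"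
  "m \<oplus>\<^bsub>coinvariants\<^esub> n = (\<lambda>x\<in>H. m x \<oplus>\<^bsub>modl M x\<^esub> n x)"
  "c \<odot>\<^bsub>coinvariants\<^esub> m = (\<lambda>x\<in>H. c \<odot>\<^bsub>modl M x\<^esub> m x)"
  by (simp_all add: coinv_def)

text \<open>The conditions defining a coinvariant equate linear maps of the family, hence survive
  the pointwise operations. The two unit laws return a family restricted to \<open>H\<close>, which
  \<open>coinv_restrict\<close> identifies with the family itself.\<close>

lemma module_coinv [simp]: "module K coinvariants"
proof -
  have M: "module K (modl M x)" if "x \<in> H" for x using that by simp
  note ag = module_abelian_group[OF M] abelian_group.axioms(1)[OF module_abelian_group[OF M]]
  have mon: "abelian_monoid (modl M x)" if "x \<in> H" for x using ag(2)[OF that] .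
  have coact: "linear_map K (modl M (x \<cdot> y)) (AT x (modl M y)) (coact M x y)"
    if "x \<in> H" "y \<in> H" for x y using that by simp
  have pure: "linear_map K (modl M y) (AT x (modl M y)) (\<lambda>m. ten x (modl M y) (un x) m)"
    if "x \<in> H" "y \<in> H" for x y using that by simp
  have psi: "linear_map K (modl M x) (modl M (shift X e x)) (psi M x e)"
    if "x \<in> H" "e \<in> E" for x e using that by simp
  note cl = abelian_monoid.a_closed[OF mon] abelian_group.a_inv_closed[OF ag(1)]
      module.smult_closed[OF M]
    abelian_monoid.zero_closed[OF mon]
  have zero: "(\<lambda>x\<in>H. \<zero>\<^bsub>modl M x\<^esub>) \<in> carrier coinvariants"
    by (rule coinvI) (simp_all add: cl linear_map_zero[OF psi] linear_map_zero[OF coact]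
        linear_map_zero[OF pure])
  note val = coinv_value coinv_coact coinv_psi
  have add: "(\<lambda>x\<in>H. m x \<oplus>\<^bsub>modl M x\<^esub> n x) \<in> carrier coinvariants"
    if m: "m \<in> carrier coinvariants" and n: "n \<in> carrier coinvariants" for m n
    by (rule coinvI) (simp_all add: val[OF m] val[OF n] cl linear_map_add[OF psi]
        linear_map_add[OF coact] linear_map_add[OF pure])
  have smult: "(\<lambda>x\<in>H. c \<odot>\<^bsub>modl M x\<^esub> m x) \<in> carrier coinvariants"
    if "c \<in> carrier K" and m: "m \<in> carrier coinvariants" for m c
    using that(1) by (intro coinvI) (simp_all add: val[OF m] cl linear_map_smult[OF psi]
        linear_map_smult[OF coact] linear_map_smult[OF pure])
  have neg: "(\<lambda>x\<in>H. \<ominus>\<^bsub>modl M x\<^esub> m x) \<in> carrier coinvariants"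
    if m: "m \<in> carrier coinvariants" for m
    by (rule coinvI) (simp_all add: val[OF m] cl linear_map_minus[OF psi]
        linear_map_minus[OF coact] linear_map_minus[OF pure])
  show ?thesis
  proof (rule moduleI)
    show "abelian_group coinvariants"
    proof (rule abelian_groupI)
      fix m assume m: "m \<in> carrier coinvariants"
      then show "\<exists>n\<in>carrier coinvariants. n \<oplus>\<^bsub>coinvariants\<^esub> m = \<zero>\<^bsub>coinvariants\<^esub>"
        by (intro bexI[OF _ neg[OF m]]) (auto simp: coinv_ops abelian_group.l_neg[OF ag(1)]
              coinv_value intro!: restrict_ext)
    next
      fix m assume m: "m \<in> carrier coinvariants"
      have "\<zero>\<^bsub>coinvariants\<^esub> \<oplus>\<^bsub>coinvariants\<^esub> m = (\<lambda>x\<in>H. m x)"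
        using m by (auto simp: coinv_ops coinv_value abelian_monoid.l_zero[OF mon] intro!:
            restrict_ext)
      then show "\<zero>\<^bsub>coinvariants\<^esub> \<oplus>\<^bsub>coinvariants\<^esub> m = m" using m by (simp add: coinv_restrict)
    qed (auto simp: coinv_ops coinv_value zero add abelian_monoid.a_assoc[OF mon]
        abelian_monoid.a_comm[OF mon]
        intro!: restrict_ext)
  next
    fix m assume m: "m \<in> carrier coinvariants"
    have "\<one>\<^bsub>K\<^esub> \<odot>\<^bsub>coinvariants\<^esub> m = (\<lambda>x\<in>H. m x)"
      using m by (auto simp: coinv_ops coinv_value module.smult_one[OF M] intro!: restrict_ext)
    then show "\<one>\<^bsub>K\<^esub> \<odot>\<^bsub>coinvariants\<^esub> m = m" using m by (simp add: coinv_restrict)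
  qed (auto simp: coinv_ops coinv_value smult module.smult_l_distr[OF M] module.smult_r_distr[OF M]
      module.smult_assoc1[OF M] intro!: restrict_ext)
qed

lemma coinv_eval_linear: "x \<in> H \<Longrightarrow> linear_map K coinvariants (modl M x) (\<lambda>m. m x)"
  by (auto intro!: linear_mapI simp: coinv_ops coinv_value)

lemma linear_map_coinvI:
  assumes "\<And>t. t \<in> carrier L \<Longrightarrow> F t \<in> carrier coinvariants"
    and "\<And>x. x \<in> H \<Longrightarrow> linear_map K L (modl M x) (\<lambda>t. F t x)" and "module K L"
  shows "linear_map K L coinvariants F"
proof -
  interpret L: module K L by fact
  interpret C: module K coinvariants by simp
  show ?thesis
  proof (rule linear_mapI)
    fix s t assume s: "s \<in> carrier L" and t: "t \<in> carrier L"
    show "F s \<in> carrier coinvariants" using s by (rule assms(1))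
    show "F (s \<oplus>\<^bsub>L\<^esub> t) = F s \<oplus>\<^bsub>coinvariants\<^esub> F t"
      by (rule coinv_eqI, simp_all add: assms(1) s t) (simp add: coinv_ops linear_map_add[OF
          assms(2)] s t)
  next
    fix c t assume c: "c \<in> carrier K" and t: "t \<in> carrier L"
    show "F (c \<odot>\<^bsub>L\<^esub> t) = c \<odot>\<^bsub>coinvariants\<^esub> F t"
      by (rule coinv_eqI, simp_all add: assms(1) c t) (simp add: coinv_ops linear_map_smult[OF
          assms(2)] c t)
  qed
qed

definition proj_family where
  "proj_family m = (\<lambda>x\<in>H. proj x m)"

lemma proj_family_closed [simp]:
  "m \<in> carrier (modl M \<e>) \<Longrightarrow> proj_family m \<in> carrier coinvariants"
  unfolding proj_family_def by (rule coinvI) (simp_all add: coact_proj psi_proj)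

lemma proj_family_linear [simp]:
  "linear_map K (modl M \<e>) coinvariants proj_family"
  by (rule linear_map_coinvI) (simp, simp add: proj_family_def, simp)

text \<open>Coinvariance turns the coaction of b m_1 into \<Delta>(b) acting on 1 \<otimes> m_y.
  Applying the antipode and multiplying leaves S(b') b'' on m_y, which \<open>antipode_left\<close>
  evaluates.\<close>

lemma proj_hact:
  assumes y [simp]: "y \<in> H" and b: "b \<in> carrier (alg A \<e>)" and m: "m \<in> carrier coinvariants"
  shows "proj y (hact M \<e> (ten \<e> (modl M \<e>) b (m \<e>))) = counit A b \<odot>\<^bsub>modl M y\<^esub> m y"
proof -
  let ?y = "H_inv y"
  note [simp] = coinv_value[OF m] coinv_coact[OF m y[THEN H.inv_closed] y, simplified]
  let ?p = "ten \<e> (modl M \<e>) b (m \<e>)"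
  \<comment> \<open>The index \<open>\<e>\<close> is spelled \<open>?y \<cdot> y\<close>, the shape
    in which \<open>coact_hact'\<close> applies; the next step simplifies it away.\<close>
  have "coact M ?y y (hact M (?y \<cdot> y) (ten (?y \<cdot> y) (modl M (?y \<cdot> y)) b (m (?y \<cdot> y)))) =
    diag_act ?y y (pure K (AA ?y y) (AT ?y (modl M y))
      (comul A ?y y b) (ten ?y (modl M y) (un ?y) (m y)))"
    using b by (subst coact_hact') simp_all
  then have c: "coact M ?y y (hact M \<e> ?p) =
    diag_act ?y y (pure K (AA ?y y) (AT ?y (modl M y))
      (comul A ?y y b) (ten ?y (modl M y) (un ?y) (m y)))"
    by simp
  have s: "comul A ?y y b \<in> carrier (AA ?y y)" using b by simp
  have "hact M y (tensor_map K (alg A ?y) (modl M y) (alg A y) (modl M y) (antipode A y) id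
      (diag_act ?y y (pure K (AA ?y y) (AT ?y (modl M y))
        (comul A ?y y b) (ten ?y (modl M y) (un ?y) (m y))))) =
    hact M y (ten y (modl M y) (mult_map K (alg A y)
      (tensor_map K (alg A ?y) (alg A y) (alg A y) (alg A y) (antipode A y) id (comul A ?y y b)))
          (m y))"
    by (rule tensor_eqI[OF s, of "modl M y"]) (simp_all add: hact_mult)
  then show ?thesis using b by (simp add: proj_def c antipode_left hact_scalar)
qed

end

section \<open>Maps of Hopf modules\<close>

text \<open>Elements of \<^const>\<open>hmod_hom\<close> without the extensionality requirement; compatibility with
  the action is only demanded on pure tensors.\<close>

definition hmod_map where
  "hmod_map K X A M N f \<longleftrightarrow>
     (\<forall>x\<in>carrier (XH X). linear_map K (modl M x) (modl N x) (f x)) \<and>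
     (\<forall>x\<in>carrier (XH X). \<forall>a\<in>carrier (alg A x). \<forall>m\<in>carrier (modl M x).
        hact N x (pure K (alg A x) (modl N x) a (f x m)) =
        f x (hact M x (pure K (alg A x) (modl M x) a m))) \<and>
     (\<forall>x\<in>carrier (XH X). \<forall>y\<in>carrier (XH X). \<forall>m\<in>carrier (modl M (x \<otimes>\<^bsub>XH X\<^esub> y)).
        tensor_map K (alg A x) (modl M y) (alg A x) (modl N y) id (f y) (coact M x y m) =
        coact N x y (f (x \<otimes>\<^bsub>XH X\<^esub> y) m)) \<and>
     (\<forall>x\<in>carrier (XH X). \<forall>e\<in>carrier (XE X). \<forall>m\<in>carrier (modl M x).
        f (shift X e x) (psi M x e m) = psi N x e (f x m))"

text \<open>Turns an \<open>hmod_map\<close> into a member of \<open>hmod_hom\<close>, which has to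
  be extensional both as a family and in each component.\<close>

definition hmod_restrict where
  "hmod_restrict X M f = (\<lambda>x\<in>carrier (XH X). restrict (f x) (carrier (modl M x)))"

locale hmod_data_pair = hmod_data K X A M + N: hmod_data K X A N
  for K :: "'k ring" and X :: "('e, 'h) xmod" and A :: "('k, 'h, 'e, 'a) hcoalg"
    and M :: "('k, 'h, 'e, 'a, 'm) hmod" and N :: "('k, 'h, 'e, 'a, 'n) hmod"
begin

lemma hmod_map_cong:
  assumes f: "hmod_map K X A M N f"
    and eq: "\<And>x m. \<lbrakk>x \<in> H; m \<in> carrier (modl M x)\<rbrakk> \<Longrightarrow> f x m = g x m"
  shows "hmod_map K X A M N g"
proof -
  have lin: "linear_map K (modl M x) (modl N x) (f x)" if "x \<in> H" for x
    using f that by (simp add: hmod_map_def)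
  have lin': "linear_map K (modl M x) (modl N x) (g x)" if "x \<in> H" for x
    by (rule linear_map_cong[OF lin]) (simp_all add: that eq)
  have "id_map x (modl M y) (modl N y) (f y) (coact M x y m) =
      id_map x (modl M y) (modl N y) (g y) (coact M x y m)"
    if "x \<in> H" "y \<in> H" "m \<in> carrier (modl M (x \<cdot> y))" for x y m
    by (rule tensor_map_cong) (simp_all add: that lin eq)
  then show ?thesis using f by (simp add: hmod_map_def lin' eq[symmetric])
qed

lemma hmod_map_hact:
  assumes f: "hmod_map K X A M N f" and x: "x \<in> H" and t: "t \<in> carrier (AT x (modl M x))"
  shows "hact N x (id_map x (modl M x) (modl N x) (f x) t) = f x (hact M x t)"
proof -
  have lin: "linear_map K (modl M x) (modl N x) (f x)" using f x by (simp add: hmod_map_def)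
  show ?thesis
    by (rule tensor_eqI[OF t, of "modl N x"])
      (use f x in \<open>simp_all add: lin linear_map_comp[OF lin] hmod_map_def\<close>)
qed

lemma hmod_hom_iff:
  "\<theta> \<in> hmod_hom K X A M N \<longleftrightarrow>
     \<theta> \<in> (\<Pi>\<^sub>E x\<in>H. extensional (carrier (modl M x))) \<and> hmod_map K X A M N \<theta>" (is "?L \<longleftrightarrow> ?R")
proof
  assume L: ?L
  then have lin: "linear_map K (modl M x) (modl N x) (\<theta> x)" if "x \<in> H" for x
    using that by (auto simp: hmod_hom_def lin_hom_def PiE_iff)
  have "hact N x (ten x (modl N x) a (\<theta> x m)) =
      \<theta> x (hact M x (ten x (modl M x) a m))"
    if "x \<in> H" "a \<in> carrier (alg A x)" "m \<in> carrier (modl M x)" for x a m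
  proof -
    have "hact N x (id_map x (modl M x) (modl N x) (\<theta> x)
        (ten x (modl M x) a m)) = \<theta> x (hact M x (ten x (modl M x) a m))"
      using L that by (simp add: hmod_hom_def)
    then show ?thesis using that lin by simp
  qed
  then show ?R using L lin by (auto simp: hmod_map_def hmod_hom_def lin_hom_def PiE_iff)
next
  assume R: ?R
  then show ?L using hmod_map_hact[of \<theta>]
    by (simp add: hmod_hom_def lin_hom_def PiE_iff) (simp add: hmod_map_def)
qed

lemma hmod_hom_map: "\<theta> \<in> hmod_hom K X A M N \<Longrightarrow> hmod_map K X A M N \<theta>"
  by (simp add: hmod_hom_iff)

lemma hmod_restrict_hom:
  "hmod_map K X A M N f \<Longrightarrow> hmod_restrict X M f \<in> hmod_hom K X A M N"
  unfolding hmod_hom_iff by (auto simp: hmod_restrict_def elim: hmod_map_cong)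

lemma hmod_hom_eqI:
  assumes "\<theta> \<in> hmod_hom K X A M N" "\<eta> \<in> hmod_hom K X A M N"
    and "\<And>x m. \<lbrakk>x \<in> H; m \<in> carrier (modl M x)\<rbrakk> \<Longrightarrow> \<theta> x m = \<eta> x m"
  shows "\<theta> = \<eta>"
proof (rule PiE_ext)
  show "\<theta> \<in> (\<Pi>\<^sub>E x\<in>H. extensional (carrier (modl M x)))"
    "\<eta> \<in> (\<Pi>\<^sub>E x\<in>H. extensional (carrier (modl M x)))" using assms(1,2) by (simp_all add:
        hmod_hom_iff)
  fix x assume "x \<in> H"
  then show "\<theta> x = \<eta> x" using assms by (intro extensionalityI[of _ "carrier (modl M x)"])
    (auto simp: hmod_hom_iff)
qed

text \<open>Each law for the inverse is the law for \<open>f\<close> at a preimage, with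
  \<open>f\<close> cancelled afterwards.\<close>

lemma hmod_map_inv:
  assumes f: "hmod_map K X A M N f" and bij: "\<And>x. x \<in> H \<Longrightarrow>
      bij_betw (f x) (carrier (modl M x)) (carrier (modl N x))"
  shows "hmod_map K X A N M (\<lambda>x. inv_into (carrier (modl M x)) (f x))"
proof -
  let ?g = "\<lambda>x. inv_into (carrier (modl M x)) (f x)"
  have lin: "linear_map K (modl M x) (modl N x) (f x)" if "x \<in> H" for x
    using f that by (simp add: hmod_map_def)
  have lin': "linear_map K (modl N x) (modl M x) (?g x)" if "x \<in> H" for x
    by (rule linear_map_inv_into[OF lin bij]) (simp_all add: that)
  have gf: "?g x (f x m) = m" if "x \<in> H" "m \<in> carrier (modl M x)" for x m
    using bij[OF that(1)] that(2) by (simp add: bij_betw_def)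
  have fg: "f x (?g x n) = n" if "x \<in> H" "n \<in> carrier (modl N x)" for x n
    using bij[OF that(1)] that(2) by (simp add: bij_betw_inv_into_right)
  have cl: "?g x n \<in> carrier (modl M x)" if "x \<in> H" "n \<in> carrier (modl N x)" for x n
    using linear_map_closed[OF lin'] that by simp
  have clf: "f x m \<in> carrier (modl N x)" if "x \<in> H" "m \<in> carrier (modl M x)" for x m
    using linear_map_closed[OF lin] that by simp
  show ?thesis
    unfolding hmod_map_def
  proof (intro conjI ballI)
    fix x a n assume x [simp]: "x \<in> H" and [simp]: "a \<in> carrier (alg A x)" and n [simp]: "n \<in>
        carrier (modl N x)"
    have "hact N x (ten x (modl N x) a (f x (?g x n))) =
        f x (hact M x (ten x (modl M x) a (?g x n)))"
      using f cl[OF x n] by (simp add: hmod_map_def)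
    then have "hact N x (ten x (modl N x) a n) =
        f x (hact M x (ten x (modl M x) a (?g x n)))"
      by (simp add: fg)
    then show "hact M x (ten x (modl M x) a (?g x n)) = ?g x (hact N x (ten x (modl N x) a n))"
      by (simp add: gf cl)
  next
    fix x y n assume x [simp]: "x \<in> H" and y [simp]: "y \<in> H" and n [simp]: "n \<in>
        carrier (modl N (x \<cdot> y))"
    let ?m = "?g (x \<cdot> y) n"
    have m [simp]: "?m \<in> carrier (modl M (x \<cdot> y))" by (rule cl) simp_all
    have "coact N x y n = coact N x y (f (x \<cdot> y) ?m)" by (simp add: fg)
    also have "\<dots> = id_map x (modl M y) (modl N y) (f y) (coact M x y ?m)"
      using f by (simp add: hmod_map_def)
    finally show "id_map x (modl N y) (modl M y) (?g y) (coact N x y n) = coact M x y ?m"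
      by (simp add: tensor_map_comp lin lin' tensor_map_ident gf)
  next
    fix x e n assume x [simp]: "x \<in> H" and e [simp]: "e \<in> E" and n [simp]: "n \<in> carrier (modl N x)"
    have "psi N x e n = f (shift X e x) (psi M x e (?g x n))"
      using f cl[OF x n] fg[OF x n] by (simp add: hmod_map_def)
    then show "?g (shift X e x) (psi N x e n) = psi M x e (?g x n)"
      by (simp add: gf cl)
  qed (rule lin')
qed

end

context hopf_coalgebra
begin

lemma hmod_map_id: "hmod_data K X A M \<Longrightarrow> hmod_map K X A M M (\<lambda>x m. m)"
proof -
  assume "hmod_data K X A M"
  then interpret M: hmod_data K X A M .
  show ?thesis by (simp add: hmod_map_def tensor_map_ident)
qed

lemma hmod_map_comp:
  assumes "hmod_data K X A L" "hmod_data K X A M" "hmod_data K X A N"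
    and f: "hmod_map K X A L M f" and g: "hmod_map K X A M N g"
  shows "hmod_map K X A L N (\<lambda>x m. g x (f x m))"
proof -
  interpret L: hmod_data K X A L by fact
  interpret M: hmod_data K X A M by fact
  interpret N: hmod_data K X A N by fact
  have lin: "linear_map K (modl L x) (modl M x) (f x)" if "x \<in> H" for x
    using f that by (simp add: hmod_map_def)
  have lin': "linear_map K (modl M x) (modl N x) (g x)" if "x \<in> H" for x
    using g that by (simp add: hmod_map_def)
  have cl: "f x m \<in> carrier (modl M x)" if "x \<in> H" "m \<in> carrier (modl L x)" for x m
    using linear_map_closed[OF lin] that by simp
  have "id_map x (modl L y) (modl N y) (\<lambda>m. g y (f y m)) (coact L x y m) =
      coact N x y (g (x \<cdot> y) (f (x \<cdot> y) m))"
    if [simp]: "x \<in> H" "y \<in> H" "m \<in> carrier (modl L (x \<cdot> y))" for x y m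
  proof -
    have "id_map x (modl L y) (modl N y) (\<lambda>m. g y (f y m)) (coact L x y m) =
      id_map x (modl M y) (modl N y) (g y)
        (id_map x (modl L y) (modl M y) (f y) (coact L x y m))"
      by (subst tensor_map_comp) (simp_all add: lin lin' id_def)
    then show ?thesis using f g cl by (simp add: hmod_map_def)
  qed
  then show ?thesis using f g cl by (simp add: hmod_map_def linear_map_comp[OF lin' lin])
qed

end

text \<open>Every element of \<open>N\<close> is a value of \<open>f\<close>, so each axiom for
  \<open>N\<close> is the corresponding axiom for \<open>M\<close> pushed through \<open>f\<close>.
  This supplies the axioms for the copies inside the universe.\<close>

lemma (in hmod_data_pair) hopf_module_transport:
  assumes "hopf_module K X A M" and f: "hmod_map K X A M N f"
    and bij: "\<And>x. x \<in> H \<Longrightarrow> bij_betw (f x) (carrier (modl M x)) (carrier (modl N x))"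
  shows "hopf_module K X A N"
proof -
  interpret hopf_module K X A M by fact
  interpret M: hopf_module_over K X A M ..
  have lin: "linear_map K (modl M x) (modl N x) (f x)" if "x \<in> H" for x
    using f that by (simp add: hmod_map_def)
  have clf: "f x m \<in> carrier (modl N x)" if "x \<in> H" "m \<in> carrier (modl M x)" for x m
    using linear_map_closed[OF lin] that by simp
  have sur: "\<exists>m\<in>carrier (modl M x). n = f x m" if "x \<in> H" "n \<in> carrier (modl N x)" for x n
    using bij[OF that(1)] that(2) by (auto simp: bij_betw_def)
  have hact: "hact N x (ten x (modl N x) a (f x m)) = f x (hact M x (ten x (modl M x) a m))"
    if "x \<in> H" "a \<in> carrier (alg A x)" "m \<in> carrier (modl M x)" for x a m
    using f that by (simp add: hmod_map_def)
  have coact: "coact N x y (f (x \<cdot> y) m) =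
      id_map x (modl M y) (modl N y) (f y) (coact M x y m)"
    if "x \<in> H" "y \<in> H" "m \<in> carrier (modl M (x \<cdot> y))" for x y m
    using f that by (simp add: hmod_map_def)
  have psi: "psi N x e (f x m) = f (shift X e x) (psi M x e m)"
    if "x \<in> H" "e \<in> E" "m \<in> carrier (modl M x)" for x e m
    using f that by (simp add: hmod_map_def)
  show ?thesis
  proof (rule hopf_module.intro)
    fix x n assume [simp]: "x \<in> H" and "n \<in> carrier (modl N x)"
    then obtain m where [simp]: "m \<in> carrier (modl M x)" and n: "n = f x m" using sur by blast
    show "hact N x (ten x (modl N x) (un x) n) = n"
      by (simp add: n hact hact_one)
    show "psi N x \<one>\<^bsub>XE X\<^esub> n = n" by (simp add: n psi psi_one)
    show "tensor_unit_left K (modl N x)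
        (tensor_map K (alg A \<e>) (modl N x) (self_module K) (modl N x) (counit A) id
          (coact N \<e> x n)) = n"
    proof -
      have "tensor_unit_left K (modl N x)
          (tensor_map K (alg A \<e>) (modl N x) (self_module K) (modl N x) (counit A) id
            (id_map \<e> (modl M x) (modl N x) (f x) t)) =
        f x (tensor_unit_left K (modl M x)
          (tensor_map K (alg A \<e>) (modl M x) (self_module K) (modl M x) (counit A) id t))"
        if t: "t \<in> carrier (AT \<e> (modl M x))" for t
        by (rule tensor_eqI[OF t, of "modl N x"])
          (simp_all add: lin linear_map_comp[OF lin] clf linear_map_smult[OF lin])
      from this[of "coact M \<e> x m"] show ?thesis
        using coact[of "\<e>" x m] by (simp add: n coact_counit)
    qed
    fix a b assume "a \<in> carrier (alg A x)" "b \<in> carrier (alg A x)"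
    then show "hact N x (ten x (modl N x) (a \<otimes>\<^bsub>alg A x\<^esub> b) n) =
       hact N x (ten x (modl N x) a (hact N x (ten x (modl N x) b n)))"
      by (simp add: n hact hact_mult)
  next
    fix x e e' n assume [simp]: "x \<in> H" "e \<in> E" "e' \<in> E" and "n \<in> carrier (modl N x)"
    then obtain m where [simp]: "m \<in> carrier (modl M x)" and n: "n = f x m" using sur by blast
    show "psi N x (e' \<otimes>\<^bsub>XE X\<^esub> e) n = psi N (shift X e x) e' (psi N x e n)"
      by (simp add: n psi psi_mult)
  next
    fix x y z n assume [simp]: "x \<in> H" "y \<in> H" "z \<in> H"
      and "n \<in> carrier (modl N (x \<cdot> y \<cdot> z))"
    then obtain m where m: "m \<in> carrier (modl M (x \<cdot> y \<cdot> z))"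
      and n: "n = f (x \<cdot> y \<cdot> z) m" using sur[of "x \<cdot> y \<cdot> z"] by auto
    have m' [simp]: "m \<in> carrier (modl M (x \<cdot> (y \<cdot> z)))" using m by (simp add: H.m_assoc)
    have n': "n = f (x \<cdot> (y \<cdot> z)) m" using n by (simp add: H.m_assoc)
    let ?Az = "AT y (modl M z)" and ?Bz = "AT y (modl N z)"
    let ?f2 = "id_map y (modl M z) (modl N z) (f z)"
    \<comment> \<open>Naturality of reassociation in the module factor, with a general
      \<open>s\<close> in front so that \<open>nat2\<close> can take a coproduct for it.\<close>
    have nat1: "assoc x y (modl N z) (pure K (AA x y) (modl N z) s (f z k)) =
        id_map x ?Az ?Bz ?f2
          (assoc x y (modl M z) (pure K (AA x y) (modl M z) s k))"
      if s: "s \<in> carrier (AA x y)" and k: "k \<in> carrier (modl M z)" for s k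
      by (rule tensor_eqI[OF s, of "AT x ?Bz"]) (simp_all add: lin clf k)
    have nat2: "assoc x y (modl N z)
         (comul_id x y (modl N z) (id_map (x \<cdot> y) (modl M z) (modl N z) (f z) t)) =
        id_map x ?Az ?Bz ?f2
          (assoc x y (modl M z)
            (comul_id x y (modl M z) t))"
      if t: "t \<in> carrier (AT (x \<cdot> y) (modl M z))" for t
      by (rule tensor_eqI[OF t, of "AT x ?Bz"])
        (simp_all add: lin clf nat1[unfolded id_def] id_def)
    have "assoc x y (modl N z)
         (comul_id x y (modl N z) (coact N (x \<cdot> y) z n)) =
       id_map x ?Az ?Bz ?f2
         (id_map x (modl M (y \<cdot> z)) ?Az (coact M y z) (coact M x (y \<cdot> z) m))"
      using coact_coassoc[of x y z m] m by (simp add: n coact nat2)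
    also have "\<dots> = id_map x (modl M (y \<cdot> z)) ?Bz (\<lambda>m. coact N y z (f (y \<cdot> z) m))
        (coact M x (y \<cdot> z) m)"
      by (subst tensor_map_comp, simp_all add: lin)
        (rule tensor_map_cong, simp_all add: lin coact)
    also have "\<dots> = id_map x (modl N (y \<cdot> z)) ?Bz (coact N y z) (coact N x (y \<cdot> z) n)"
      by (simp add: n' coact tensor_map_comp lin id_def)
    finally show "assoc x y (modl N z)
         (comul_id x y (modl N z) (coact N (x \<cdot> y) z n)) =
       id_map x (modl N (y \<cdot> z)) ?Bz (coact N y z) (coact N x (y \<cdot> z) n)" .
  next
    fix x y t assume [simp]: "x \<in> H" "y \<in> H"
      and t: "t \<in> carrier (AT (x \<cdot> y) (modl N (x \<cdot> y)))"
    let ?xy = "x \<cdot> y"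
    let ?TM = "AT x (modl M y)" and ?TN = "AT x (modl N y)"
    let ?f2 = "id_map x (modl M y) (modl N y) (f y)"
    \<comment> \<open>The coaction on a value of \<open>f\<close> is \<open>?f2\<close> of the
      coaction over \<open>M\<close>, so the axiom follows once \<open>?f2\<close> is known to
      commute with the diagonal actions.\<close>
    have nat: "N.diag_act x y (pure K (AA x y) ?TN s (?f2 u)) =
        ?f2 (diag_act x y (pure K (AA x y) ?TM s u))"
      if s: "s \<in> carrier (AA x y)" and u: "u \<in> carrier ?TM" for s u
    proof (rule tensor_eqI[OF s, of ?TN], goal_cases)
      case (6 a b)
      show ?case
        by (rule tensor_eqI[OF u, of ?TN]) (simp_all add: 6 lin clf hact)
    qed (simp_all add: u lin)
    have "coact N x y (hact N ?xy t) = N.diag_act x y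
        (tensor_map K (alg A ?xy) (modl N ?xy) (AA x y) ?TN (comul A x y) (coact N x y) t)"
    proof (rule tensor_eqI[OF t, of ?TN], goal_cases)
      case (6 a n)
      then obtain m where [simp]: "m \<in> carrier (modl M ?xy)" and n: "n =
          f ?xy m" using sur[of ?xy] by auto
      have "diag_act x y (pure K (AA x y) ?TM (comul A x y a) (coact M x y m)) =
          coact M x y (hact M ?xy (ten ?xy (modl M ?xy) a m))"
        using 6 by (simp add: M.coact_hact')
      then show ?case using 6 by (simp add: n hact coact clf nat)
    qed simp_all
    then show "coact N x y (hact N ?xy t) =
       tensor_map K (AA x x) (AT y (modl N y))
         (alg A x) (modl N y) (mult_map K (alg A x)) (hact N y)
         (middle_flip K (alg A x) (alg A y) (alg A x) (modl N y)
           (tensor_map K (alg A ?xy) (modl N ?xy) (AA x y) ?TN (comul A x y) (coact N x y) t))"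
      by (simp add: N.diag_act_def)
  next
    fix x e t assume [simp]: "x \<in> H" "e \<in> E" and t: "t \<in> carrier (AT x (modl N x))"
    show "psi N x e (hact N x t) = hact N (shift X e x)
         (tensor_map K (alg A x) (modl N x) (alg A (shift X e x)) (modl N (shift X e x)) (phi A x
             e) (psi N x e) t)"
    proof (rule tensor_eqI[OF t, of "modl N (shift X e x)"], goal_cases)
      case (6 a n)
      then obtain m where [simp]: "m \<in> carrier (modl M x)" and n: "n =
          f x m" using sur[of x] by auto
      show ?case using 6 by (simp add: n hact psi clf psi_hact)
    qed simp_all
  next
    fix x y e e' n assume [simp]: "x \<in> H" "y \<in> H" "e \<in> E" "e' \<in> E"
      and "n \<in> carrier (modl N (x \<cdot> y))"
    then obtain m where m [simp]: "m \<in> carrier (modl M (x \<cdot> y))" and n: "n = f (x \<cdot> y) m"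
      using sur[of "x \<cdot> y"] by auto
    let ?x = "shift X e x" and ?y = "shift X e' y"
    have "tensor_map K (alg A x) (modl N y) (alg A ?x) (modl N ?y) (phi A x e) (psi N y e') (coact
        N x y n) =
       tensor_map K (alg A x) (modl M y) (alg A ?x) (modl N ?y) (phi A x e) (\<lambda>m. f ?y (psi M y e'
           m)) (coact M x y m)"
      by (simp add: n coact, subst tensor_map_comp, simp_all add: lin)
        (rule tensor_map_cong, simp_all add: lin clf psi)
    also have "\<dots> = id_map ?x (modl M ?y) (modl N ?y) (f ?y)
       (tensor_map K (alg A x) (modl M y) (alg A ?x) (modl M ?y) (phi A x e) (psi M y e') (coact M
           x y m))"
      by (subst tensor_map_comp) (simp_all add: lin)
    also have "tensor_map K (alg A x) (modl M y) (alg A ?x) (modl M ?y) (phi A x e) (psi M y e')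
        (coact M x y m) =
       coact M ?x ?y (psi M (x \<cdot> y) (twist X e x e') m)"
      by (rule psi_coact) simp_all
    also have "id_map ?x (modl M ?y) (modl N ?y) (f ?y) \<dots> =
        coact N ?x ?y (psi N (x \<cdot> y) (twist X e x e') n)"
      using psi_closed[of "x \<cdot> y" "twist X e x e'" m] by (simp add: n psi coact)
    finally show "tensor_map K (alg A x) (modl N y) (alg A ?x) (modl N ?y) (phi A x e) (psi N y
        e') (coact N x y n) =
       coact N ?x ?y (psi N (x \<cdot> y) (twist X e x e') n)" .
  qed (simp_all add: N.modl_module N.act_linear N.coact_lin N.psi_lin)
qed

section \<open>Trivial Hopf modules\<close>

context hopf_coalgebra
begin

abbreviation is_hopf where "is_hopf M \<equiv> hopf_module K X A M"
abbreviation homs where "homs M N \<equiv> hmod_hom K X A M N"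
abbreviation is_map where "is_map M N f \<equiv> hmod_map K X A M N f"

lemma triv_simps [simp]:
  "modl (Triv V) x = AT x V"
  "hact (Triv V) x t = tensor_map K (AA x x) V (alg A x) V
     (mult_map K (alg A x)) id (tensor_assoc_inv K (alg A x) (alg A x) V t)"
  "coact (Triv V) x y s = assoc x y V
     (comul_id x y V s)"
  "psi (Triv V) x e = tensor_map K (alg A x) V (alg A (shift X e x)) V (phi A x e) id"
  by (simp_all add: triv_def)

text \<open>Exposes the argument of \<open>f\<close> to simplification rules that need it.\<close>

lemma linear_map_eta:
  "linear_map K M N (\<lambda>t. f t) \<Longrightarrow> linear_map K M N f"
  by simp

lemma hmod_data_triv:
  assumes [simp]: "module K V" shows "hmod_data K X A (Triv V)"
proof (intro hmod_data.intro hmod_data_axioms.intro hopf_coalgebra_axioms)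
  fix x y assume [simp]: "x \<in> H" "y \<in> H"
  show "linear_map K (AT x (modl (Triv V) x)) (modl (Triv V) x) (hact (Triv V) x)"
    by (rule linear_map_eta) simp
  show "linear_map K (modl (Triv V) (x \<cdot> y)) (AT x (modl (Triv V) y)) (coact (Triv V) x y)"
    by (rule linear_map_eta) simp
qed simp_all

text \<open>This is \<open>coassoc\<close> for \<open>A\<close> with a vector \<open>v\<close>
  carried along as an additional last factor.\<close>

lemma triv_coassoc:
  assumes [simp]: "module K V" "x \<in> H" "y \<in> H" "z \<in> H"
    and t: "t \<in> carrier (AT (x \<cdot> (y \<cdot> z)) V)"
  shows "assoc x y (AT z V)
      (comul_id x y (AT z V)
        (assoc (x \<cdot> y) z V
          (tensor_map K (alg A (x \<cdot> (y \<cdot> z))) V (AA (x \<cdot> y) z) V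
            (comul A (x \<cdot> y) z) id t))) =
    id_map x (AT (y \<cdot> z) V) (AT y (AT z V)) (\<lambda>u. assoc y z V
        (comul_id y z V u))
      (assoc x (y \<cdot> z) V
        (comul_id x (y \<cdot> z) V t))"
proof (rule tensor_eqI[OF t, of "AT x (AT y (AT z V))"], goal_cases)
  case (6 a v)
  note [simp] = 6 H.m_assoc
  let ?W = "AT z V"
  let ?T = "AT x (AT y ?W)"
  \<comment> \<open>\<open>?L\<close> attaches \<open>v\<close> to the last factor of a threefold
    tensor and reassociates. Both sides turn out to be \<open>?L\<close> of an iterated coproduct of
    \<open>a\<close>, one for each bracketing.\<close>
  let ?L = "id_map x (AA y z) (AT y ?W) (\<lambda>u. assoc y z V (pure K (AA y z) V u v))"
  have s: "comul A (x \<cdot> y) z a \<in> carrier (AA (x \<cdot> y) z)"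
    and s': "comul A x (y \<cdot> z) a \<in> carrier (AA x (y \<cdot> z))" by simp_all
  have "assoc x y ?W (comul_id x y ?W
        (assoc (x \<cdot> y) z V (pure K (AA (x \<cdot> y) z) V
          (comul A (x \<cdot> y) z a) v))) =
    ?L (assoc x y (alg A z)
      (comul_id x y (alg A z) (comul A (x \<cdot> y) z a)))"
  proof (rule tensor_eqI[OF s, of ?T], goal_cases)
    case (6 p q)
    have u: "comul A x y p \<in> carrier (AA x y)" using 6 by simp
    have "assoc x y ?W
        (pure K (AA x y) ?W (comul A x y p) (ten z V q v)) =
      ?L (assoc x y (alg A z)
        (pure K (AA x y) (alg A z) (comul A x y p) q))"
      by (rule tensor_eqI[OF u, of ?T]) (simp_all add: 6)
    then show ?case using 6 by (simp add: id_def)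
  qed simp_all
  also have "\<dots> = ?L (id_map x (alg A (y \<cdot> z)) (AA y z) (comul A y z) (comul A x (y \<cdot> z) a))"
    using coassoc[of x y z a] by simp
  also have "\<dots> = id_map x (AT (y \<cdot> z) V) (AT y ?W) (\<lambda>u. assoc y z V
        (comul_id y z V u))
      (assoc x (y \<cdot> z) V
        (pure K (AA x (y \<cdot> z)) V (comul A x (y \<cdot> z) a) v))"
    by (rule tensor_eqI[OF s', of ?T]) simp_all
  finally show ?case by (simp add: id_def)
qed (simp_all add: H.m_assoc)

text \<open>Reduces to \<open>counit_left\<close> for \<open>A\<close>;
  \<open>pure_smult_left\<close> moves the scalar produced by the counit from the tensor into its
  algebra factor.\<close>

lemma triv_counit:
  assumes [simp]: "module K V" "x \<in> H" and t: "t \<in> carrier (AT x V)"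
  shows "tensor_unit_left K (AT x V)
      (tensor_map K (alg A \<e>) (AT x V) (self_module K) (AT x V)
        (counit A) id (assoc \<e> x V
          (tensor_map K (alg A x) V (AA \<e> x) V (comul A \<e> x) id t))) = t"
proof (rule tensor_eqI[OF t, of "AT x V"], goal_cases)
  case (6 a v)
  have s: "comul A \<e> x a \<in> carrier (AA \<e> x)" using 6 by simp
  have "tensor_unit_left K (AT x V)
      (tensor_map K (alg A \<e>) (AT x V) (self_module K) (AT x V)
        (counit A) id (assoc \<e> x V
          (pure K (AA \<e> x) V (comul A \<e> x a) v))) =
    ten x V (tensor_unit_left K (alg A x)
         (tensor_map K (alg A \<e>) (alg A x) (self_module K) (alg A x)
           (counit A) id (comul A \<e> x a))) v"
    by (rule tensor_eqI[OF s, of "AT x V"]) (simp_all add: 6 pure_smult_left)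
  then show ?case using 6 by (simp add: counit_left[unfolded id_def] id_def)
qed simp_all

abbreviation triv_diag where "triv_diag V \<equiv> hmod_data.diag_act K A (Triv V)"

text \<open>The rules for \<open>diag_act\<close> with \<open>modl (Triv V) y\<close> already
  replaced by \<open>AT y V\<close>, the form in which the simplifier meets them.\<close>

lemma triv_diag_linear [simp]:
  "\<lbrakk>module K V; x \<in> H; y \<in> H;
    linear_map K L (tensor K (AA x y) (AT x (AT y V))) F\<rbrakk> \<Longrightarrow>
     linear_map K L (AT x (AT y V)) (\<lambda>t. triv_diag V x y (F t))"
  using hmod_data.diag_act_linear[OF hmod_data_triv] by simp

lemma triv_diag_pure [simp]:
  "\<lbrakk>module K V; x \<in> H; y \<in> H; a \<in> carrier (alg A x); b \<in> carrier (alg A y); c \<in> carrier (alg A x);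
    d \<in> carrier (alg A y); v \<in> carrier V\<rbrakk> \<Longrightarrow>
   triv_diag V x y (pure K (AA x y) (AT x (AT y V))
     (ten x (alg A y) a b) (ten x (AT y V) c (ten y V d v))) =
   ten x (AT y V) (a \<otimes>\<^bsub>alg A x\<^esub> c) (ten y V (b \<otimes>\<^bsub>alg A y\<^esub> d) v)"
  using hmod_data.diag_act_pure[OF hmod_data_triv, of V x y a b c "ten y V d v"] by simp

text \<open>Under reassociation the product of A_x \<otimes> A_y becomes the diagonal action.
  Together with \<open>comul_mult\<close> this yields the compatibility of action and coaction for
  trivial modules.\<close>

lemma triv_diag_assoc:
  assumes [simp]: "module K V" "x \<in> H" "y \<in> H"
    and s: "s \<in> carrier (AA x y)"
    and s': "s' \<in> carrier (AA x y)"
    and v [simp]: "v \<in> carrier V"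
  shows "assoc x y V (pure K (AA x y) V
      (tensor_map K (AA x x) (AA y y) (alg A x) (alg A y)
        (mult_map K (alg A x)) (mult_map K (alg A y))
        (middle_flip K (alg A x) (alg A y) (alg A x) (alg A y)
          (pure K (AA x y) (AA x y) s s'))) v) =
    triv_diag V x y (pure K (AA x y) (AT x (AT y V)) s
      (assoc x y V (pure K (AA x y) V s' v)))"
proof (rule tensor_eqI[OF s, of "AT x (AT y V)"], goal_cases)
  case (6 p q)
  show ?case
    by (rule tensor_eqI[OF s', of "AT x (AT y V)"]) (simp_all add: 6)
qed (simp_all add: s')

lemma triv_coact_hact:
  assumes [simp]: "module K V" "x \<in> H" "y \<in> H"
    and t: "t \<in> carrier (AT (x \<cdot> y) (AT (x \<cdot> y) V))"
  shows "coact (Triv V) x y (hact (Triv V) (x \<cdot> y) t) = triv_diag V x y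
      (tensor_map K (alg A (x \<cdot> y)) (modl (Triv V) (x \<cdot> y)) (AA x y)
        (AT x (modl (Triv V) y)) (comul A x y) (coact (Triv V) x y) t)"
proof -
  let ?N = "AT x (AT y V)"
  let ?c = "\<lambda>s. assoc x y V
     (comul_id x y V s)"
  \<comment> \<open>The coaction occurs unapplied, as an argument of \<open>tensor_map\<close>,
    where the applied form in \<open>triv_simps\<close> does not match.\<close>
  have c: "coact (Triv V) x y = ?c" by (rule ext) simp
  show ?thesis
    unfolding c triv_simps
  proof (rule tensor_eqI[OF t, of ?N], goal_cases)
    case (6 a w)
    show ?case
      by (rule tensor_eqI[OF 6(2), of ?N]) (simp_all add: 6 triv_diag_assoc comul_mult)
  qed simp_all
qed

lemma hopf_module_triv:
  assumes [simp]: "module K V" shows "is_hopf (Triv V)"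
proof (rule hopf_module.intro)
  interpret T: hmod_data K X A "Triv V" by (rule hmod_data_triv) simp
  fix x assume [simp]: "x \<in> H"
  show "module K (modl (Triv V) x)" by simp
  show "linear_map K (AT x (modl (Triv V) x)) (modl (Triv V) x) (hact (Triv V) x)"
    by (rule T.act_linear) simp
  fix m assume m: "m \<in> carrier (modl (Triv V) x)"
  then have m': "m \<in> carrier (AT x V)" by simp
  show "hact (Triv V) x (ten x (modl (Triv V) x) (un x) m) = m"
    by (rule tensor_eqI[OF m', of "AT x V"]) simp_all
  show "psi (Triv V) x \<one>\<^bsub>XE X\<^esub> m = m"
    using m' by (simp add: tensor_map_ident phi_one)
  show "tensor_unit_left K (modl (Triv V) x)
         (tensor_map K (alg A \<e>) (modl (Triv V) x) (self_module K) (modl (Triv V) x)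
           (counit A) id (coact (Triv V) \<e> x m)) = m"
    using triv_counit[OF _ _ m'] by simp
  fix a b assume [simp]: "a \<in> carrier (alg A x)" "b \<in> carrier (alg A x)"
  show "hact (Triv V) x (ten x (modl (Triv V) x) (a \<otimes>\<^bsub>alg A x\<^esub> b) m) =
       hact (Triv V) x (ten x (modl (Triv V) x) a
         (hact (Triv V) x (ten x (modl (Triv V) x) b m)))"
    by (rule tensor_eqI[OF m', of "AT x V"]) simp_all
next
  interpret T: hmod_data K X A "Triv V" by (rule hmod_data_triv) simp
  fix x y assume [simp]: "x \<in> H" "y \<in> H"
  show "linear_map K (modl (Triv V) (x \<cdot> y)) (AT x (modl (Triv V) y)) (coact (Triv V) x y)"
    by (rule T.coact_lin) simp_all
  show "coact (Triv V) x y (hact (Triv V) (x \<cdot> y) t) =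
       tensor_map K (AA x x) (AT y (modl (Triv V) y))
         (alg A x) (modl (Triv V) y) (mult_map K (alg A x)) (hact (Triv V) y)
         (middle_flip K (alg A x) (alg A y) (alg A x) (modl (Triv V) y)
           (tensor_map K (alg A (x \<cdot> y)) (modl (Triv V) (x \<cdot> y))
             (AA x y) (AT x (modl (Triv V) y))
             (comul A x y) (coact (Triv V) x y) t))"
    if "t \<in> carrier (AT (x \<cdot> y) (modl (Triv V) (x \<cdot> y)))" for t
    using triv_coact_hact[of V x y t] that unfolding T.diag_act_def by simp
  fix e f m assume [simp]: "e \<in> E" "f \<in> E" and m: "m \<in> carrier (modl (Triv V) (x \<cdot> y))"
  let ?x = "shift X e x" and ?y = "shift X f y"
  let ?xy = "x \<cdot> y" and ?ef = "twist X e x f"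
  have m': "m \<in> carrier (AT ?xy V)" using m by simp
  \<comment> \<open>\<open>phi_linear\<close> speaks of the index \<open>shift X ?ef ?xy\<close>;
    \<open>shift_twist\<close> rewrites it to \<open>?x \<cdot> ?y\<close>, as the comultiplication
    on the right-hand side demands.\<close>
  have phi: "linear_map K (alg A ?xy) (alg A (?x \<cdot> ?y)) (\<lambda>a. phi A ?xy ?ef a)"
    using phi_linear[of ?xy ?ef "alg A ?xy" "\<lambda>a. a"] by simp
  have phi_cl: "phi A ?xy ?ef a \<in> carrier (alg A (?x \<cdot> ?y))" if "a \<in> carrier (alg A ?xy)" for a
    using linear_map_closed[OF phi that] .
  have "tensor_map K (alg A x) (AT y V) (alg A ?x) (AT ?y V)
      (phi A x e) (tensor_map K (alg A y) V (alg A ?y) V (phi A y f) id)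
      (assoc x y V
        (tensor_map K (alg A ?xy) V (AA x y) V (comul A x y) id m)) =
     assoc ?x ?y V (comul_id ?x ?y V
       (tensor_map K (alg A ?xy) V (alg A (?x \<cdot> ?y)) V (phi A ?xy ?ef) id m))"
  proof (rule tensor_eqI[OF m', of "AT ?x (AT ?y V)"], goal_cases)
    case (6 a v)
    have s: "comul A x y a \<in> carrier (AA x y)" using 6 by simp
    have "tensor_map K (alg A x) (AT y V) (alg A ?x) (AT ?y V)
        (phi A x e) (tensor_map K (alg A y) V (alg A ?y) V (phi A y f) id)
        (assoc x y V (pure K (AA x y) V (comul A x y a) v)) =
      assoc ?x ?y V (pure K (AA ?x ?y) V
        (tensor_map K (alg A x) (alg A y) (alg A ?x) (alg A ?y) (phi A x e) (phi A y f) (comul A x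
            y a)) v)"
      by (rule tensor_eqI[OF s, of "AT ?x (AT ?y V)"]) (simp_all add: 6)
    then show ?case using 6 phi phi_cl by (simp add: phi_comul id_def)
  qed (use phi in \<open>simp_all add: linear_map_comp[OF phi]\<close>)
  then show "tensor_map K (alg A x) (modl (Triv V) y) (alg A ?x) (modl (Triv V) ?y)
         (phi A x e) (psi (Triv V) y f) (coact (Triv V) x y m) =
       coact (Triv V) ?x ?y (psi (Triv V) ?xy ?ef m)"
    by simp
next
  fix x y z m assume [simp]: "x \<in> H" "y \<in> H" "z \<in> H" and m: "m \<in>
      carrier (modl (Triv V) (x \<cdot> y \<cdot> z))"
  then have "m \<in> carrier (AT (x \<cdot> (y \<cdot> z)) V)" by (simp add: H.m_assoc)
  from triv_coassoc[OF _ _ _ _ this]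
  show "assoc x y (modl (Triv V) z)
         (comul_id x y (modl (Triv V) z) (coact (Triv V) (x \<cdot> y) z m)) =
       id_map x (modl (Triv V) (y \<cdot> z)) (AT y (modl (Triv V) z)) (coact (Triv V) y z) (coact (Triv
           V) x (y \<cdot> z) m)"
    by (simp add: triv_def H.m_assoc)
next
  interpret T: hmod_data K X A "Triv V" by (rule hmod_data_triv) simp
  fix x e assume [simp]: "x \<in> H" "e \<in> E"
  show "linear_map K (modl (Triv V) x) (modl (Triv V) (shift X e x)) (psi (Triv V) x e)"
    by (rule T.psi_lin) simp_all
  show "psi (Triv V) x (f \<otimes>\<^bsub>XE X\<^esub> e) m = psi (Triv V) (shift X e x) f (psi (Triv V) x e m)"
    if "f \<in> E" "m \<in> carrier (modl (Triv V) x)" for f m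
  proof -
    have m: "m \<in> carrier (AT x V)" using that by simp
    have "linear_map K (alg A x) (alg A (shift X f (shift X e x))) (phi A x (f \<otimes>\<^bsub>XE X\<^esub> e))"
      using phi_linear[of x "f \<otimes>\<^bsub>XE X\<^esub> e" "alg A x" "\<lambda>a. a"] that by simp
    then have "tensor_map K (alg A x) V (alg A (shift X f (shift X e x))) V (phi A x (f \<otimes>\<^bsub>XE X\<^esub>
        e)) id m =
      tensor_map K (alg A x) V (alg A (shift X f (shift X e x))) V (\<lambda>a. phi A (shift X e x) f (phi
          A x e a)) (\<lambda>v. v) m"
      using that by (intro tensor_map_cong) (simp_all add: phi_mult)
    then show ?thesis using that m by (simp add: tensor_map_comp id_def)
  qed
  fix t assume t: "t \<in> carrier (AT x (modl (Triv V) x))"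
  then have t': "t \<in> carrier (AT x (AT x V))" by simp
  show "psi (Triv V) x e (hact (Triv V) x t) =
       hact (Triv V) (shift X e x)
         (tensor_map K (alg A x) (modl (Triv V) x) (alg A (shift X e x)) (modl (Triv V) (shift X e
             x))
           (phi A x e) (psi (Triv V) x e) t)"
  proof (rule tensor_eqI[OF t', of "AT (shift X e x) V"], goal_cases)
    case (6 a w)
    show ?case
      by (rule tensor_eqI[OF 6(2), of "AT (shift X e x) V"]) (simp_all add: 6)
  qed simp_all
qed

end

lemma (in hopf_coalgebra) hmod_map_triv:
  assumes [simp]: "module K V" "module K W" and f: "linear_map K V W f"
  shows "is_map (Triv V) (triv K X A W) (\<lambda>x. id_map x V W f)"
proof -
  note [simp] = f linear_map_comp[OF f] linear_map_closed[OF f]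
  have hact: "hact (triv K X A W) x (ten x (modl (triv K X A W) x) a
      (id_map x V W f t)) =
    id_map x V W f (hact (Triv V) x (ten x (modl (Triv V) x) a t))"
    if [simp]: "x \<in> H" "a \<in> carrier (alg A x)" and t: "t \<in> carrier (AT x V)" for x a t
    by (rule tensor_eqI[OF t, of "AT x W"]) simp_all
  have assoc: "id_map x (AT y V) (AT y W) (id_map y V W f)
      (assoc x y V (pure K (AA x y) V s v)) =
    assoc x y W (pure K (AA x y) W s (f v))"
    if [simp]: "x \<in> H" "y \<in> H" "v \<in> carrier V" and s: "s \<in> carrier (AA x y)" for x y s v
    by (rule tensor_eqI[OF s, of "AT x (AT y W)"]) simp_all
  have coact: "id_map x (AT y V) (AT y W) (id_map y V W f) (coact (Triv V) x y t) =
    coact (triv K X A W) x y (id_map (x \<cdot> y) V W f t)"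
    if [simp]: "x \<in> H" "y \<in> H" and t: "t \<in> carrier (AT (x \<cdot> y) V)" for x y t
    unfolding triv_simps
    by (rule tensor_eqI[OF t, of "AT x (AT y W)"])
      (simp_all add: assoc[unfolded id_def] id_def)
  have psi: "id_map (shift X e x) V W f (psi (Triv V) x e t) =
      psi (triv K X A W) x e (id_map x V W f t)"
    if [simp]: "x \<in> H" "e \<in> E" and t: "t \<in> carrier (AT x V)" for x e t
    by (rule tensor_eqI[OF t, of "AT (shift X e x) W"]) simp_all
  have lin: "linear_map K (AT x V) (AT x W) (id_map x V W f)"
    if "x \<in> H" for x by (rule linear_map_eta) (simp add: that)
  show ?thesis
    unfolding hmod_map_def triv_simps(1)
    by (intro conjI ballI lin coact psi hact[unfolded triv_simps(1)])
qed

lemma (in hopf_coalgebra) tensor_map_id_bij: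
  assumes [simp]: "x \<in> H" "module K V" "module K W" and f: "linear_map K V W f"
    and bij: "bij_betw f (carrier V) (carrier W)"
  shows "bij_betw (id_map x V W f) (carrier (AT x V))
    (carrier (AT x W))"
proof -
  let ?g = "inv_into (carrier V) f"
  have g: "linear_map K W V ?g" by (rule linear_map_inv_into[OF f bij]) simp
  show ?thesis
  proof (rule bij_betw_byWitness[where f' = "id_map x W V ?g"])
    show "\<forall>t\<in>carrier (AT x V).
        id_map x W V ?g (id_map x V W f t) = t"
      using bij by (simp add: tensor_map_comp f g tensor_map_ident bij_betw_def)
    show "\<forall>t\<in>carrier (AT x W).
        id_map x V W f (id_map x W V ?g t) = t"
      using bij by (simp add: tensor_map_comp f g tensor_map_ident bij_betw_inv_into_right)
  qed (auto simp: f g)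
qed

section \<open>Hopf modules are trivial\<close>

context hopf_module_over
begin

text \<open>The natural map of the overview at the index \<open>x\<close>; it later provides the
  counit of the equivalence.\<close>

definition kappa where
  "kappa x = tensor_lift K (alg A x) coinvariants (modl M x)
     (\<lambda>a m. hact M x (ten x (modl M x) a (m x)))"

lemma kappa_bilinear: "x \<in> H \<Longrightarrow> bilinear_map K (alg A x) coinvariants (modl M x)
     (\<lambda>a m. hact M x (ten x (modl M x) a (m x)))"
  by (rule bilinear_mapI) (simp_all add: coinv_value coinv_eval_linear)

lemma kappa_linear [simp]:
  "\<lbrakk>x \<in> H; linear_map K L (AT x coinvariants) F\<rbrakk> \<Longrightarrow>
     linear_map K L (modl M x) (\<lambda>t. kappa x (F t))"
  by (simp add: kappa_def kappa_bilinear)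

lemma kappa_closed [simp]:
  "\<lbrakk>x \<in> H; t \<in> carrier (AT x coinvariants)\<rbrakk> \<Longrightarrow> kappa x t \<in> carrier (modl M x)"
  by (simp add: kappa_def kappa_bilinear)

lemma kappa_pure [simp]:
  "\<lbrakk>x \<in> H; a \<in> carrier (alg A x); m \<in> carrier coinvariants\<rbrakk> \<Longrightarrow>
     kappa x (ten x coinvariants a m) = hact M x (ten x (modl M x) a (m x))"
  by (simp add: kappa_def kappa_bilinear)

text \<open>The coaction on a coinvariant is 1 \<otimes> m, so only the coproduct of
  \<open>a\<close> contributes. Both the compatibility of \<open>kappa\<close> with coactions and
  the identity \<open>kappa_inv_kappa\<close> rest on this.\<close>

lemma coact_hact_coinv:
  assumes [simp]: "x \<in> H" "y \<in> H" "a \<in> carrier (alg A (x \<cdot> y))" and m: "m \<in> carrier coinvariants"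
  shows "coact M x y (hact M (x \<cdot> y) (ten (x \<cdot> y) (modl M (x \<cdot> y)) a (m (x \<cdot> y)))) =
    id_map x (alg A y) (modl M y) (\<lambda>b. hact M y (ten y (modl M y) b (m y))) (comul A x y a)"
  using coinv_value[OF m, of "x \<cdot> y"] coinv_value[OF m, of y] coinv_coact[OF m, of x y]
  by (subst coact_hact') (simp_all add: diag_act_unit)

lemma kappa_hmod_map: "is_map (triv K X A coinvariants) M kappa"
proof -
  let ?C = coinvariants
  have lin: "linear_map K (AT x ?C) (modl M x) (kappa x)" if "x \<in> H" for x
    by (rule linear_map_eta) (simp add: that)
  have hact: "hact M x (ten x (modl M x) a (kappa x t)) =
      kappa x (hact (triv K X A ?C) x (ten x (AT x ?C) a t))"
    if [simp]: "x \<in> H" "a \<in> carrier (alg A x)" and t: "t \<in> carrier (AT x ?C)" for x a t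
    by (rule tensor_eqI[OF t, of "modl M x"]) (simp_all add: hact_mult coinv_value)
  have coact: "id_map x (AT y ?C) (modl M y) (kappa y)
      (coact (triv K X A ?C) x y t) = coact M x y (kappa (x \<cdot> y) t)"
    if [simp]: "x \<in> H" "y \<in> H" and t: "t \<in> carrier (AT (x \<cdot> y) ?C)" for x y t
    unfolding triv_simps
  proof (rule tensor_eqI[OF t, of "AT x (modl M y)"], goal_cases)
    case (6 a m)
    have s: "comul A x y a \<in> carrier (AA x y)" using 6 by simp
    have "id_map x (AT y ?C) (modl M y) (kappa y)
        (assoc x y ?C (pure K (AA x y) ?C (comul A x y a) m)) =
      id_map x (alg A y) (modl M y) (\<lambda>b. hact M y (ten y (modl M y) b (m y))) (comul A x y a)"
      by (rule tensor_eqI[OF s, of "AT x (modl M y)"])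
        (simp_all add: lin 6 coinv_value)
    then show ?case using 6 by (simp add: coact_hact_coinv id_def)
  qed (simp_all add: lin)
  have psi: "kappa (shift X e x) (psi (triv K X A ?C) x e t) = psi M x e (kappa x t)"
    if [simp]: "x \<in> H" "e \<in> E" and t: "t \<in> carrier (AT x ?C)" for x e t
    unfolding triv_simps
  proof (rule tensor_eqI[OF t, of "modl M (shift X e x)"], goal_cases)
    case (6 a m)
    have "linear_map K (modl M x) (modl M (shift X e x)) (psi M x e)" by (rule psi_linear) simp_all
    then show ?case using 6 by (simp add: psi_hact coinv_value coinv_psi)
  qed simp_all
  show ?thesis
    unfolding hmod_map_def triv_simps(1)
    by (intro conjI ballI lin coact psi hact[unfolded triv_simps(1)])
qed

definition kappa_inv where
  "kappa_inv x m = id_map x (modl M \<e>) coinvariants proj_family (coact M x \<e> m)"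

lemma kappa_inv_closed [simp]:
  "\<lbrakk>x \<in> H; m \<in> carrier (modl M x)\<rbrakk> \<Longrightarrow> kappa_inv x m \<in> carrier (AT x coinvariants)"
  by (simp add: kappa_inv_def)

text \<open>Evaluating \<open>proj_family\<close> at \<open>x\<close> gives \<open>proj x\<close>,
  so the claim comes down to \<open>reconstruct\<close>.\<close>

lemma kappa_kappa_inv:
  assumes [simp]: "x \<in> H" "m \<in> carrier (modl M x)" shows "kappa x (kappa_inv x m) = m"
proof -
  have "kappa x (id_map x (modl M \<e>) coinvariants proj_family t) =
      hact M x (id_map x (modl M \<e>) (modl M x) (proj x) t)"
    if t: "t \<in> carrier (AT x (modl M \<e>))" for t
    by (rule tensor_eqI[OF t, of "modl M x"]) (simp_all, simp add: proj_family_def)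
  then show ?thesis by (simp add: kappa_inv_def reconstruct)
qed

text \<open>The coaction sends a m_x to the sum of a' \<otimes> a'' m_1; \<open>proj_hact\<close>
  turns the projection of a'' m_1 into \<epsilon>(a'') m, and \<open>counit_right\<close> collects
  a' \<epsilon>(a'') to a.\<close>

lemma kappa_inv_kappa:
  assumes x [simp]: "x \<in> H" and t: "t \<in> carrier (AT x coinvariants)"
  shows "kappa_inv x (kappa x t) = t"
  unfolding kappa_inv_def
proof (rule tensor_eqI[OF t, of "AT x coinvariants"], goal_cases)
  case (6 a m)
  let ?p = "\<lambda>b. hact M \<e> (ten \<e> (modl M \<e>) b (m \<e>))"
  have m: "m \<e> \<in> carrier (modl M \<e>)" using 6 by (simp add: coinv_value)
  have s: "comul A x \<e> a \<in> carrier (AA x \<e>)" using 6 by simp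
  have pf: "proj_family (?p b) = counit A b \<odot>\<^bsub>coinvariants\<^esub> m" if "b \<in> carrier (alg A \<e>)" for b
    using that 6 by (simp add: proj_family_def proj_hact coinv_ops cong: restrict_cong)
  have "id_map x (modl M \<e>) coinvariants proj_family
      (id_map x (alg A \<e>) (modl M \<e>) ?p (comul A x \<e> a)) =
    ten x coinvariants (tensor_unit_right K (alg A x)
      (id_map x (alg A \<e>) (self_module K) (counit A) (comul A x \<e> a))) m"
    by (rule tensor_eqI[OF s, of "AT x coinvariants"])
      (use 6 in \<open>simp_all add: m pf pure_smult_left pure_smult_right linear_map_comp[OF
          proj_family_linear]\<close>)
  then show ?case using 6 coact_hact_coinv[of x \<e> a m]
    by (simp add: counit_right[unfolded id_def] id_def)
qed (simp_all add: linear_map_comp[OF proj_family_linear])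

lemma kappa_bij: "x \<in> H \<Longrightarrow> bij_betw (kappa x) (carrier (AT x coinvariants)) (carrier (modl M x))"
  by (rule bij_betw_byWitness[where f' = "kappa_inv x"]) (auto simp: kappa_kappa_inv
      kappa_inv_kappa)

end

section \<open>Coinvariants as a functor\<close>

lemma (in hopf_coalgebra) coinv_eta:
  assumes [simp]: "module K V"
  shows "linear_map K V (coinv K X A (Triv V)) (\<lambda>v. \<lambda>x\<in>H. ten x V (un x) v)" (is "linear_map K V
      ?C ?\<eta>")
    and "bij_betw (\<lambda>v. \<lambda>x\<in>H. ten x V (un x) v) (carrier V) (carrier (coinv K X A (Triv V)))"
proof -
  interpret hopf_module K X A "Triv V" by (rule hopf_module_triv) simp
  interpret T: hopf_module_over K X A "Triv V" ..
  interpret V: module K V by simp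
  let ?\<epsilon> = "\<lambda>m. tensor_unit_left K V (tensor_map K (alg A \<e>) V (self_module K) V (counit A) id (m
      \<e>))"
  have cl: "?\<eta> v \<in> carrier ?C" if v: "v \<in> carrier V" for v
    by (rule T.coinvI) (simp_all add: v)
  show "linear_map K V ?C ?\<eta>"
    by (rule T.linear_map_coinvI) (simp_all add: cl)
  have inv: "?\<eta> (?\<epsilon> m) = m" if m: "m \<in> carrier ?C" for m
  proof (rule T.coinv_eqI[OF _ m])
    have m\<e>: "m \<e> \<in> carrier (AT \<e> V)" using T.coinv_value[OF m H.one_closed] by simp
    show "?\<eta> (?\<epsilon> m) \<in> carrier ?C" using m\<e> by (intro cl) simp
    fix x assume [simp]: "x \<in> H"
    have mx: "m x \<in> carrier (AT x V)" using T.coinv_value[OF m, of x] by simp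
    let ?e = "\<lambda>t. tensor_unit_left K V (tensor_map K (alg A \<e>) V (self_module K) V (counit A) id t)"
    \<comment> \<open>By \<open>counit_right\<close>, applying \<open>?e\<close> to the second
      factor undoes the coaction at \<open>(x, \<e>)\<close>. Applied to the coinvariance of
      \<open>m\<close>, this recovers \<open>m x\<close> from \<open>m \<e>\<close>.\<close>
    have e: "id_map x (AT \<e> V) V ?e
      (assoc x \<e> V
        (tensor_map K (alg A x) V (AA x \<e>) V (comul A x \<e>) id t)) = t"
      if t: "t \<in> carrier (AT x V)" for t
    proof (rule tensor_eqI[OF t, of "AT x V"], goal_cases)
      case (6 a v)
      have s: "comul A x \<e> a \<in> carrier (AA x \<e>)" using 6 by simp
      have "id_map x (AT \<e> V) V ?e
          (assoc x \<e> V (pure K (AA x \<e>) V (comul A x \<e> a) v)) =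
        ten x V (tensor_unit_right K (alg A x)
          (id_map x (alg A \<e>) (self_module K) (counit A) (comul A x \<e> a))) v"
        by (rule tensor_eqI[OF s, of "AT x V"])
          (simp_all add: 6 pure_smult_left pure_smult_right)
      then show ?case using 6 by (simp add: counit_right[unfolded id_def] id_def)
    qed simp_all
    have "assoc x \<e> V
        (tensor_map K (alg A x) V (AA x \<e>) V (comul A x \<e>) id (m x)) =
      ten x (AT \<e> V) (un x) (m \<e>)"
      using T.coinv_coact[OF m, of x \<e>] by simp
    then have "m x = id_map x (AT \<e> V) V ?e
        (ten x (AT \<e> V) (un x) (m \<e>))"
      using e[OF mx] by simp
    then show "?\<eta> (?\<epsilon> m) x = m x" using m\<e> by simp
  qed
  show "bij_betw ?\<eta> (carrier V) (carrier ?C)"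
  proof (rule bij_betw_byWitness[where f' = ?\<epsilon>])
    show "?\<epsilon> ` carrier ?C \<subseteq> carrier V"
      using T.coinv_value[OF _ H.one_closed] by auto
  qed (use cl inv in auto)
qed

text \<open>Stated for modules with possibly different element types, so that it and its two
  successors also apply to the coding map from \<open>Triv V\<close> to its copy.\<close>

lemma (in hopf_coalgebra) coinv_fun_closed:
  assumes M: "is_hopf M" and N: "is_hopf N" and f: "is_map M N f"
    and m: "m \<in> carrier (coinv K X A M)"
  shows "(\<lambda>x\<in>H. f x (m x)) \<in> carrier (coinv K X A N)"
proof -
  interpret M: hopf_module K X A M by fact
  interpret N: hopf_module K X A N by fact
  interpret M: hopf_module_over K X A M ..
  interpret N: hopf_module_over K X A N ..
  have lin: "linear_map K (modl M x) (modl N x) (f x)" if "x \<in> H" for x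
    using f that by (simp add: hmod_map_def)
  show ?thesis
  proof (rule N.coinvI)
    fix x assume [simp]: "x \<in> H"
    show "f x (m x) \<in> carrier (modl N x)" using linear_map_closed[OF lin] M.coinv_value[OF m] by
        simp
    fix e assume "e \<in> E"
    then have "f (shift X e x) (psi M x e (m x)) = psi N x e (f x (m x))"
      using f M.coinv_value[OF m] by (simp add: hmod_map_def)
    then show "psi N x e (f x (m x)) = f (shift X e x) (m (shift X e x))"
      using M.coinv_psi[OF m] \<open>e \<in> E\<close> by simp
  next
    fix x y assume [simp]: "x \<in> H" "y \<in> H"
    have "coact N x y (f (x \<cdot> y) (m (x \<cdot> y))) =
        id_map x (modl M y) (modl N y) (f y) (coact M x y (m (x \<cdot> y)))"
      using f M.coinv_value[OF m] by (simp add: hmod_map_def)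
    then show "coact N x y (f (x \<cdot> y) (m (x \<cdot> y))) = ten x (modl N y) (un x) (f y (m y))"
      by (simp add: M.coinv_coact[OF m] M.coinv_value[OF m] lin)
  qed
qed

lemma (in hopf_coalgebra) coinv_fun_linear:
  assumes M: "is_hopf M" and N: "is_hopf N" and f: "is_map M N f"
  shows "linear_map K (coinv K X A M) (coinv K X A N) (\<lambda>m. \<lambda>x\<in>H. f x (m x))"
proof -
  interpret M: hopf_module K X A M by fact
  interpret N: hopf_module K X A N by fact
  interpret M: hopf_module_over K X A M ..
  interpret N: hopf_module_over K X A N ..
  have lin: "linear_map K (modl M x) (modl N x) (f x)" if "x \<in> H" for x
    using f that by (simp add: hmod_map_def)
  show ?thesis
    by (rule N.linear_map_coinvI)
      (simp_all add: coinv_fun_closed[OF M N f] linear_map_comp[OF lin M.coinv_eval_linear])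
qed

lemma (in hopf_coalgebra) coinv_fun_bij:
  assumes M: "is_hopf M" and N: "is_hopf N" and f: "is_map M N f"
    and bij: "\<And>x. x \<in> H \<Longrightarrow> bij_betw (f x) (carrier (modl M x)) (carrier (modl N x))"
  shows "bij_betw (\<lambda>m. \<lambda>x\<in>H. f x (m x)) (carrier (coinv K X A M)) (carrier (coinv K X A N))"
proof -
  interpret M: hopf_module K X A M by fact
  interpret N: hopf_module K X A N by fact
  interpret M: hopf_module_over K X A M ..
  interpret N: hopf_module_over K X A N ..
  interpret hmod_data_pair K X A M N ..
  let ?g = "\<lambda>x. inv_into (carrier (modl M x)) (f x)"
  have g: "is_map N M ?g" by (rule hmod_map_inv[OF f bij])
  note cf = coinv_fun_closed[OF M N f] and cg = coinv_fun_closed[OF N M g]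
  show ?thesis
  proof (rule bij_betw_byWitness[where f' = "\<lambda>n. \<lambda>x\<in>H. ?g x (n x)"])
    show "\<forall>m\<in>carrier (coinv K X A M). (\<lambda>x\<in>H. ?g x ((\<lambda>x\<in>H. f x (m x)) x)) = m"
    proof
      fix m assume m: "m \<in> carrier (coinv K X A M)"
      show "(\<lambda>x\<in>H. ?g x ((\<lambda>x\<in>H. f x (m x)) x)) = m"
        by (rule M.coinv_eqI[OF cg[OF cf[OF m]] m])
          (use bij M.coinv_value[OF m] in \<open>simp add: bij_betw_def\<close>)
    qed
    show "\<forall>n\<in>carrier (coinv K X A N). (\<lambda>x\<in>H. f x ((\<lambda>x\<in>H. ?g x (n x)) x)) = n"
    proof
      fix n assume n: "n \<in> carrier (coinv K X A N)"
      show "(\<lambda>x\<in>H. f x ((\<lambda>x\<in>H. ?g x (n x)) x)) = n"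
        by (rule N.coinv_eqI[OF cf[OF cg[OF n]] n])
          (simp add: bij_betw_inv_into_right[OF bij] N.coinv_value[OF n])
    qed
  qed (use cf cg in auto)
qed

section \<open>Copies in a universe\<close>

text \<open>A tensor is encoded by a chosen representative; this is a function of finite support,
  hence recoverable from a list enumerating its graph, and \<open>cl\<close> sends that list into
  the universe.\<close>

lemma (in tensor_pair) tensor_embeds:
  fixes cl :: "(('a \<times> 'b) \<times> 'k) list \<Rightarrow> 'u"
  assumes "inj cl"
  shows "\<exists>j :: ('k, 'a, 'b) tens \<Rightarrow> 'u. inj_on j (carrier T)"
proof -
  define r where "r t = (SOME f. f \<in> carrier F \<and> t = coset f)" for t
  define graph where "graph f = {(p, f p) |p. f p \<noteq> \<zero>\<^bsub>K\<^esub>}" for f :: "'a \<times> 'b \<Rightarrow> 'k"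
  define l where "l f = (SOME xs. set xs = graph f)" for f
  have r: "r t \<in> carrier F \<and> t = coset (r t)" if "t \<in> carrier T" for t
    unfolding r_def using that by (intro someI_ex[of "\<lambda>f. f \<in> carrier F \<and> t =
        coset f"]) (auto simp: tensor_carrier)
  have l: "set (l f) = graph f" if "f \<in> carrier F" for f
  proof -
    have "graph f = (\<lambda>p. (p, f p)) ` {p. f p \<noteq> \<zero>\<^bsub>K\<^esub>}" by (auto simp: graph_def)
    then have "finite (graph f)" using that by (simp add: free_module_carrier)
    then show ?thesis unfolding l_def by (intro someI_ex[of "\<lambda>xs. set xs = graph f"] finite_list)
  qed
  have graph_eq: "f = g" if "graph f = graph g" for f g
  proof
    fix p
    have mem: "(p, q) \<in> graph h \<longleftrightarrow> h p = q \<and> q \<noteq> \<zero>\<^bsub>K\<^esub>" for h q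
      by (cases p) (auto simp: graph_def)
    show "f p = g p" using mem[of "f p" f] mem[of "f p" g] mem[of "g p" f] mem[of "g p" g] that by
        metis
  qed
  have "inj_on (\<lambda>t. cl (l (r t))) (carrier T)"
  proof (rule inj_onI)
    fix s t assume st: "s \<in> carrier T" "t \<in> carrier T" and "cl (l (r s)) = cl (l (r t))"
    then have "l (r s) = l (r t)" using assms by (simp add: inj_eq)
    then have "graph (r s) = graph (r t)" using l[of "r s"] l[of "r t"] r st by simp
    then have "r s = r t" by (rule graph_eq)
    then show "s = t" using r[OF st(1)] r[OF st(2)] by simp
  qed
  then show ?thesis by blast
qed

section \<open>Copies of modules and Hopf modules\<close>

lemma code_inj_on: "\<exists>j :: 'x \<Rightarrow> 'u. inj_on j S \<Longrightarrow> inj_on (code S :: 'x \<Rightarrow> 'u) S"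
  unfolding code_def by (rule someI_ex[of "\<lambda>j. inj_on j S"])

lemma copy_module_simps [simp]:
  "carrier (copy_module M) = code (carrier M) ` carrier M"
  "\<zero>\<^bsub>copy_module M\<^esub> = code (carrier M) \<zero>\<^bsub>M\<^esub>"
  "u \<oplus>\<^bsub>copy_module M\<^esub> v = code (carrier M) (decode (carrier M) u \<oplus>\<^bsub>M\<^esub> decode (carrier M) v)"
  "c \<odot>\<^bsub>copy_module M\<^esub> u = code (carrier M) (c \<odot>\<^bsub>M\<^esub> decode (carrier M) u)"
  by (simp_all add: copy_module_def Let_def)

lemma copy_map_extensional: "copy_map M N f \<in> extensional (carrier (copy_module M))"
  by (simp add: copy_map_def)

context
  fixes K :: "'k ring" and M :: "('k, 'x) module" and c :: "'x \<Rightarrow> 'u"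
  defines "c \<equiv> code (carrier M)"
  assumes M: "module K M" and inj: "inj_on c (carrier M)"
begin

interpretation M: module K M by (rule M)

lemma decode_code: "m \<in> carrier M \<Longrightarrow> decode (carrier M) (c m) = m"
  using inj unfolding c_def decode_def by simp

lemma module_copy_module: "module K (copy_module M :: ('k, 'u) module)"
proof (rule moduleI[OF M.R.is_cring])
  show "abelian_group (copy_module M :: ('k, 'u) module)"
  proof (rule abelian_groupI)
    fix u assume "u \<in> carrier (copy_module M :: ('k, 'u) module)"
    then obtain m where "m \<in> carrier M" "u = c m" by (auto simp: c_def)
    then show "\<exists>v\<in>carrier (copy_module M). v \<oplus>\<^bsub>copy_module M\<^esub> u = \<zero>\<^bsub>copy_module M\<^esub>"
      by (intro bexI[of _ "c (\<ominus>\<^bsub>M\<^esub> m)"]) (simp_all add: decode_code[unfolded c_def] c_def M.l_neg)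
  qed (auto simp: decode_code[unfolded c_def] M.a_ac)
qed (auto simp: decode_code[unfolded c_def] M.smult_l_distr M.smult_r_distr M.smult_assoc1)

lemma code_linear: "linear_map K M (copy_module M) c"
  by (rule linear_mapI) (simp_all add: c_def decode_code[unfolded c_def])

lemma code_bij: "bij_betw c (carrier M) (carrier (copy_module M))"
  using inj by (simp add: bij_betw_def c_def)

lemma decode_linear: "linear_map K (copy_module M :: ('k, 'u) module) M (decode (carrier M))"
  using linear_map_inv_into[OF code_linear code_bij M] by (simp add: decode_def c_def)

lemma decode_bij: "bij_betw (decode (carrier M)) (carrier (copy_module M :: ('k,
    'u) module)) (carrier M)"
  using bij_betw_inv_into[OF code_bij] by (simp add: decode_def c_def)

end

lemma copy_map_lin_hom:
  fixes M :: "('k, 'x) module" and N :: "('k, 'y) module"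
  assumes M: "module K M" and N: "module K N"
    and cM: "inj_on (code (carrier M) :: 'x \<Rightarrow> 'u) (carrier M)"
    and cN: "inj_on (code (carrier N) :: 'y \<Rightarrow> 'u) (carrier N)"
    and f: "linear_map K M N f"
  shows "copy_map M N f \<in> lin_hom K (copy_module M :: ('k, 'u) module) (copy_module N :: ('k,
      'u) module)"
proof -
  have "linear_map K (copy_module M :: ('k, 'u) module) (copy_module N :: ('k, 'u) module)
      (\<lambda>u. code (carrier N) (f (decode (carrier M) u)))"
    by (rule linear_map_comp[OF code_linear[OF N cN] linear_map_comp[OF f decode_linear[OF M cM]]])
  then have "linear_map K (copy_module M :: ('k, 'u) module) (copy_module N :: ('k,
      'u) module) (copy_map M N f)"
    by (rule linear_map_cong[OF _ module_copy_module[OF M cM]]) (simp add: copy_map_def)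
  then show ?thesis by (simp add: lin_hom_def copy_map_extensional[simplified])
qed

text \<open>The structure maps of the copy decode, apply the original map and encode again, so
  \<open>code\<close> intertwines the two structures. The axioms then follow from
  \<open>hopf_module_transport\<close>.\<close>

lemma (in hopf_coalgebra) copy_hmod_transport:
  fixes M :: "('k, 'h, 'e, 'a, 'x) hmod"
  defines "N \<equiv> copy_hmod K X A M :: ('k, 'h, 'e, 'a, 'u) hmod"
  assumes M: "is_hopf M"
    and inj: "\<And>x. x \<in> H \<Longrightarrow> inj_on (code (carrier (modl M x)) :: 'x \<Rightarrow> 'u) (carrier (modl M x))"
  shows copy_hmod_hopf_module: "is_hopf N"
    and code_hmod_map: "is_map M N (\<lambda>x. code (carrier (modl M x)))"
proof -
  interpret M: hopf_module K X A M by fact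
  interpret M: hopf_module_over K X A M ..
  let ?c = "\<lambda>x. code (carrier (modl M x)) :: 'x \<Rightarrow> 'u"
  let ?d = "\<lambda>x. decode (carrier (modl M x)) :: 'u \<Rightarrow> 'x"
  let ?N = "\<lambda>x. copy_module (modl M x) :: ('k, 'u) module"
  have N: "modl N x = ?N x"
    "hact N x = (\<lambda>t. ?c x (hact M x (id_map x (?N x) (modl M x) (?d x) t)))"
    "coact N x y = (\<lambda>u. id_map x (modl M y) (?N y) (?c y) (coact M x y (?d (x \<cdot> y) u)))"
    "psi N x e = (\<lambda>u. ?c (shift X e x) (psi M x e (?d x u)))" for x y e
    by (simp_all add: N_def copy_hmod_def Let_def)
  have mod [simp]: "module K (?N x)" if "x \<in> H" for x
    by (rule module_copy_module[OF M.module_modl[OF that] inj[OF that]])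
  have c: "linear_map K (modl M x) (?N x) (?c x)" if "x \<in> H" for x
    by (rule code_linear[OF M.module_modl[OF that] inj[OF that]])
  have d: "linear_map K (?N x) (modl M x) (?d x)" if "x \<in> H" for x
    by (rule decode_linear[OF M.module_modl[OF that] inj[OF that]])
  have dc [simp]: "?d x (?c x m) = m" if "x \<in> H" "m \<in> carrier (modl M x)" for x m
    by (rule decode_code[OF M.module_modl[OF that(1)] inj[OF that(1)] that(2)])
  interpret N: hmod_data K X A N
  proof (intro hmod_data.intro hmod_data_axioms.intro hopf_coalgebra_axioms)
    fix x assume [simp]: "x \<in> H"
    show "module K (modl N x)" by (simp add: N)
    show "linear_map K (AT x (modl N x)) (modl N x) (hact N x)"
      unfolding N by (rule linear_map_comp[OF c]) (simp_all add: d)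
    fix y assume [simp]: "y \<in> H"
    show "linear_map K (modl N (x \<cdot> y)) (AT x (modl N y)) (coact N x y)"
      unfolding N by (simp add: c d)
  next
    fix x e assume [simp]: "x \<in> H" "e \<in> E"
    show "linear_map K (modl N x) (modl N (shift X e x)) (psi N x e)"
      unfolding N by (rule linear_map_comp[OF c]) (simp_all add: d)
  qed
  interpret hmod_data_pair K X A M N ..
  show map: "is_map M N ?c"
    unfolding hmod_map_def
  proof (intro conjI ballI)
    fix x a m assume "x \<in> H" "a \<in> carrier (alg A x)" "m \<in> carrier (modl M x)"
    then show "hact N x (ten x (modl N x) a (?c x m)) = ?c x (hact M x (ten x (modl M x) a m))"
      by (simp add: N d)
  qed (simp_all add: N c)
  show "is_hopf N"
    by (rule hopf_module_transport[OF M map]) (simp_all add: N inj bij_betw_def)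
qed

section \<open>Categories\<close>

lemma is_functor_id: "is_category C \<Longrightarrow> is_functor C C id_ftr"
  by (simp add: is_functor_def is_functor_axioms_def id_ftr_def)

lemma is_functor_comp:
  assumes "is_functor C D F" "is_functor D B G"
  shows "is_functor C B (comp_ftr G F)"
proof -
  interpret F: is_functor C D F by fact
  interpret G: is_functor D B G by fact
  show ?thesis
    by unfold_locales (simp_all add: comp_ftr_def F.fobj_in G.fobj_in F.farr_in G.farr_in F.farr_id
      G.farr_id F.farr_comp G.farr_comp)
qed

text \<open>\<open>quasi_inverse\<close> fixes the directions of its two natural isomorphisms;
  exchanging the roles of the functors reverses both.\<close>

lemma nat_isomorphic_sym:
  assumes "nat_isomorphic C D F G"
  shows "nat_isomorphic C D G F"
proof -
  interpret F: is_functor C D F using assms unfolding nat_isomorphic_def by blast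
  interpret G: is_functor C D G using assms unfolding nat_isomorphic_def by blast
  obtain \<tau> where iso: "\<And>a. a \<in> Ob C \<Longrightarrow> iso_arrow D (fobj F a) (fobj G a) (\<tau> a)"
    and nat: "\<And>a b f. \<lbrakk>a \<in> Ob C; b \<in> Ob C; f \<in> Hom C a b\<rbrakk> \<Longrightarrow>
      Comp D (fobj F a) (fobj F b) (fobj G b) (\<tau> b) (farr F a b f) =
      Comp D (fobj F a) (fobj G a) (fobj G b) (farr G a b f) (\<tau> a)"
    using assms unfolding nat_isomorphic_def by blast
  define \<sigma> where "\<sigma> a = (SOME g. g \<in> Hom D (fobj G a) (fobj F a) \<and>
     Comp D (fobj F a) (fobj G a) (fobj F a) g (\<tau> a) = Id D (fobj F a) \<and>
     Comp D (fobj G a) (fobj F a) (fobj G a) (\<tau> a) g = Id D (fobj G a))" for a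
  have \<sigma>: "\<sigma> a \<in> Hom D (fobj G a) (fobj F a) \<and>
     Comp D (fobj F a) (fobj G a) (fobj F a) (\<sigma> a) (\<tau> a) = Id D (fobj F a) \<and>
     Comp D (fobj G a) (fobj F a) (fobj G a) (\<tau> a) (\<sigma> a) = Id D (fobj G a)" if "a \<in> Ob C" for a
  proof -
    have "\<exists>g. g \<in> Hom D (fobj G a) (fobj F a) \<and>
        Comp D (fobj F a) (fobj G a) (fobj F a) g (\<tau> a) = Id D (fobj F a) \<and>
        Comp D (fobj G a) (fobj F a) (fobj G a) (\<tau> a) g = Id D (fobj G a)"
      using iso[OF that] by (auto simp: iso_arrow_def)
    from someI_ex[OF this] show ?thesis unfolding \<sigma>_def .
  qed
  have \<tau>: "\<tau> a \<in> Hom D (fobj F a) (fobj G a)" if "a \<in> Ob C" for a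
    using iso[OF that] by (simp add: iso_arrow_def)
  have "Comp D (fobj G a) (fobj G b) (fobj F b) (\<sigma> b) (farr G a b f) =
      Comp D (fobj G a) (fobj F a) (fobj F b) (farr F a b f) (\<sigma> a)"
    if a: "a \<in> Ob C" and b: "b \<in> Ob C" and f: "f \<in> Hom C a b" for a b f
  proof -
    note cl = a b F.fobj_in G.fobj_in F.farr_in[OF a b f] G.farr_in[OF a b f] \<sigma>[OF a] \<sigma>[OF b] \<tau>[OF
        a] \<tau>[OF b]
    let ?Fa = "fobj F a" and ?Fb = "fobj F b" and ?Ga = "fobj G a" and ?Gb = "fobj G b"
    \<comment> \<open>Insert \<open>\<tau> a\<close> after \<open>\<sigma> a\<close>, which is an
      identity, move \<open>\<tau>\<close> across by naturality and cancel it against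
      \<open>\<sigma> b\<close>.\<close>
    have "Comp D ?Ga ?Gb ?Fb (\<sigma> b) (farr G a b f) =
        Comp D ?Ga ?Gb ?Fb (\<sigma> b) (Comp D ?Ga ?Ga ?Gb (farr G a b f) (Comp D ?Ga ?Fa ?Ga (\<tau> a) (\<sigma>
            a)))"
      using cl by (simp add: F.target.comp_id_right)
    also have "\<dots> = Comp D ?Ga ?Gb ?Fb (\<sigma> b) (Comp D ?Ga ?Fa ?Gb (Comp D ?Fa ?Ga ?Gb (farr G a b f)
        (\<tau> a)) (\<sigma> a))"
      using cl by (simp add: F.target.comp_assoc)
    also have "\<dots> = Comp D ?Ga ?Gb ?Fb (\<sigma> b) (Comp D ?Ga ?Fa ?Gb (Comp D ?Fa ?Fb ?Gb (\<tau> b) (farr F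
        a b f)) (\<sigma> a))"
      by (simp add: nat[OF a b f])
    also have "\<dots> = Comp D ?Ga ?Fa ?Fb (Comp D ?Fa ?Gb ?Fb (\<sigma> b) (Comp D ?Fa ?Fb ?Gb (\<tau> b) (farr F
        a b f))) (\<sigma> a)"
      using cl by (intro F.target.comp_assoc[symmetric]) (auto intro: F.target.comp_in)
    also have "Comp D ?Fa ?Gb ?Fb (\<sigma> b) (Comp D ?Fa ?Fb ?Gb (\<tau> b) (farr F a b f)) =
        Comp D ?Fa ?Fb ?Fb (Comp D ?Fb ?Gb ?Fb (\<sigma> b) (\<tau> b)) (farr F a b f)"
      using cl by (intro F.target.comp_assoc[symmetric]) auto
    also have "\<dots> = farr F a b f" using cl by (simp add: F.target.comp_id_left)
    finally show ?thesis .
  qed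
  moreover have "iso_arrow D (fobj G a) (fobj F a) (\<sigma> a)" if "a \<in> Ob C" for a
    using \<sigma>[OF that] \<tau>[OF that] by (auto simp: iso_arrow_def)
  ultimately show ?thesis
    unfolding nat_isomorphic_def using F.is_functor_axioms G.is_functor_axioms by blast
qed

section \<open>The category of modules\<close>

lemma lin_hom_compose:
  assumes "module K U" and f: "f \<in> lin_hom K U V" and g: "g \<in> lin_hom K V W"
  shows "compose (carrier U) g f \<in> lin_hom K U W"
proof -
  have "linear_map K U W (\<lambda>x. g (f x))"
    using f g by (auto simp: lin_hom_def intro: linear_map_comp)
  then have "linear_map K U W (compose (carrier U) g f)"
    by (rule linear_map_cong) (simp_all add: assms(1) compose_eq)
  then show ?thesis by (simp add: lin_hom_def compose_def)
qed

lemma lin_hom_ident: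
  assumes "module K V" shows "(\<lambda>v\<in>carrier V. v) \<in> lin_hom K V V"
  using linear_map_cong[OF linear_map_ident assms, of "\<lambda>v\<in>carrier V. v"] by (simp add: lin_hom_def)

lemma lin_hom_closed: "f \<in> lin_hom K V W \<Longrightarrow> v \<in> carrier V \<Longrightarrow> f v \<in> carrier W"
  by (auto simp: lin_hom_def linear_map_closed)

lemma lin_hom_eqI:
  assumes "f \<in> lin_hom K V W" "g \<in> lin_hom K V W" "\<And>v. v \<in> carrier V \<Longrightarrow> f v = g v"
  shows "f = g"
  using assms by (intro extensionalityI[of f "carrier V" g]) (auto simp: lin_hom_def)

lemma is_category_Mod_cat:
  fixes K :: "'k ring"
  shows "is_category (Mod_cat K :: (('k, 'u) module, 'u \<Rightarrow> 'u) cat)"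
proof (rule is_category.intro)
  fix U V W Z :: "('k, 'u) module" and f g h
  assume "f \<in> Hom (Mod_cat K) U V"
  then show "Comp (Mod_cat K) U V Z (Comp (Mod_cat K) V W Z h g) f =
      Comp (Mod_cat K) U W Z h (Comp (Mod_cat K) U V W g f)"
    by (auto simp: Mod_cat_def compose_def lin_hom_closed intro!: restrict_ext)
next
  fix U V W :: "('k, 'u) module" and f g
  assume "U \<in> Ob (Mod_cat K)" "f \<in> Hom (Mod_cat K) U V" "g \<in> Hom (Mod_cat K) V W"
  then show "Comp (Mod_cat K) U V W g f \<in> Hom (Mod_cat K) U W"
    by (simp add: Mod_cat_def lin_hom_compose)
next
  fix U V :: "('k, 'u) module" and f
  assume "U \<in> Ob (Mod_cat K)" "V \<in> Ob (Mod_cat K)" "f \<in> Hom (Mod_cat K) U V"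
  then have U: "module K U" and V: "module K V" and f: "f \<in> lin_hom K U V"
    by (simp_all add: Mod_cat_def)
  show "Comp (Mod_cat K) U V V (Id (Mod_cat K) V) f = f"
    unfolding Mod_cat_def cat.simps
    by (rule lin_hom_eqI[OF lin_hom_compose[OF U f lin_hom_ident[OF V]] f])
      (simp add: compose_eq lin_hom_closed[OF f])
  show "Comp (Mod_cat K) U U V f (Id (Mod_cat K) U) = f"
    unfolding Mod_cat_def cat.simps
    by (rule lin_hom_eqI[OF lin_hom_compose[OF U lin_hom_ident[OF U] f] f]) (simp add: compose_eq)
qed (simp add: Mod_cat_def lin_hom_ident)

lemma iso_arrow_Mod_cat:
  assumes V: "module K V" and W: "module K W" and f: "f \<in> lin_hom K V W"
    and bij: "bij_betw f (carrier V) (carrier W)"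
  shows "iso_arrow (Mod_cat K) V W f"
proof -
  let ?g = "restrict (inv_into (carrier V) f) (carrier W)"
  have "linear_map K W V (inv_into (carrier V) f)"
    using f bij V by (intro linear_map_inv_into) (simp_all add: lin_hom_def)
  then have "linear_map K W V ?g" by (rule linear_map_cong) (simp_all add: W)
  then have "?g \<in> lin_hom K W V" by (simp add: lin_hom_def)
  moreover have "compose (carrier V) ?g f = (\<lambda>v\<in>carrier V. v)"
    using bij lin_hom_closed[OF f] by (auto simp: compose_def bij_betw_def intro!: restrict_ext)
  moreover have "compose (carrier W) f ?g = (\<lambda>w\<in>carrier W. w)"
    using bij by (auto simp: compose_def bij_betw_inv_into_right intro!: restrict_ext)
  ultimately show ?thesis using f by (auto simp: iso_arrow_def Mod_cat_def intro!: bexI[of _ ?g])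
qed

section \<open>The category of Hopf modules\<close>

context hopf_coalgebra
begin

abbreviation hmod_comp where
  "hmod_comp L \<eta> \<theta> \<equiv> (\<lambda>x\<in>H. compose (carrier (modl L x)) (\<eta> x) (\<theta> x))"

lemma hmod_data_hopf_module: "is_hopf M \<Longrightarrow> hmod_data K X A M"
proof -
  assume "is_hopf M"
  then interpret hopf_module K X A M .
  interpret hopf_module_over K X A M ..
  show ?thesis ..
qed

lemma hmod_data_pair_hopf_module:
  "is_hopf M \<Longrightarrow> is_hopf N \<Longrightarrow> hmod_data_pair K X A M N"
  by (simp add: hmod_data_hopf_module hmod_data_pair.intro)

lemma hmod_hom_imp_map:
  "\<lbrakk>is_hopf M; is_hopf N; \<theta> \<in> homs M N\<rbrakk> \<Longrightarrow> is_map M N \<theta>"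
  using hmod_data_pair.hmod_hom_map[OF hmod_data_pair_hopf_module] by blast

lemma hmod_hom_closed:
  "\<lbrakk>\<theta> \<in> homs M N; x \<in> H; m \<in> carrier (modl M x)\<rbrakk> \<Longrightarrow> \<theta> x m \<in> carrier (modl N x)"
  by (auto simp: hmod_hom_def PiE_iff lin_hom_closed)

lemma hmod_hom_comp:
  assumes L: "is_hopf L" and M: "is_hopf M" and N: "is_hopf N"
    and \<theta>: "\<theta> \<in> homs L M" and \<eta>: "\<eta> \<in> homs M N"
  shows "hmod_comp L \<eta> \<theta> \<in> homs L N"
proof -
  note d = hmod_data_hopf_module[OF L] hmod_data_hopf_module[OF M] hmod_data_hopf_module[OF N]
  have "is_map L N (\<lambda>x m. \<eta> x (\<theta> x m))"
    by (rule hmod_map_comp[OF d hmod_hom_imp_map[OF L M \<theta>] hmod_hom_imp_map[OF M N \<eta>]])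
  from hmod_data_pair.hmod_restrict_hom[OF hmod_data_pair_hopf_module[OF L N] this]
  show ?thesis by (simp add: hmod_restrict_def compose_def)
qed

lemma hmod_hom_ident:
  assumes "is_hopf M"
  shows "(\<lambda>x\<in>H. \<lambda>m\<in>carrier (modl M x). m) \<in> homs M M"
  using hmod_data_pair.hmod_restrict_hom[OF hmod_data_pair_hopf_module[OF assms assms]
      hmod_map_id[OF hmod_data_hopf_module[OF assms]]]
  by (simp add: hmod_restrict_def)

lemma hmod_hom_ext:
  assumes "is_hopf M" "is_hopf N"
    and "\<theta> \<in> homs M N" "\<eta> \<in> homs M N"
    and "\<And>x m. \<lbrakk>x \<in> H; m \<in> carrier (modl M x)\<rbrakk> \<Longrightarrow> \<theta> x m = \<eta> x m"
  shows "\<theta> = \<eta>"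
  using hmod_data_pair.hmod_hom_eqI[OF hmod_data_pair_hopf_module[OF assms(1,2)] assms(3-5)] .

lemma is_category_HMod_cat:
  "is_category (HMod_cat K X A :: (('k, 'h, 'e, 'a, 'u) hmod, 'h \<Rightarrow> 'u \<Rightarrow> 'u) cat)"
proof (rule is_category.intro)
  fix L M N P :: "('k, 'h, 'e, 'a, 'u) hmod" and f g h
  assume "f \<in> Hom (HMod_cat K X A) L M"
  then show "Comp (HMod_cat K X A) L M P (Comp (HMod_cat K X A) M N P h g) f =
      Comp (HMod_cat K X A) L N P h (Comp (HMod_cat K X A) L M N g f)"
    by (auto simp: HMod_cat_def compose_def hmod_hom_closed intro!: restrict_ext)
next
  fix L M N :: "('k, 'h, 'e, 'a, 'u) hmod" and f g
  assume "L \<in> Ob (HMod_cat K X A)" "M \<in> Ob (HMod_cat K X A)" "N \<in> Ob (HMod_cat K X A)"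
    "f \<in> Hom (HMod_cat K X A) L M" "g \<in> Hom (HMod_cat K X A) M N"
  then show "Comp (HMod_cat K X A) L M N g f \<in> Hom (HMod_cat K X A) L N"
    unfolding HMod_cat_def by (simp add: hmod_hom_comp)
next
  fix L M :: "('k, 'h, 'e, 'a, 'u) hmod" and f
  assume "L \<in> Ob (HMod_cat K X A)" "M \<in> Ob (HMod_cat K X A)" and "f \<in> Hom (HMod_cat K X A) L M"
  then have L: "is_hopf L" and M: "is_hopf M" and f: "f \<in> homs L M"
    by (simp_all add: HMod_cat_def)
  show "Comp (HMod_cat K X A) L M M (Id (HMod_cat K X A) M) f = f"
    unfolding HMod_cat_def cat.simps
    by (rule hmod_hom_ext[OF L M hmod_hom_comp[OF L M M f hmod_hom_ident[OF M]] f])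
      (simp add: compose_eq hmod_hom_closed[OF f])
  show "Comp (HMod_cat K X A) L L M f (Id (HMod_cat K X A) L) = f"
    unfolding HMod_cat_def cat.simps
    by (rule hmod_hom_ext[OF L M hmod_hom_comp[OF L L M hmod_hom_ident[OF L] f] f])
      (simp add: compose_eq)
qed (simp add: HMod_cat_def hmod_hom_ident)

text \<open>Formulated outside the category, where \<open>M\<close> and \<open>N\<close> may have
  different element types; this is the situation of a Hopf module and the trivial one on its
  coinvariants.\<close>

lemma hmod_restrict_inverse:
  assumes M: "is_hopf M" and N: "is_hopf N"
    and f: "is_map M N f"
    and bij: "\<And>x. x \<in> H \<Longrightarrow> bij_betw (f x) (carrier (modl M x)) (carrier (modl N x))"
  shows "\<exists>\<eta>\<in>homs N M. \<forall>x\<in>H. (\<forall>m\<in>carrier (modl M x). \<eta> x (f x m) = m) \<and>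
    (\<forall>n\<in>carrier (modl N x). f x (\<eta> x n) = n)"
proof -
  interpret MN: hmod_data_pair K X A M N by (rule hmod_data_pair_hopf_module[OF M N])
  let ?\<eta> = "hmod_restrict X N (\<lambda>x. inv_into (carrier (modl M x)) (f x))"
  have "?\<eta> \<in> homs N M"
    by (rule hmod_data_pair.hmod_restrict_hom[OF hmod_data_pair_hopf_module[OF N M]
        MN.hmod_map_inv[OF f bij]])
  moreover have "?\<eta> x (f x m) = m" if "x \<in> H" "m \<in> carrier (modl M x)" for x m
    using bij[OF that(1)] that by (auto simp: hmod_restrict_def bij_betw_def)
  moreover have "f x (?\<eta> x n) = n" if "x \<in> H" "n \<in> carrier (modl N x)" for x n
    using bij_betw_inv_into_right[OF bij[OF that(1)]] that by (simp add: hmod_restrict_def)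
  ultimately show ?thesis by blast
qed

lemma iso_arrow_HMod_cat:
  assumes M: "is_hopf M" and N: "is_hopf N" and \<theta>: "\<theta> \<in> homs M N"
    and bij: "\<And>x. x \<in> H \<Longrightarrow> bij_betw (\<theta> x) (carrier (modl M x)) (carrier (modl N x))"
  shows "iso_arrow (HMod_cat K X A) M N \<theta>"
proof -
  from hmod_restrict_inverse[OF M N hmod_hom_imp_map[OF M N \<theta>] bij] obtain \<eta> where \<eta>: "\<eta> \<in>
      homs N M"
    and l: "\<And>x m. \<lbrakk>x \<in> H; m \<in> carrier (modl M x)\<rbrakk> \<Longrightarrow> \<eta> x (\<theta> x m) = m"
    and r: "\<And>x n. \<lbrakk>x \<in> H; n \<in> carrier (modl N x)\<rbrakk> \<Longrightarrow> \<theta> x (\<eta> x n) = n" by blast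
  have "hmod_comp M \<eta> \<theta> = (\<lambda>x\<in>H. \<lambda>m\<in>carrier (modl M x). m)"
    "hmod_comp N \<theta> \<eta> = (\<lambda>x\<in>H. \<lambda>n\<in>carrier (modl N x). n)"
    by (auto simp: compose_def l r intro!: restrict_ext)
  then show ?thesis using \<theta> \<eta> by (auto simp: iso_arrow_def HMod_cat_def intro!: bexI[of _ \<eta>])
qed

end

section \<open>The two functors\<close>

text \<open>\<open>cf\<close> and \<open>cl\<close> witness that the universe is large enough; the
  injections actually used are those chosen by \<open>code\<close>, which exist because of
  them.\<close>

locale hopf_universe = hopf_coalgebra K X A
  for K :: "'k ring" and X :: "('e, 'h) xmod" and A :: "('k, 'h, 'e, 'a) hcoalg" +
  fixes cf :: "('h \<Rightarrow> 'u) \<Rightarrow> 'u" and cl :: "(('a \<times> 'u) \<times> 'k) list \<Rightarrow> 'u"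
  assumes inj_cf: "inj cf" and inj_cl: "inj cl"
begin

text \<open>In these names \<open>c\<close> and \<open>d\<close> stand for coding and decoding,
  \<open>T\<close> and \<open>C\<close> for trivial modules and coinvariants.\<close>

abbreviation cT :: "('k, 'u) module \<Rightarrow> 'h \<Rightarrow> ('k, 'a, 'u) tens \<Rightarrow> 'u" where
  "cT V x \<equiv> code (carrier (AT x V))"

abbreviation dT :: "('k, 'u) module \<Rightarrow> 'h \<Rightarrow> 'u \<Rightarrow> ('k, 'a, 'u) tens" where
  "dT V x \<equiv> decode (carrier (AT x V))"

abbreviation cC :: "('k, 'h, 'e, 'a, 'u) hmod \<Rightarrow> ('h \<Rightarrow> 'u) \<Rightarrow> 'u" where
  "cC M \<equiv> code (carrier (coinv K X A M))"

abbreviation dC :: "('k, 'h, 'e, 'a, 'u) hmod \<Rightarrow> 'u \<Rightarrow> ('h \<Rightarrow> 'u)" where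
  "dC M \<equiv> decode (carrier (coinv K X A M))"

abbreviation Tob :: "('k, 'u) module \<Rightarrow> ('k, 'h, 'e, 'a, 'u) hmod" where
  "Tob V \<equiv> copy_hmod K X A (Triv V)"

abbreviation Cob :: "('k, 'h, 'e, 'a, 'u) hmod \<Rightarrow> ('k, 'u) module" where
  "Cob M \<equiv> copy_module (coinv K X A M)"

abbreviation UMod :: "(('k, 'u) module, 'u \<Rightarrow> 'u) cat" where
  "UMod \<equiv> Mod_cat K"

abbreviation UHM :: "(('k, 'h, 'e, 'a, 'u) hmod, 'h \<Rightarrow> 'u \<Rightarrow> 'u) cat" where
  "UHM \<equiv> HMod_cat K X A"

abbreviation TF :: "(('k, 'u) module, 'u \<Rightarrow> 'u, ('k, 'h, 'e, 'a, 'u) hmod, 'h \<Rightarrow> 'u \<Rightarrow> 'u) ftr" where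
  "TF \<equiv> triv_functor K X A"

abbreviation CF :: "(('k, 'h, 'e, 'a, 'u) hmod, 'h \<Rightarrow> 'u \<Rightarrow> 'u, ('k, 'u) module, 'u \<Rightarrow> 'u) ftr" where
  "CF \<equiv> coinv_functor K X A"

abbreviation Tarr :: "('k, 'u) module \<Rightarrow> ('k, 'u) module \<Rightarrow> ('u \<Rightarrow> 'u) \<Rightarrow> 'h \<Rightarrow> 'u \<Rightarrow> 'u" where
  "Tarr \<equiv> farr TF"

abbreviation Carr :: "('k, 'h, 'e, 'a, 'u) hmod \<Rightarrow> ('k, 'h, 'e, 'a,
    'u) hmod \<Rightarrow> ('h \<Rightarrow> 'u \<Rightarrow> 'u) \<Rightarrow> 'u \<Rightarrow> 'u" where
  "Carr \<equiv> farr CF"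

lemma inj_cT: "\<lbrakk>module K V; x \<in> H\<rbrakk> \<Longrightarrow> inj_on (cT V x) (carrier (AT x V))"
  by (rule code_inj_on[OF tensor_pair.tensor_embeds[OF tensor_pair inj_cl]]) simp_all

lemma inj_cC: "inj_on (cC M) (carrier (coinv K X A M))"
  using inj_cf by (intro code_inj_on exI[of _ cf]) (rule inj_on_subset, auto)

lemma modl_Tob [simp]: "modl (Tob V) x = copy_module (AT x V)"
  by (simp add: copy_hmod_def Let_def)

lemma hopf_module_Tob: "module K V \<Longrightarrow> is_hopf (Tob V)"
  by (rule copy_hmod_hopf_module[OF hopf_module_triv]) (simp_all add: inj_cT)

lemma cT_hmod_map:
  assumes "module K V" shows "is_map (Triv V) (Tob V) (cT V)"
proof -
  have "is_map (Triv V) (Tob V) (\<lambda>x. code (carrier (modl (Triv V) x)))"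
    by (rule code_hmod_map[OF hopf_module_triv[OF assms]]) (simp add: inj_cT assms)
  then show ?thesis by simp
qed

lemma cT_bij: "\<lbrakk>module K V; x \<in> H\<rbrakk> \<Longrightarrow>
    bij_betw (cT V x) (carrier (modl (Triv V) x)) (carrier (modl (Tob V) x))"
  by (simp add: bij_betw_def inj_cT)

lemma dT_hmod_map:
  assumes "module K V" shows "is_map (Tob V) (Triv V) (dT V)"
  using hmod_data_pair.hmod_map_inv[OF hmod_data_pair_hopf_module[OF hopf_module_triv[OF assms]
      hopf_module_Tob[OF assms]] cT_hmod_map[OF assms] cT_bij[OF assms]]
  by (simp add: decode_def)

lemma dT_bij: "\<lbrakk>module K V; x \<in> H\<rbrakk> \<Longrightarrow>
    bij_betw (dT V x) (carrier (modl (Tob V) x)) (carrier (AT x V))"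
  using bij_betw_inv_into[OF cT_bij, of V x] by (simp add: decode_def)

lemma dT_cT [simp]: "\<lbrakk>module K V; x \<in> H; t \<in> carrier (AT x V)\<rbrakk> \<Longrightarrow> dT V x (cT V x t) = t"
  using inj_cT[of V x] by (simp add: decode_def)

lemma module_Cob: "is_hopf M \<Longrightarrow> module K (Cob M)"
proof -
  assume "is_hopf M"
  then interpret hopf_module K X A M .
  interpret hopf_module_over K X A M ..
  show ?thesis by (rule module_copy_module[OF module_coinv inj_cC])
qed

lemma module_coinv': "is_hopf M \<Longrightarrow> module K (coinv K X A M)"
proof -
  assume "is_hopf M"
  then interpret hopf_module K X A M .
  interpret hopf_module_over K X A M ..
  show ?thesis by (rule module_coinv)
qed

lemma dC_cC [simp]: "m \<in> carrier (coinv K X A M) \<Longrightarrow> dC M (cC M m) = m"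
  using inj_cC[of M] by (simp add: decode_def)

section \<open>Functoriality of the trivial Hopf modules\<close>

lemma Tarr_hom:
  assumes V: "module K V" and W: "module K W" and \<alpha>: "\<alpha> \<in> lin_hom K V W"
  shows "Tarr V W \<alpha> \<in> homs (Tob V) (Tob W)"
proof -
  have lin: "linear_map K V W \<alpha>" using \<alpha> by (simp add: lin_hom_def)
  note h = hmod_data_hopf_module[OF hopf_module_Tob[OF V]] hmod_data_hopf_module[OF
      hopf_module_Tob[OF W]]
    hmod_data_triv[OF V] hmod_data_triv[OF W]
  have "is_map (Tob V) (Tob W) (\<lambda>x u. cT W x (id_map x V W \<alpha> (dT V x u)))"
    by (rule hmod_map_comp[OF h(1,4,2) hmod_map_comp[OF h(1,3,4) dT_hmod_map[OF V]
        hmod_map_triv[OF V W lin]]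
          cT_hmod_map[OF W]])
  from hmod_data_pair.hmod_restrict_hom[OF hmod_data_pair_hopf_module[OF hopf_module_Tob
      hopf_module_Tob] this]
  show ?thesis using V W
    by (simp add: hmod_restrict_def triv_functor_def copy_map_def triv_map_def cong: restrict_cong)
qed

text \<open>Every element of \<open>Tob V\<close> at \<open>x\<close> is a code
  \<open>cT V x t\<close>, so with this rule functoriality and naturality are computed on uncoded
  tensors.\<close>

lemma Tarr_code:
  assumes "module K V" "x \<in> H" "t \<in> carrier (AT x V)"
  shows "Tarr V W \<alpha> x (cT V x t) = cT W x (id_map x V W \<alpha> t)"
  using assms by (simp add: triv_functor_def copy_map_def triv_map_def)

lemma is_functor_triv: "is_functor UMod UHM
    TF"
proof (rule is_functor.intro[OF is_category_Mod_cat is_category_HMod_cat], unfold_locales)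
  have ob: "fobj TF V = Tob V" for V by (simp add: triv_functor_def)
  fix V :: "('k, 'u) module"
  assume "V \<in> Ob UMod"
  then have V: "module K V" by (simp add: Mod_cat_def)
  show "fobj TF V \<in> Ob UHM"
    by (simp add: ob HMod_cat_def hopf_module_Tob V)
  show "farr TF V V (cat.Id UMod V) = cat.Id UHM (fobj TF V)"
    unfolding ob HMod_cat_def Mod_cat_def cat.simps
  proof (rule hmod_hom_ext[OF hopf_module_Tob[OF V] hopf_module_Tob[OF V]
        Tarr_hom[OF V V lin_hom_ident[OF V]] hmod_hom_ident[OF hopf_module_Tob[OF V]]])
    fix x u assume [simp]: "x \<in> H" and "u \<in> carrier (modl (Tob V) x)"
    then obtain t where t: "t \<in> carrier (AT x V)" and u: "u = cT V x t" by auto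
    show "Tarr V V (\<lambda>v\<in>carrier V. v) x u = (\<lambda>x\<in>H. \<lambda>m\<in>carrier (modl (Tob V) x). m) x u"
      using t V by (simp add: u Tarr_code tensor_map_ident)
  qed
  fix W :: "('k, 'u) module" and \<alpha>
  assume "W \<in> Ob UMod" "\<alpha> \<in> Hom UMod V W"
  then have W: "module K W" and \<alpha>: "\<alpha> \<in> lin_hom K V W" by (simp_all add: Mod_cat_def)
  show "farr TF V W \<alpha> \<in> Hom UHM (fobj TF V) (fobj TF W)"
    by (simp add: ob HMod_cat_def Tarr_hom V W \<alpha>)
  fix U :: "('k, 'u) module" and \<beta>
  assume "U \<in> Ob UMod" "\<beta> \<in> Hom UMod W U"
  then have U: "module K U" and \<beta>: "\<beta> \<in> lin_hom K W U" by (simp_all add: Mod_cat_def)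
  show "farr TF V U (Comp UMod V W U \<beta> \<alpha>) =
      Comp UHM (fobj TF V) (fobj TF W) (fobj TF U) (farr TF W U \<beta>) (farr TF V W \<alpha>)"
    unfolding ob HMod_cat_def Mod_cat_def cat.simps
  proof (rule hmod_hom_ext[OF hopf_module_Tob[OF V] hopf_module_Tob[OF U]
        Tarr_hom[OF V U lin_hom_compose[OF V \<alpha> \<beta>]]
        hmod_hom_comp[OF hopf_module_Tob[OF V] hopf_module_Tob[OF W] hopf_module_Tob[OF U]
          Tarr_hom[OF V W \<alpha>] Tarr_hom[OF W U \<beta>]]])
    fix x u assume [simp]: "x \<in> H" and "u \<in> carrier (modl (Tob V) x)"
    then obtain t where t: "t \<in> carrier (AT x V)" and u: "u = cT V x t" by auto
    have lin: "linear_map K V W \<alpha>" "linear_map K W U \<beta>" using \<alpha> \<beta> by (simp_all add: lin_hom_def)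
    have "id_map x V U (compose (carrier V) \<beta> \<alpha>) t =
        id_map x V U (\<lambda>v. \<beta> (\<alpha> v)) t"
      using lin_hom_compose[OF V \<alpha> \<beta>] t V U
      by (intro tensor_map_cong) (simp_all add: compose_eq lin_hom_def)
    then show "Tarr V U (compose (carrier V) \<beta> \<alpha>) x u =
        hmod_comp (Tob V) (Tarr W U \<beta>) (Tarr V W \<alpha>) x u"
      using t V W U lin by (simp add: u Tarr_code compose_eq tensor_map_comp id_def)
  qed
qed

section \<open>Functoriality of the coinvariants\<close>

lemma Carr_hom:
  assumes M: "is_hopf M" and N: "is_hopf N" and \<theta>: "\<theta> \<in> homs M N"
  shows "Carr M N \<theta> \<in> lin_hom K (Cob M) (Cob N)"
proof -
  have "linear_map K (coinv K X A M) (coinv K X A N) (coinv_map K X A M \<theta>)"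
    by (rule linear_map_cong[OF coinv_fun_linear[OF M N hmod_hom_imp_map[OF M N \<theta>]]
        module_coinv'[OF M]])
      (simp add: coinv_map_def)
  from copy_map_lin_hom[OF module_coinv'[OF M] module_coinv'[OF N] inj_cC inj_cC this]
  show ?thesis by (simp add: coinv_functor_def)
qed

lemma Carr_code:
  assumes "m \<in> carrier (coinv K X A M)"
  shows "Carr M N \<theta> (cC M m) = cC N (\<lambda>x\<in>H. \<theta> x (m x))"
  using assms by (simp add: coinv_functor_def copy_map_def coinv_map_def)

lemma is_functor_coinv: "is_functor UHM UMod
    CF"
proof (rule is_functor.intro[OF is_category_HMod_cat is_category_Mod_cat], unfold_locales)
  have ob: "fobj CF M = Cob M" for M by (simp add: coinv_functor_def)
  fix M :: "('k, 'h, 'e, 'a, 'u) hmod"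
  assume "M \<in> Ob UHM"
  then have M: "is_hopf M" by (simp add: HMod_cat_def)
  interpret hopf_module K X A M by (rule M)
  interpret M: hopf_module_over K X A M ..
  show "fobj CF M \<in> Ob UMod" by (simp add: ob Mod_cat_def module_Cob M)
  show "farr CF M M (cat.Id UHM M) = cat.Id UMod (fobj CF M)"
    unfolding ob HMod_cat_def Mod_cat_def cat.simps
  proof (rule lin_hom_eqI[OF Carr_hom[OF M M hmod_hom_ident[OF M]] lin_hom_ident[OF module_Cob[OF
      M]]])
    fix u assume "u \<in> carrier (Cob M)"
    then obtain m where m: "m \<in> carrier (coinv K X A M)" and u: "u = cC M m" by auto
    have "(\<lambda>x\<in>H. (\<lambda>x\<in>H. \<lambda>m\<in>carrier (modl M x). m) x (m x)) = (\<lambda>x\<in>H. m x)"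
      using M.coinv_value[OF m] by (auto intro!: restrict_ext)
    then show "Carr M M (\<lambda>x\<in>H. \<lambda>m\<in>carrier (modl M x). m) u = (\<lambda>v\<in>carrier (Cob M). v) u"
      using m by (simp add: u Carr_code M.coinv_restrict cong: restrict_cong)
  qed
  fix N :: "('k, 'h, 'e, 'a, 'u) hmod" and \<theta>
  assume "N \<in> Ob UHM" "\<theta> \<in> Hom UHM M N"
  then have N: "is_hopf N" and \<theta>: "\<theta> \<in> homs M N" by (simp_all add: HMod_cat_def)
  show "farr CF M N \<theta> \<in> Hom UMod (fobj CF M) (fobj CF N)"
    by (simp only: ob Mod_cat_def cat.simps) (rule Carr_hom[OF M N \<theta>])
  fix L :: "('k, 'h, 'e, 'a, 'u) hmod" and \<eta>
  assume "L \<in> Ob UHM" "\<eta> \<in> Hom UHM N L"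
  then have L: "is_hopf L" and \<eta>: "\<eta> \<in> homs N L" by (simp_all add: HMod_cat_def)
  show "farr CF M L (Comp UHM M N L \<eta> \<theta>) =
      Comp UMod (fobj CF M) (fobj CF N) (fobj CF L) (farr CF N L \<eta>) (farr CF M N \<theta>)"
    unfolding ob HMod_cat_def Mod_cat_def cat.simps
  proof (rule lin_hom_eqI[OF Carr_hom[OF M L hmod_hom_comp[OF M N L \<theta> \<eta>]]
        lin_hom_compose[OF module_Cob[OF M] Carr_hom[OF M N \<theta>] Carr_hom[OF N L \<eta>]]])
    fix u assume u': "u \<in> carrier (Cob M)"
    then obtain m where m: "m \<in> carrier (coinv K X A M)" and u: "u = cC M m" by auto
    have n: "(\<lambda>x\<in>H. \<theta> x (m x)) \<in> carrier (coinv K X A N)"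
      by (rule coinv_fun_closed[OF M N hmod_hom_imp_map[OF M N \<theta>] m])
    have "(\<lambda>x\<in>H. hmod_comp M \<eta> \<theta> x (m x)) = (\<lambda>x\<in>H. \<eta> x ((\<lambda>x\<in>H. \<theta> x (m x)) x))"
      using M.coinv_value[OF m] by (auto simp: compose_eq intro!: restrict_ext)
    then show "Carr M L (hmod_comp M \<eta> \<theta>) u = compose (carrier (Cob M)) (Carr N L \<eta>) (Carr M N \<theta>) u"
      unfolding compose_eq[OF u'] using m n by (simp add: u Carr_code)
  qed
qed

section \<open>The unit and the counit of the equivalence\<close>

lemma unit_iso: "nat_isomorphic UMod UMod id_ftr
    (comp_ftr CF TF)"
proof -
  have obF: "fobj TF V = Tob V" for V by (simp add: triv_functor_def)
  have obG: "fobj CF M = Cob M" for M by (simp add: coinv_functor_def)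
  \<comment> \<open>Two codings occur: \<open>cT\<close> moves each component into the universe,
    which gives a coinvariant family of \<open>Tob V\<close>, and \<open>cC\<close> in
    \<open>\<tau>\<close> then encodes the family as a whole.\<close>
  define \<eta> where "\<eta> V v = (\<lambda>x\<in>H. cT V x (ten x V (un x) v))" for V v
  define \<tau> where "\<tau> V = (\<lambda>v\<in>carrier V. cC (Tob V) (\<eta> V v))" for V
  have \<eta>: "linear_map K V (coinv K X A (Tob V)) (\<eta> V)"
      "bij_betw (\<eta> V) (carrier V) (carrier (coinv K X A (Tob V)))"
    if V: "module K V" for V
  proof -
    note TV = hopf_module_triv[OF V] hopf_module_Tob[OF V] cT_hmod_map[OF V]
    \<comment> \<open>Factors \<open>\<eta> V\<close> into the isomorphism of
      \<open>coinv_eta\<close> and the map induced on coinvariants by the coding, so that linearity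
      and bijectivity come from the two factors.\<close>
    have \<eta>: "\<eta> V = (\<lambda>v. \<lambda>x\<in>H. cT V x ((\<lambda>x\<in>H. ten x V (un x) v) x))"
      by (rule ext) (simp add: \<eta>_def cong: restrict_cong)
    show "linear_map K V (coinv K X A (Tob V)) (\<eta> V)" unfolding \<eta>
      by (rule linear_map_comp[OF coinv_fun_linear[OF TV] coinv_eta(1)[OF V]])
    show "bij_betw (\<eta> V) (carrier V) (carrier (coinv K X A (Tob V)))" unfolding \<eta>
      using bij_betw_trans[OF coinv_eta(2)[OF V] coinv_fun_bij[OF TV cT_bij[OF V]]]
      by (simp add: comp_def)
  qed
  have \<tau>_hom: "\<tau> V \<in> lin_hom K V (Cob (Tob V))" if V: "module K V" for V
    using linear_map_cong[OF linear_map_comp[OF code_linear[OF module_coinv'[OF hopf_module_Tob[OF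
        V]] inj_cC] \<eta>(1)[OF V]] V]
    by (simp add: lin_hom_def \<tau>_def)
  have \<tau>_iso: "iso_arrow UMod V (Cob (Tob V)) (\<tau> V)" if V: "module K V" for V
  proof (rule iso_arrow_Mod_cat[OF V module_Cob[OF hopf_module_Tob[OF V]] \<tau>_hom[OF V]])
    have "bij_betw (cC (Tob V) \<circ> \<eta> V) (carrier V) (carrier (Cob (Tob V)))"
      by (rule bij_betw_trans[OF \<eta>(2)[OF V]]) (simp add: bij_betw_def inj_cC)
    then show "bij_betw (\<tau> V) (carrier V) (carrier (Cob (Tob V)))"
      by (rule bij_betw_cong[THEN iffD1, rotated]) (simp add: \<tau>_def)
  qed
  have nat: "compose (carrier V) (\<tau> W) \<alpha> = compose (carrier V) (Carr (Tob V) (Tob W) (Tarr V W \<alpha>))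
      (\<tau> V)"
    if V: "module K V" and W: "module K W" and \<alpha>: "\<alpha> \<in> lin_hom K V W" for V W \<alpha>
  proof -
    have "\<tau> W (\<alpha> v) = Carr (Tob V) (Tob W) (Tarr V W \<alpha>) (\<tau> V v)" if v: "v \<in> carrier V" for v
    proof -
      have \<alpha>v: "\<alpha> v \<in> carrier W" and lin: "linear_map K V W \<alpha>"
        using lin_hom_closed[OF \<alpha> v] \<alpha> by (simp_all add: lin_hom_def)
      have "(\<lambda>x\<in>H. Tarr V W \<alpha> x (\<eta> V v x)) = \<eta> W (\<alpha> v)"
        using v V W lin by (auto simp: \<eta>_def Tarr_code intro!: restrict_ext)
      moreover have "\<eta> V v \<in> carrier (coinv K X A (Tob V))" by (rule linear_map_closed[OF \<eta>(1)[OF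
          V] v])
      ultimately show ?thesis using v \<alpha>v by (simp add: \<tau>_def Carr_code)
    qed
    then show ?thesis by (auto simp: compose_def intro!: restrict_ext)
  qed
  show ?thesis
    unfolding nat_isomorphic_def
  proof (intro conjI exI[of _ \<tau>] ballI)
    show "is_functor UMod UMod (comp_ftr CF TF)"
      by (rule is_functor_comp[OF is_functor_triv is_functor_coinv])
    show "is_functor UMod UMod id_ftr" by (rule is_functor_id[OF is_category_Mod_cat])
    fix V assume "V \<in> Ob UMod"
    then have V: "module K V" by (simp add: Mod_cat_def)
    show "iso_arrow UMod (fobj id_ftr V) (fobj (comp_ftr CF TF) V) (\<tau> V)"
      using \<tau>_iso[OF V] by (simp only: comp_ftr_def id_ftr_def ftr.simps obF obG)
    fix W \<alpha> assume "W \<in> Ob UMod" "\<alpha> \<in> Hom UMod V W"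
    then have W: "module K W" and \<alpha>: "\<alpha> \<in> lin_hom K V W" by (simp_all add: Mod_cat_def)
    show "Comp UMod (fobj id_ftr V) (fobj id_ftr W) (fobj (comp_ftr CF TF) W) (\<tau> W) (farr id_ftr V
        W \<alpha>) =
        Comp UMod (fobj id_ftr V) (fobj (comp_ftr CF TF) V) (fobj (comp_ftr CF TF) W)
          (farr (comp_ftr CF TF) V W \<alpha>) (\<tau> V)"
      using nat[OF V W \<alpha>] by (simp only: comp_ftr_def id_ftr_def ftr.simps obF obG Mod_cat_def
          cat.simps)
  qed
qed

lemma counit_iso: "nat_isomorphic UHM UHM
    (comp_ftr TF CF) id_ftr"
proof -
  have obF: "fobj TF V = Tob V" for V by (simp add: triv_functor_def)
  have obG: "fobj CF M = Cob M" for M by (simp add: coinv_functor_def)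
  \<comment> \<open>The second tensor factor lies in the copy \<open>Cob M\<close> and has to be
    decoded before \<open>kappa\<close> applies; the tensor itself is decoded only in
    \<open>\<tau>\<close>.\<close>
  define \<kappa> where "\<kappa> M x t = hopf_module_over.kappa K X A M x
      (id_map x (Cob M) (coinv K X A M) (dC M) t)" for M x t
  define \<tau> where "\<tau> M = hmod_restrict X (Tob (Cob M)) (\<lambda>x u. \<kappa> M x (dT (Cob M) x u))" for M
  have dC: "linear_map K (Cob M) (coinv K X A M) (dC M)"
      "bij_betw (dC M) (carrier (Cob M)) (carrier (coinv K X A M))"
    if M: "is_hopf M" for M
    using decode_linear[OF module_coinv'[OF M] inj_cC] decode_bij[OF module_coinv'[OF M] inj_cC]
        by auto
  \<comment> \<open>The first two facts give the isomorphism, the last two its naturality; all of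
    them need \<open>hopf_module_over\<close> interpreted at the quantified
    \<open>M\<close>.\<close>
  have map: "is_map (Tob (Cob M)) M (\<lambda>x u. \<kappa> M x (dT (Cob M) x u))"
      "\<And>x. x \<in> H \<Longrightarrow> bij_betw (\<lambda>u. \<kappa> M x (dT (Cob M) x u)) (carrier (modl (Tob (Cob M)) x)) (carrier
          (modl M x))"
      "\<And>x a w. \<lbrakk>x \<in> H; a \<in> carrier (alg A x); w \<in> carrier (Cob M)\<rbrakk> \<Longrightarrow>
        \<kappa> M x (ten x (Cob M) a w) = hact M x (ten x (modl M x) a (dC M w x))"
      "\<And>x. x \<in> H \<Longrightarrow> linear_map K (AT x (Cob M)) (modl M x) (\<kappa> M x)"
    if M: "is_hopf M" for M
  proof -
    interpret hopf_module K X A M by (rule M)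
    interpret M: hopf_module_over K X A M ..
    have C: "module K (coinv K X A M)" and C': "module K (Cob M)"
      using module_coinv'[OF M] module_Cob[OF M] .
    note h = hmod_data_hopf_module[OF hopf_module_Tob[OF C']] hmod_data_triv[OF C']
        hmod_data_triv[OF C]
      hmod_data_hopf_module[OF M]
    show "is_map (Tob (Cob M)) M (\<lambda>x u. \<kappa> M x (dT (Cob M) x u))"
      unfolding \<kappa>_def
      by (rule hmod_map_comp[OF h(1,3,4) hmod_map_comp[OF h(1,2,3) dT_hmod_map[OF C']
            hmod_map_triv[OF C' C dC(1)[OF M]]] M.kappa_hmod_map])
    show "bij_betw (\<lambda>u. \<kappa> M x (dT (Cob M) x u)) (carrier (modl (Tob (Cob M)) x)) (carrier (modl M
        x))"
      if x: "x \<in> H" for x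
      using bij_betw_trans[OF dT_bij[OF C' x] bij_betw_trans[OF
          tensor_map_id_bij[OF x C' C dC(1)[OF M] dC(2)[OF M]] M.kappa_bij[OF x]]]
      by (simp add: \<kappa>_def comp_def del: modl_Tob)
    show "\<kappa> M x (ten x (Cob M) a w) = hact M x (ten x (modl M x) a (dC M w x))"
      if "x \<in> H" "a \<in> carrier (alg A x)" "w \<in> carrier (Cob M)" for x a w
      using that C C' dC[OF M] linear_map_closed[OF dC(1)[OF M] that(3)]
      by (simp add: \<kappa>_def del: copy_module_simps)
    show "linear_map K (AT x (Cob M)) (modl M x) (\<kappa> M x)" if "x \<in> H" for x
      unfolding \<kappa>_def by (rule linear_map_eta) (simp add: that C C' dC[OF M])
  qed
  have \<tau>_hom: "\<tau> M \<in> homs (Tob (Cob M)) M" if M: "is_hopf M" for M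
    unfolding \<tau>_def
    by (rule hmod_data_pair.hmod_restrict_hom[OF hmod_data_pair_hopf_module[OF hopf_module_Tob[OF
        module_Cob[OF M]] M]
        map(1)[OF M]])
  have \<tau>_iso: "iso_arrow UHM (Tob (Cob M)) M (\<tau> M)" if M: "is_hopf M" for M
  proof (rule iso_arrow_HMod_cat[OF hopf_module_Tob[OF module_Cob[OF M]] M \<tau>_hom[OF M]])
    fix x assume x: "x \<in> H"
    show "bij_betw (\<tau> M x) (carrier (modl (Tob (Cob M)) x)) (carrier (modl M x))"
      by (rule bij_betw_cong[THEN iffD1, OF _ map(2)[OF M x]]) (simp add: \<tau>_def hmod_restrict_def x)
  qed
  have nat: "hmod_comp (Tob (Cob M)) (\<tau> N) (Tarr (Cob M) (Cob N) (Carr M N \<theta>)) =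
      hmod_comp (Tob (Cob M)) \<theta> (\<tau> M)"
    if M: "is_hopf M" and N: "is_hopf N" and \<theta>: "\<theta> \<in>
        homs M N" for M N \<theta>
  proof (rule hmod_hom_ext)
    note C = module_Cob[OF M] module_Cob[OF N]
    note T = hopf_module_Tob[OF C(1)] hopf_module_Tob[OF C(2)]
    show "is_hopf (Tob (Cob M))" "is_hopf N" by (rule T(1)) (rule N)
    show "hmod_comp (Tob (Cob M)) (\<tau> N) (Tarr (Cob M) (Cob N) (Carr M N \<theta>)) \<in>
        homs (Tob (Cob M)) N"
      by (rule hmod_hom_comp[OF T N Tarr_hom[OF C Carr_hom[OF M N \<theta>]] \<tau>_hom[OF N]])
    show "hmod_comp (Tob (Cob M)) \<theta> (\<tau> M) \<in> homs (Tob (Cob M)) N"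
      by (rule hmod_hom_comp[OF T(1) M N \<tau>_hom[OF M] \<theta>])
    fix x u assume x [simp]: "x \<in> H" and u': "u \<in> carrier (modl (Tob (Cob M)) x)"
    then obtain t where t: "t \<in> carrier (AT x (Cob M))" and u: "u = cT (Cob M) x t" by auto
    interpret hopf_module K X A M by (rule M)
    interpret M: hopf_module_over K X A M ..
    interpret N: hopf_module K X A N by (rule N)
    interpret N: hopf_module_over K X A N ..
    let ?g = "Carr M N \<theta>"
    have g: "linear_map K (Cob M) (Cob N) ?g" using Carr_hom[OF M N \<theta>] by (simp add: lin_hom_def)
    have \<theta>': "is_map M N \<theta>" by (rule hmod_hom_imp_map[OF M N \<theta>])
    have \<theta>x: "linear_map K (modl M x) (modl N x) (\<theta> x)" using \<theta>' x unfolding hmod_map_def by blast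
    \<comment> \<open>Naturality before the tensors are coded; on a pure tensor it says that
      \<open>\<theta> x\<close> commutes with the action on a component of a coinvariant
      family.\<close>
    have "\<kappa> N x (id_map x (Cob M) (Cob N) ?g t) = \<theta> x (\<kappa> M x t)"
    proof (rule tensor_eqI[OF t _ C(1), of "modl N x"], goal_cases)
      case (3)
      show ?case by (rule linear_map_comp[OF map(4)[OF N x]]) (use C g in simp)
    next
      case 4
      show ?case by (rule linear_map_comp[OF \<theta>x map(4)[OF M x]])
    next
      case (5 a w)
      then obtain m where m: "m \<in> carrier (coinv K X A M)" and w: "w = cC M m" by auto
      have n: "(\<lambda>x\<in>H. \<theta> x (m x)) \<in> carrier (coinv K X A N)"
        by (rule coinv_fun_closed[OF M N \<theta>' m])
      have gw: "?g w \<in> carrier (Cob N)" by (rule linear_map_closed[OF g 5(2)])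
      have dgw: "dC N (?g w) x = \<theta> x (dC M w x)" using m n by (simp add: w Carr_code)
      have "hact N x (ten x (modl N x) a (\<theta> x (m x))) = \<theta> x (hact M x (ten x (modl M x) a (m x)))"
        using \<theta>' x 5(1) M.coinv_value[OF m x] unfolding hmod_map_def by blast
      then show ?case
        using C g 5 gw m dgw map(3)[OF N x 5(1) gw] map(3)[OF M x 5(1,2)]
        by (simp add: w del: copy_module_simps)
    qed simp_all
    moreover have "id_map x (Cob M) (Cob N) ?g t \<in> carrier (AT x (Cob N))"
      using C g t by simp
    ultimately show "hmod_comp (Tob (Cob M)) (\<tau> N) (Tarr (Cob M) (Cob N) ?g) x u =
        hmod_comp (Tob (Cob M)) \<theta> (\<tau> M) x u"
      unfolding restrict_apply'[OF x] compose_eq[OF u'] using t C x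
      by (simp add: u Tarr_code \<tau>_def hmod_restrict_def)
  qed
  show ?thesis
    unfolding nat_isomorphic_def
  proof (intro conjI exI[of _ \<tau>] ballI)
    show "is_functor UHM UHM (comp_ftr TF CF)"
      by (rule is_functor_comp[OF is_functor_coinv is_functor_triv])
    show "is_functor UHM UHM id_ftr" by (rule is_functor_id[OF is_category_HMod_cat])
    fix M assume "M \<in> Ob UHM"
    then have M: "is_hopf M" by (simp add: HMod_cat_def)
    show "iso_arrow UHM (fobj (comp_ftr TF CF) M) (fobj id_ftr M) (\<tau> M)"
      using \<tau>_iso[OF M] by (simp only: comp_ftr_def id_ftr_def ftr.simps obF obG)
    fix N \<theta> assume "N \<in> Ob UHM" "\<theta> \<in> Hom UHM M N"
    then have N: "is_hopf N" and \<theta>: "\<theta> \<in> homs M N" by (simp_all add: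
        HMod_cat_def)
    show "Comp UHM (fobj (comp_ftr TF CF) M) (fobj (comp_ftr TF CF) N) (fobj id_ftr N) (\<tau> N) (farr
        (comp_ftr TF CF) M N \<theta>) =
        Comp UHM (fobj (comp_ftr TF CF) M) (fobj id_ftr M) (fobj id_ftr N) (farr id_ftr M N \<theta>) (\<tau>
            M)"
      using nat[OF M N \<theta>] by (simp only: comp_ftr_def id_ftr_def ftr.simps obF obG HMod_cat_def
          cat.simps)
  qed
qed

end

text \<open>\<open>hmod_isomorphic\<close> compares modules of different element types, so
  \<open>kappa\<close> serves directly, without any coding and independently of a universe.\<close>

lemma (in hopf_coalgebra) hmod_isomorphic_triv_coinv:
  assumes M: "is_hopf M"
  shows "hmod_isomorphic K X A M (triv K X A (coinv K X A M))"
proof -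
  interpret hopf_module K X A M by (rule M)
  interpret M: hopf_module_over K X A M ..
  let ?T = "triv K X A (coinv K X A M)"
  have T: "is_hopf ?T" by (rule hopf_module_triv) simp
  have bij: "bij_betw (M.kappa x) (carrier (modl ?T x)) (carrier (modl M x))" if "x \<in> H" for x
    using M.kappa_bij[OF that] by simp
  from hmod_restrict_inverse[OF T M M.kappa_hmod_map bij]
  obtain \<eta> where \<eta>: "\<eta> \<in> homs M ?T"
    and inv: "\<forall>x\<in>H. (\<forall>t\<in>carrier (modl ?T x). \<eta> x (M.kappa x t) = t) \<and>
      (\<forall>m\<in>carrier (modl M x). M.kappa x (\<eta> x m) = m)"
    by (rule bexE)
  have l: "\<eta> x (M.kappa x t) = t" if "x \<in> H" "t \<in> carrier (modl ?T x)" for x t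
    using bspec[OF conjunct1[OF bspec[OF inv that(1)]] that(2)] .
  have r: "M.kappa x (\<eta> x m) = m" if "x \<in> H" "m \<in> carrier (modl M x)" for x m
    using bspec[OF conjunct2[OF bspec[OF inv that(1)]] that(2)] .
  let ?\<kappa> = "hmod_restrict X ?T M.kappa"
  have \<kappa>: "?\<kappa> \<in> homs ?T M"
    by (rule hmod_data_pair.hmod_restrict_hom[OF hmod_data_pair_hopf_module[OF T M]
        M.kappa_hmod_map])
  have eq: "?\<kappa> x t = M.kappa x t" if "x \<in> H" "t \<in> carrier (modl ?T x)" for x t
    using that by (simp add: hmod_restrict_def)
  show ?thesis
    unfolding hmod_isomorphic_def
  proof (rule bexI[OF _ \<eta>], rule bexI[OF _ \<kappa>], intro ballI conjI)
    fix x m assume x: "x \<in> H" and m: "m \<in> carrier (modl M x)"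
    show "?\<kappa> x (\<eta> x m) = m" using eq[OF x hmod_hom_closed[OF \<eta> x m]] r[OF x m] by (rule trans)
  next
    fix x t assume x: "x \<in> H" and t: "t \<in> carrier (modl ?T x)"
    show "\<eta> x (?\<kappa> x t) = t" unfolding eq[OF x t] by (rule l[OF x t])
  qed
qed

theorem theorem9p1:
  fixes K :: "'k ring"
    and X :: "('e, 'h) xmod"
    and A :: "('k, 'h, 'e, 'a) hcoalg"
    and cf :: "('h \<Rightarrow> 'u) \<Rightarrow> 'u"
    and cl :: "(('a \<times> 'u) \<times> 'k) list \<Rightarrow> 'u"
  assumes "cring K"
    and "\<one>\<^bsub>K\<^esub> \<noteq> \<zero>\<^bsub>K\<^esub>"
    and "crossed_module X"
    and "hopf_coalgebra K X A"
    and "inj cf"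
    and "inj cl"
  shows "is_equivalence (Mod_cat K) (HMod_cat K X A)
           (triv_functor K X A ::
             (('k, 'u) module, 'u \<Rightarrow> 'u, ('k, 'h, 'e, 'a, 'u) hmod, 'h \<Rightarrow> 'u \<Rightarrow> 'u) ftr)
       \<and> is_equivalence (HMod_cat K X A) (Mod_cat K)
           (coinv_functor K X A ::
             (('k, 'h, 'e, 'a, 'u) hmod, 'h \<Rightarrow> 'u \<Rightarrow> 'u, ('k, 'u) module, 'u \<Rightarrow> 'u) ftr)
       \<and> quasi_inverse (Mod_cat K) (HMod_cat K X A)
           (triv_functor K X A ::
             (('k, 'u) module, 'u \<Rightarrow> 'u, ('k, 'h, 'e, 'a, 'u) hmod, 'h \<Rightarrow> 'u \<Rightarrow> 'u) ftr)
           (coinv_functor K X A)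
       \<and> (\<forall>M :: ('k, 'h, 'e, 'a, 'm) hmod. hopf_module K X A M \<longrightarrow>
            hmod_isomorphic K X A M (triv K X A (coinv K X A M)))"
proof -
  interpret hopf_universe K X A cf cl
    using assms(4-6) by (intro hopf_universe.intro hopf_universe_axioms.intro)
  let ?F = "triv_functor K X A ::
      (('k, 'u) module, 'u \<Rightarrow> 'u, ('k, 'h, 'e, 'a, 'u) hmod, 'h \<Rightarrow> 'u \<Rightarrow> 'u) ftr"
  let ?G = "coinv_functor K X A ::
      (('k, 'h, 'e, 'a, 'u) hmod, 'h \<Rightarrow> 'u \<Rightarrow> 'u, ('k, 'u) module, 'u \<Rightarrow> 'u) ftr"
  have FG: "quasi_inverse (Mod_cat K) (HMod_cat K X A) ?F ?G"
    unfolding quasi_inverse_def using is_functor_triv is_functor_coinv unit_iso counit_iso by blast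
  have GF: "quasi_inverse (HMod_cat K X A) (Mod_cat K) ?G ?F"
    unfolding quasi_inverse_def
    using is_functor_triv is_functor_coinv unit_iso[THEN nat_isomorphic_sym]
      counit_iso[THEN nat_isomorphic_sym] by blast
  show ?thesis
    unfolding is_equivalence_def using FG GF hmod_isomorphic_triv_coinv by blast
qed

end
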